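(* Let $k=\mathbb Z[\delta]$ with $\delta$ an indeterminate, $l\ge1$, $n\ge0$, and $\underline\lambda\in\Lambda(P^l_n)$. Then the determinant of the Gram matrix of the contravariant form $(-,-)_e$ on $\mathcal S^n_{\underline\lambda}$ (with respect to a $k$-basis) is nonzero.
   Context: Partitions and products: for $n,m\ge 0$ let $\mathsf P_{n,m}$ be the set of set partitions of the disjoint union $\{1,\dots,n\}\cup\{1',\dots,m'\}$. For $p\in\mathsf P_{n,m}$, $p'\in\mathsf P_{m,r}$: rename each $i'$ of $p$ and each $i\in\{1,\dots,m\}$ of $p'$ as $i''$; take the finest partition of $\{1,\dots,n\}\cup\{1'',\dots,m''\}\cup\{1',\dots,r'\}$ such that every part of $p$ and of $p'$ is contained in a part; let $c$ be the number of its parts contained in $\{1'',\dots,m''\}$; delete all $i''$ (and empty parts) to get $q$; then $pp'=\delta^cq$. $p\otimes p'$ is side-by-side juxtaposition ($p'$ to the right). A part $s$ is $l$-tone if $|s\cap\{1,\dots,n\}|\equiv|s\cap\{1',\dots,m'\}|$ mod $l$; a partition is $l$-tone if all its parts are. The tonal partition algebra $P^l_n$ is the $k$-algebra with basis the set $\mathsf P^l_n$ of $l$-tone partitions in $\mathsf P_{n,n}$. The involutive antiautomorphism $op$ of $P^l_n$ is the $k$-linear map exchanging $i\leftrightarrow i'$ in each partition. Propagating vector: a part is propagating if it meets both rows. For $p\in\mathsf P^l_n$ let $\#^i(p)$ ($1\le i\le l$) be the number of propagating parts $s$ with $|s\cap\{1,\dots,n\}|\equiv i$ mod $l$, and $\#^-(p)=(\#^1(p),\dots,\#^l(p))$.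 Index poset: for $\mathbf m=(m_1,\dots,m_l)$ let $r_{\mathbf m}=\sum_i i\,m_i$; $\gamma^{l,n}=\{\mathbf m\in\mathbb N_0^l:(n-r_{\mathbf m})/l\in\mathbb N_0\}$. With $\epsilon_i$ the standard basis of $\mathbb Z^l$, indices read mod $l$ in $\{1,\dots,l\}$, let $v_{ij}=\epsilon_{i+j}-\epsilon_i-\epsilon_j$ ($1\le i\le j\le l$); $\mathbf m\ge\mathbf m'$ iff $\mathbf m'-\mathbf m$ is a nonnegative integral combination of the $v_{ij}$. Elements and quotients: $b^i\in\mathsf P_{i,i}$ has the single part $\{1,\dots,i,1',\dots,i'\}$; $w\in\mathsf P_{l,0}$, $w^\star\in\mathsf P_{0,l}$ are the one-part partitions; $a^{\mathbf m}=(b^l)^{\otimes m_l}\otimes\cdots\otimes(b^1)^{\otimes m_1}\otimes(ww^\star)^{\otimes(n-r_{\mathbf m})/l}$ (so $(a^{\mathbf m})^{op}=a^{\mathbf m}$). $I^{<\mathbf m}=\sum_{\mathbf m'<\mathbf m}P^l_na^{\mathbf m'}P^l_n$ (stable under $op$) and $P^{\mathbf m}_n=P^l_n/I^{<\mathbf m}$, with induced $op$. Standard modules: let $S_{\mathbf m}=S_{m_1}\times\cdots\times S_{m_l}$. The left ideal $P^{\mathbf m}_na^{\mathbf m}$ has basis the classes of those $p\in\mathsf P^l_n$ with $\#^-(p)=\mathbf m$ and with the same restriction to the bottom row, and the same non-propagating bottom parts, as $a^{\mathbf m}$. It is a free right $kS_{\mathbf m}$-module by permuting, for each $i$, the $m_i$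 bottom blocks of size $i$ attached to propagating parts: if $B_{i,1},\dots,B_{i,m_i}$ are these blocks from left to right, then in $p\cdot\sigma$ the propagating part of $p$ with bottom block $B_{i,\sigma_i(j)}$ is given the bottom block $B_{i,j}$. Symmetrically (applying $op$), $a^{\mathbf m}P^{\mathbf m}_n$ is a left $kS_{\mathbf m}$-module with $\sigma\cdot x=(x^{op}\cdot\sigma^{-1})^{op}$. $\Lambda_{\mathbf m}$ is the set of $l$-tuples of integer partitions $(\lambda^1,\dots,\lambda^l)$ with $\lambda^i\vdash m_i$; $\Lambda(P^l_n)=\bigsqcup_{\mathbf m\in\gamma^{l,n}}\Lambda_{\mathbf m}$. For $\underline\lambda\in\Lambda_{\mathbf m}$, $e=e_{\underline\lambda}\in\mathbb ZS_{\mathbf m}$ is a chosen element with $e=e^{op}$ (where $\sigma^{op}=\sigma^{-1}$), with $exe=c_xe$, $c_x\in k$, for all $x\in kS_{\mathbf m}$, and such that $kS_{\mathbf m}e$ is the Specht module of $S_{\mathbf m}$ labelled by $\underline\lambda$ (outer product of Specht modules of the factors), which is $k$-free. The standard module is $\mathcal S^n_{\underline\lambda}=P^{\mathbf m}_na^{\mathbf m}\cdot e_{\underline\lambda}\cong P^{\mathbf m}_na^{\mathbf m}\otimes_{kS_{\mathbf m}}kS_{\mathbf m}e_{\underline\lambda}$, which is $k$-free of finite rank. The contravariant form on it is the $k$-bilinear form determined by $(xa^{\mathbf m}e)^{op}(ya^{\mathbf m}e)=e\,(a^{\mathbf m}x^{op}ya^{\mathbf m})\,e=(xa^{\mathbf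 m}e,ya^{\mathbf m}e)_e\;a^{\mathbf m}e$ in $P^{\mathbf m}_n$. *)

theory Defs
  imports
    "HOL-Algebra.QuotRing"
    "HOL-Combinatorics.Permutations"
    "HOL-Library.Disjoint_Sets"
    "HOL-Library.FuncSet"
    "Jordan_Normal_Form.Determinant"
    "Jordan_Normal_Form.VS_Connect"
begin

section \<open>Free modules and bilinear products over the integer polynomial ring\<close>

text \<open>
  The ground ring is \<^typ>\<open>int poly\<close>, its variable being the parameter \<open>\<delta>\<close>; as an argument of
  the locale-based notions of \<^theory>\<open>VectorSpace.LinearCombinations\<close> it is \<^term>\<open>class_ring\<close>.
  The free module on a set \<open>X\<close> consists of the functions vanishing outside \<open>X\<close>. Its fields
  \<^const>\<open>mult\<close> and \<^const>\<open>one\<close> are irrelevant unless overwritten by an algebra structure.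
\<close>

definition free_mod :: "'a set \<Rightarrow> (int poly, 'a \<Rightarrow> int poly) module" where
  "free_mod X = \<lparr>carrier = {f. \<forall>x. x \<notin> X \<longrightarrow> f x = 0},
     mult = undefined, one = undefined,
     zero = (\<lambda>x. 0), add = (\<lambda>f g x. f x + g x), smult = (\<lambda>c f x. c * f x)\<rparr>"

definition basis_vec :: "'a \<Rightarrow> 'a \<Rightarrow> int poly" where
  "basis_vec x = (\<lambda>y. if y = x then 1 else 0)"

text \<open>The linear map on the free module on \<open>X\<close> and the bilinear map on the free modules on \<open>X\<close>
  and \<open>Y\<close> with prescribed values on basis elements.\<close>

definition lin_ext :: "'a set \<Rightarrow> ('a \<Rightarrow> 'b \<Rightarrow> int poly) \<Rightarrow> ('a \<Rightarrow> int poly) \<Rightarrow> 'b \<Rightarrow> int poly" where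
  "lin_ext X \<mu> f = (\<lambda>z. \<Sum>x\<in>X. f x * \<mu> x z)"

definition bilin_ext :: "'a set \<Rightarrow> 'b set \<Rightarrow> ('a \<Rightarrow> 'b \<Rightarrow> 'c \<Rightarrow> int poly)
    \<Rightarrow> ('a \<Rightarrow> int poly) \<Rightarrow> ('b \<Rightarrow> int poly) \<Rightarrow> 'c \<Rightarrow> int poly" where
  "bilin_ext X Y \<mu> f g = (\<lambda>z. \<Sum>x\<in>X. \<Sum>y\<in>Y. f x * g y * \<mu> x y z)"

abbreviation kspan :: "(int poly, 'a) module \<Rightarrow> 'a set \<Rightarrow> 'a set" where
  "kspan M \<equiv> LinearCombinations.module.span class_ring M"

definition is_basis :: "(int poly, 'a) module \<Rightarrow> 'a list \<Rightarrow> bool" where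
  "is_basis M bs \<longleftrightarrow> distinct bs \<and> set bs \<subseteq> carrier M \<and>
     \<not> LinearCombinations.module.lin_dep class_ring M (set bs) \<and> kspan M (set bs) = carrier M"


section \<open>Partition diagrams\<close>

text \<open>\<open>Top i\<close>, \<open>Bot i\<close> and \<open>Mid i\<close> are the vertices \<open>i\<close>, \<open>i'\<close> and \<open>i''\<close>; the last kind
  only occurs while two diagrams are being composed.\<close>

datatype vertex = Top nat | Mid nat | Bot nat

type_synonym diagram = "vertex set set"

definition diagrams :: "nat \<Rightarrow> nat \<Rightarrow> diagram set" where
  "diagrams n m = {p. partition_on (Top ` {1..n} \<union> Bot ` {1..m}) p}"

fun bot_to_mid :: "vertex \<Rightarrow> vertex" where
  "bot_to_mid (Bot i) = Mid i"
| "bot_to_mid (Top i) = Top i"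
| "bot_to_mid (Mid i) = Mid i"

fun top_to_mid :: "vertex \<Rightarrow> vertex" where
  "top_to_mid (Top i) = Mid i"
| "top_to_mid (Bot i) = Bot i"
| "top_to_mid (Mid i) = Mid i"

definition stacked :: "diagram \<Rightarrow> diagram \<Rightarrow> vertex set set" where
  "stacked p p' = (`) bot_to_mid ` p \<union> (`) top_to_mid ` p'"

text \<open>The finest partition all of whose parts are unions of stacked parts; see \<open>glue_finest\<close>.\<close>

definition glue :: "diagram \<Rightarrow> diagram \<Rightarrow> vertex set set" where
  "glue p p' = \<Union>(stacked p p') // (\<Union>s\<in>stacked p p'. s \<times> s)\<^sup>+"

definition dcomp :: "diagram \<Rightarrow> diagram \<Rightarrow> diagram" where
  "dcomp p p' = (\<lambda>t. t - range Mid) ` glue p p' - {{}}"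

definition loops :: "diagram \<Rightarrow> diagram \<Rightarrow> nat" where
  "loops p p' = card {t \<in> glue p p'. t \<subseteq> range Mid}"

definition id_diagram :: "nat \<Rightarrow> diagram" where
  "id_diagram n = (\<lambda>i. {Top i, Bot i}) ` {1..n}"

fun flip_vertex :: "vertex \<Rightarrow> vertex" where
  "flip_vertex (Top i) = Bot i"
| "flip_vertex (Bot i) = Top i"
| "flip_vertex (Mid i) = Mid i"

definition flip :: "diagram \<Rightarrow> diagram" where
  "flip p = (`) flip_vertex ` p"

fun shift :: "nat \<Rightarrow> nat \<Rightarrow> vertex \<Rightarrow> vertex" where
  "shift n m (Top i) = Top (n + i)"
| "shift n m (Bot i) = Bot (m + i)"
| "shift n m (Mid i) = Mid i"

text \<open>The juxtaposition of \<open>p \<in> diagrams n m\<close> with \<open>p'\<close> placed to its right.\<close>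

definition juxt :: "nat \<Rightarrow> nat \<Rightarrow> diagram \<Rightarrow> diagram \<Rightarrow> diagram" where
  "juxt n m p p' = p \<union> (`) (shift n m) ` p'"

text \<open>Iterated juxtaposition of diagrams \<open>p \<in> diagrams d d\<close>, given as pairs \<open>(d, p)\<close>.\<close>

fun juxt_list :: "(nat \<times> diagram) list \<Rightarrow> diagram" where
  "juxt_list [] = {}"
| "juxt_list ((d, p) # ps) = juxt d d p (juxt_list ps)"

definition ntop :: "vertex set \<Rightarrow> nat" where
  "ntop s = card (s \<inter> range Top)"

definition nbot :: "vertex set \<Rightarrow> nat" where
  "nbot s = card (s \<inter> range Bot)"

definition propagating :: "vertex set \<Rightarrow> bool" where
  "propagating s \<longleftrightarrow> s \<inter> range Top \<noteq> {} \<and> s \<inter> range Bot \<noteq> {}"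

definition tonal :: "nat \<Rightarrow> nat \<Rightarrow> diagram set" where
  "tonal l n = {p \<in> diagrams n n. \<forall>s\<in>p. ntop s mod l = nbot s mod l}"

definition prop_vec :: "nat \<Rightarrow> diagram \<Rightarrow> nat \<Rightarrow> nat" where
  "prop_vec l p = (\<lambda>i. if i \<in> {1..l}
     then card {s \<in> p. propagating s \<and> ntop s mod l = i mod l} else 0)"

lemma glue_finest:
  assumes "p \<in> diagrams n m" and "p' \<in> diagrams m r"
  defines "V \<equiv> Top ` {1..n} \<union> Mid ` {1..m} \<union> Bot ` {1..r}"
  shows "partition_on V (glue p p')"
    and "\<forall>s\<in>stacked p p'. \<exists>t\<in>glue p p'. s \<subseteq> t"
    and "\<And>Q. partition_on V Q \<Longrightarrow> \<forall>s\<in>stacked p p'. \<exists>t\<in>Q. s \<subseteq> t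
           \<Longrightarrow> \<forall>t\<in>glue p p'. \<exists>u\<in>Q. t \<subseteq> u"
proof -
  define R where "R = (\<Union>s\<in>stacked p p'. s \<times> s)"
  have U: "\<Union>p = Top ` {1..n} \<union> Bot ` {1..m}" "\<Union>p' = Top ` {1..m} \<union> Bot ` {1..r}"
    using assms by (auto simp: diagrams_def partition_on_def)
  have ne: "{} \<notin> p" "{} \<notin> p'"
    using assms by (auto simp: diagrams_def partition_on_def)
  have "\<Union>(stacked p p') = bot_to_mid ` \<Union>p \<union> top_to_mid ` \<Union>p'"
    by (auto simp: stacked_def)
  also have "\<dots> = V"
    unfolding U V_def by (simp add: image_Un image_image Un_assoc)
  finally have V: "\<Union>(stacked p p') = V" .
  have sub: "R \<subseteq> V \<times> V" using V by (auto simp: R_def)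
  have sym: "sym (R\<^sup>+)" by (rule sym_trancl) (auto simp: R_def sym_def)
  have subp: "R\<^sup>+ \<subseteq> V \<times> V" by (rule trancl_subset_Sigma[OF sub])
  have rf: "refl_on V (R\<^sup>+)"
  proof (rule refl_onI)
    fix x assume "x \<in> V"
    then obtain s where "s \<in> stacked p p'" "x \<in> s" using V by auto
    then have "(x, x) \<in> R" by (auto simp: R_def)
    then show "(x, x) \<in> R\<^sup>+" by blast
  qed
  have eq: "equiv V (R\<^sup>+)"
    using subp rf sym by (auto simp: equiv_def)
  have g: "glue p p' = V // R\<^sup>+" by (simp add: glue_def V R_def)
  show "partition_on V (glue p p')"
    unfolding g by (rule partition_on_quotient[OF eq])
  show "\<forall>s\<in>stacked p p'. \<exists>t\<in>glue p p'. s \<subseteq> t"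
  proof
    fix s assume s: "s \<in> stacked p p'"
    then have "s \<noteq> {}" using ne by (auto simp: stacked_def)
    then obtain x where x: "x \<in> s" by blast
    have "s \<subseteq> R\<^sup>+ `` {x}" using s x by (auto simp: R_def intro!: r_into_trancl)
    moreover have "x \<in> V" using V s x by auto
    ultimately show "\<exists>t\<in>glue p p'. s \<subseteq> t" unfolding g by (auto intro: quotientI)
  qed
  fix Q assume Q: "partition_on V Q" and cov: "\<forall>s\<in>stacked p p'. \<exists>t\<in>Q. s \<subseteq> t"
  have disj: "t = u" if "t \<in> Q" "u \<in> Q" "z \<in> t" "z \<in> u" for t u z
    using Q that by (auto simp: partition_on_def disjoint_def)
  show "\<forall>t\<in>glue p p'. \<exists>u\<in>Q. t \<subseteq> u"
  proof
    fix t assume "t \<in> glue p p'"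
    then obtain x where x: "x \<in> V" "t = R\<^sup>+ `` {x}" unfolding g by (auto elim: quotientE)
    obtain u where u: "u \<in> Q" "x \<in> u" using Q x by (auto simp: partition_on_def)
    have "y \<in> u" if "(x, y) \<in> R\<^sup>+" for y
      using that
    proof (induction rule: trancl_induct)
      case (base y)
      then obtain s where s: "s \<in> stacked p p'" "x \<in> s" "y \<in> s" by (auto simp: R_def)
      then obtain v where "v \<in> Q" "s \<subseteq> v" using cov by blast
      then show ?case using disj[of u v x] u s by auto
    next
      case (step y z)
      then obtain s where s: "s \<in> stacked p p'" "y \<in> s" "z \<in> s" by (auto simp: R_def)
      then obtain v where "v \<in> Q" "s \<subseteq> v" using cov by blast
      then show ?case using disj[of u v y] u s step by auto
    qed
    then show "\<exists>u\<in>Q. t \<subseteq> u" using u x by auto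
  qed
qed


section \<open>The tonal partition algebra and its quotients\<close>

definition tonal_alg :: "nat \<Rightarrow> nat \<Rightarrow> (int poly, diagram \<Rightarrow> int poly) module" where
  "tonal_alg l n = free_mod (tonal l n)
     \<lparr>mult := bilin_ext (tonal l n) (tonal l n)
        (\<lambda>p p' q. monom 1 (loops p p') * basis_vec (dcomp p p') q),
      one := basis_vec (id_diagram n)\<rparr>"

definition opmap :: "nat \<Rightarrow> nat \<Rightarrow> (diagram \<Rightarrow> int poly) \<Rightarrow> diagram \<Rightarrow> int poly" where
  "opmap l n = lin_ext (tonal l n) (\<lambda>p. basis_vec (flip p))"

text \<open>Vectors in \<open>\<nat>\<^sup>l\<close> are functions on \<^typ>\<open>nat\<close> vanishing outside \<open>{1..l}\<close>.\<close>

definition rank_sum :: "nat \<Rightarrow> (nat \<Rightarrow> nat) \<Rightarrow> nat" where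
  "rank_sum l m = (\<Sum>i\<in>{1..l}. i * m i)"

definition index_set :: "nat \<Rightarrow> nat \<Rightarrow> (nat \<Rightarrow> nat) set" where
  "index_set l n = {m. (\<forall>i. i \<notin> {1..l} \<longrightarrow> m i = 0) \<and>
     rank_sum l m \<le> n \<and> l dvd n - rank_sum l m}"

text \<open>The coefficient at \<open>h\<close> of the standard basis vector with index \<open>i\<close> read modulo \<open>l\<close>, and of
  the vector \<open>v\<^sub>i\<^sub>j\<close>.\<close>

definition eps :: "nat \<Rightarrow> nat \<Rightarrow> nat \<Rightarrow> int" where
  "eps l i h = (if h \<in> {1..l} \<and> h mod l = i mod l then 1 else 0)"

definition vvec :: "nat \<Rightarrow> nat \<Rightarrow> nat \<Rightarrow> nat \<Rightarrow> int" where
  "vvec l i j h = eps l (i + j) h - eps l i h - eps l j h"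

definition index_le :: "nat \<Rightarrow> (nat \<Rightarrow> nat) \<Rightarrow> (nat \<Rightarrow> nat) \<Rightarrow> bool" where
  "index_le l m' m \<longleftrightarrow> (\<exists>c :: nat \<Rightarrow> nat \<Rightarrow> nat. \<forall>h\<in>{1..l}.
     int (m' h) - int (m h) = (\<Sum>j\<in>{1..l}. \<Sum>i\<in>{1..j}. int (c i j) * vvec l i j h))"

definition index_less :: "nat \<Rightarrow> (nat \<Rightarrow> nat) \<Rightarrow> (nat \<Rightarrow> nat) \<Rightarrow> bool" where
  "index_less l m' m \<longleftrightarrow> index_le l m' m \<and> m' \<noteq> m"

definition b_diagram :: "nat \<Rightarrow> diagram" where
  "b_diagram i = {Top ` {1..i} \<union> Bot ` {1..i}}"

definition w_diagram :: "nat \<Rightarrow> diagram" where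
  "w_diagram l = {Top ` {1..l}}"

definition w_star :: "nat \<Rightarrow> diagram" where
  "w_star l = {Bot ` {1..l}}"

definition a_diagram :: "nat \<Rightarrow> nat \<Rightarrow> (nat \<Rightarrow> nat) \<Rightarrow> diagram" where
  "a_diagram l n m = juxt_list
     (concat (map (\<lambda>i. replicate (m i) (i, b_diagram i)) (rev [1..<Suc l]))
      @ replicate ((n - rank_sum l m) div l) (l, dcomp (w_diagram l) (w_star l)))"

definition a_elt :: "nat \<Rightarrow> nat \<Rightarrow> (nat \<Rightarrow> nat) \<Rightarrow> diagram \<Rightarrow> int poly" where
  "a_elt l n m = basis_vec (a_diagram l n m)"

definition lower_ideal :: "nat \<Rightarrow> nat \<Rightarrow> (nat \<Rightarrow> nat) \<Rightarrow> (diagram \<Rightarrow> int poly) set" where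
  "lower_ideal l n m = kspan (tonal_alg l n)
     {x \<otimes>\<^bsub>tonal_alg l n\<^esub> a_elt l n m' \<otimes>\<^bsub>tonal_alg l n\<^esub> y | x y m'.
        x \<in> carrier (tonal_alg l n) \<and> y \<in> carrier (tonal_alg l n) \<and>
        m' \<in> index_set l n \<and> index_less l m' m}"

text \<open>The quotient of an algebra by a two-sided ideal: the quotient ring with the induced scalar
  multiplication.\<close>

definition quot_alg :: "(int poly, 'a) module \<Rightarrow> 'a set \<Rightarrow> (int poly, 'a set) module" where
  "quot_alg A J = \<lparr>carrier = carrier (A Quot J), mult = mult (A Quot J), one = one (A Quot J),
     zero = zero (A Quot J), add = add (A Quot J),
     smult = (\<lambda>c X. \<Union>x\<in>X. J +>\<^bsub>A\<^esub> (c \<odot>\<^bsub>A\<^esub> x))\<rparr>"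

definition cell_alg ::
    "nat \<Rightarrow> nat \<Rightarrow> (nat \<Rightarrow> nat) \<Rightarrow> (int poly, (diagram \<Rightarrow> int poly) set) module" where
  "cell_alg l n m = quot_alg (tonal_alg l n) (lower_ideal l n m)"

definition cls ::
    "nat \<Rightarrow> nat \<Rightarrow> (nat \<Rightarrow> nat) \<Rightarrow> (diagram \<Rightarrow> int poly) \<Rightarrow> (diagram \<Rightarrow> int poly) set" where
  "cls l n m f = lower_ideal l n m +>\<^bsub>tonal_alg l n\<^esub> f"

definition cell_op :: "nat \<Rightarrow> nat \<Rightarrow> (diagram \<Rightarrow> int poly) set \<Rightarrow> (diagram \<Rightarrow> int poly) set" where
  "cell_op l n X = opmap l n ` X"


section \<open>The group algebra of a product of symmetric groups\<close>

text \<open>Elements of \<open>S\<^sub>m\<^sub>1 \<times> \<dots> \<times> S\<^sub>m\<^sub>l\<close> are families of permutations \<open>\<sigma> i\<close> of \<open>{1..m i}\<close>, with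
  \<open>\<sigma> i\<close> the identity for \<open>i\<close> outside \<open>{1..l}\<close>.\<close>

type_synonym perms = "nat \<Rightarrow> nat \<Rightarrow> nat"

definition sym_prod :: "nat \<Rightarrow> (nat \<Rightarrow> nat) \<Rightarrow> perms set" where
  "sym_prod l m = {\<sigma>. (\<forall>i\<in>{1..l}. \<sigma> i permutes {1..m i}) \<and> (\<forall>i. i \<notin> {1..l} \<longrightarrow> \<sigma> i = id)}"

definition perms_mult :: "perms \<Rightarrow> perms \<Rightarrow> perms" where
  "perms_mult \<sigma> \<tau> = (\<lambda>i. \<sigma> i \<circ> \<tau> i)"

definition perms_inv :: "perms \<Rightarrow> perms" where
  "perms_inv \<sigma> = (\<lambda>i. inv_into UNIV (\<sigma> i))"

definition group_alg :: "nat \<Rightarrow> (nat \<Rightarrow> nat) \<Rightarrow> (int poly, perms \<Rightarrow> int poly) module" where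
  "group_alg l m = free_mod (sym_prod l m)
     \<lparr>mult := bilin_ext (sym_prod l m) (sym_prod l m) (\<lambda>\<sigma> \<tau>. basis_vec (perms_mult \<sigma> \<tau>)),
      one := basis_vec (\<lambda>i. id)\<rparr>"

text \<open>The inclusion of the integral group ring.\<close>

definition int_coeffs :: "(perms \<Rightarrow> int) \<Rightarrow> perms \<Rightarrow> int poly" where
  "int_coeffs e = (\<lambda>\<sigma>. of_int (e \<sigma>))"


section \<open>Integer partitions and Specht modules\<close>

definition int_partition :: "nat \<Rightarrow> nat list \<Rightarrow> bool" where
  "int_partition N lam \<longleftrightarrow> sorted_wrt (\<ge>) lam \<and> 0 \<notin> set lam \<and> sum_list lam = N"

definition multi_partitions :: "nat \<Rightarrow> (nat \<Rightarrow> nat) \<Rightarrow> (nat \<Rightarrow> nat list) set" where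
  "multi_partitions l m = {lam. (\<forall>i\<in>{1..l}. int_partition (m i) (lam i)) \<and>
     (\<forall>i. i \<notin> {1..l} \<longrightarrow> lam i = [])}"

text \<open>The disjoint union over \<open>m\<close> is realised by recording \<open>m\<close>.\<close>

definition labels :: "nat \<Rightarrow> nat \<Rightarrow> ((nat \<Rightarrow> nat) \<times> (nat \<Rightarrow> nat list)) set" where
  "labels l n = (SIGMA m : index_set l n. multi_partitions l m)"

text \<open>Tableaux, tabloids and polytabloids in the sense of James. Cells are pairs (row, column); the
  tabloid of a tableau records the set of entries of each row.\<close>

definition young_cells :: "nat list \<Rightarrow> (nat \<times> nat) set" where
  "young_cells lam = {(r, c). r < length lam \<and> c < lam ! r}"

definition tableaux :: "nat list \<Rightarrow> (nat \<times> nat \<Rightarrow> nat) set" where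
  "tableaux lam = {t \<in> extensional (young_cells lam).
     bij_betw t (young_cells lam) {1..sum_list lam}}"

definition tabloid :: "nat list \<Rightarrow> (nat \<times> nat \<Rightarrow> nat) \<Rightarrow> nat \<Rightarrow> nat set" where
  "tabloid lam t = (\<lambda>r. {t (r, c) | c. (r, c) \<in> young_cells lam})"

definition tabloids :: "nat list \<Rightarrow> (nat \<Rightarrow> nat set) set" where
  "tabloids lam = tabloid lam ` tableaux lam"

definition tabloid_act :: "(nat \<Rightarrow> nat) \<Rightarrow> (nat \<Rightarrow> nat set) \<Rightarrow> nat \<Rightarrow> nat set" where
  "tabloid_act \<pi> T = (\<lambda>r. \<pi> ` T r)"

definition column_stabilizer :: "nat list \<Rightarrow> (nat \<times> nat \<Rightarrow> nat) \<Rightarrow> (nat \<Rightarrow> nat) set" where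
  "column_stabilizer lam t = {\<pi>. \<pi> permutes {1..sum_list lam} \<and>
     (\<forall>(r, c)\<in>young_cells lam. \<exists>r'. (r', c) \<in> young_cells lam \<and> \<pi> (t (r, c)) = t (r', c))}"

definition polytabloid :: "nat list \<Rightarrow> (nat \<times> nat \<Rightarrow> nat) \<Rightarrow> (nat \<Rightarrow> nat set) \<Rightarrow> int poly" where
  "polytabloid lam t = (\<lambda>T. \<Sum>\<pi>\<in>column_stabilizer lam t.
     of_int (sign \<pi>) * basis_vec (tabloid_act \<pi> (tabloid lam t)) T)"

definition specht :: "nat list \<Rightarrow> ((nat \<Rightarrow> nat set) \<Rightarrow> int poly) set" where
  "specht lam = kspan (free_mod (tabloids lam)) (polytabloid lam ` tableaux lam)"

text \<open>The outer tensor product of Specht modules, inside the tensor product of the permutation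
  modules on tabloids, i.e. the free module on families of tabloids.\<close>

definition multi_tabloids :: "nat \<Rightarrow> (nat \<Rightarrow> nat list) \<Rightarrow> (nat \<Rightarrow> nat \<Rightarrow> nat set) set" where
  "multi_tabloids l lam = (\<Pi>\<^sub>E i\<in>{1..l}. tabloids (lam i))"

definition pure_tensor :: "nat \<Rightarrow> (nat \<Rightarrow> nat list) \<Rightarrow> (nat \<Rightarrow> (nat \<Rightarrow> nat set) \<Rightarrow> int poly)
    \<Rightarrow> (nat \<Rightarrow> nat \<Rightarrow> nat set) \<Rightarrow> int poly" where
  "pure_tensor l lam f = (\<lambda>T. if T \<in> multi_tabloids l lam then \<Prod>i\<in>{1..l}. f i (T i) else 0)"

definition multi_specht :: "nat \<Rightarrow> (nat \<Rightarrow> nat list)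
    \<Rightarrow> (int poly, (nat \<Rightarrow> nat \<Rightarrow> nat set) \<Rightarrow> int poly) module" where
  "multi_specht l lam = free_mod (multi_tabloids l lam)
     \<lparr>carrier := kspan (free_mod (multi_tabloids l lam))
        {pure_tensor l lam f | f. \<forall>i\<in>{1..l}. f i \<in> specht (lam i)}\<rparr>"

definition multi_tabloid_act :: "nat \<Rightarrow> (nat \<Rightarrow> nat list) \<Rightarrow> perms
    \<Rightarrow> ((nat \<Rightarrow> nat \<Rightarrow> nat set) \<Rightarrow> int poly) \<Rightarrow> (nat \<Rightarrow> nat \<Rightarrow> nat set) \<Rightarrow> int poly" where
  "multi_tabloid_act l lam \<sigma> = lin_ext (multi_tabloids l lam)
     (\<lambda>T. basis_vec (\<lambda>i\<in>{1..l}. tabloid_act (\<sigma> i) (T i)))"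

definition group_left_ideal ::
    "nat \<Rightarrow> (nat \<Rightarrow> nat) \<Rightarrow> (perms \<Rightarrow> int poly) \<Rightarrow> (int poly, perms \<Rightarrow> int poly) module" where
  "group_left_ideal l m e = group_alg l m
     \<lparr>carrier := {x \<otimes>\<^bsub>group_alg l m\<^esub> e | x. x \<in> carrier (group_alg l m)}\<rparr>"

definition is_specht_ideal ::
    "nat \<Rightarrow> (nat \<Rightarrow> nat) \<Rightarrow> (nat \<Rightarrow> nat list) \<Rightarrow> (perms \<Rightarrow> int poly) \<Rightarrow> bool" where
  "is_specht_ideal l m lam e \<longleftrightarrow>
     (\<exists>\<phi>\<in>LinearCombinations.module_hom class_ring (group_left_ideal l m e) (multi_specht l lam).
        bij_betw \<phi> (carrier (group_left_ideal l m e)) (carrier (multi_specht l lam)) \<and>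
        (\<forall>\<sigma>\<in>sym_prod l m. \<forall>y\<in>carrier (group_left_ideal l m e).
           \<phi> (basis_vec \<sigma> \<otimes>\<^bsub>group_alg l m\<^esub> y) = multi_tabloid_act l lam \<sigma> (\<phi> y)))"

definition specht_element ::
    "nat \<Rightarrow> (nat \<Rightarrow> nat) \<Rightarrow> (nat \<Rightarrow> nat list) \<Rightarrow> (perms \<Rightarrow> int) \<Rightarrow> bool" where
  "specht_element l m lam e \<longleftrightarrow>
     (\<forall>\<sigma>. \<sigma> \<notin> sym_prod l m \<longrightarrow> e \<sigma> = 0) \<and>
     (\<forall>\<sigma>\<in>sym_prod l m. e (perms_inv \<sigma>) = e \<sigma>) \<and>
     (\<forall>x\<in>carrier (group_alg l m). \<exists>c.
        int_coeffs e \<otimes>\<^bsub>group_alg l m\<^esub> x \<otimes>\<^bsub>group_alg l m\<^esub> int_coeffs e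
          = c \<odot>\<^bsub>group_alg l m\<^esub> int_coeffs e) \<and>
     is_specht_ideal l m lam (int_coeffs e)"


section \<open>Standard modules and the contravariant form\<close>

definition cell_diagrams :: "nat \<Rightarrow> nat \<Rightarrow> (nat \<Rightarrow> nat) \<Rightarrow> diagram set" where
  "cell_diagrams l n m = {p \<in> tonal l n. prop_vec l p = m \<and>
     (\<lambda>s. s \<inter> range Bot) ` p - {{}} = (\<lambda>s. s \<inter> range Bot) ` a_diagram l n m - {{}} \<and>
     {s \<in> p. s \<subseteq> range Bot} = {s \<in> a_diagram l n m. s \<subseteq> range Bot}}"

text \<open>The \<open>j\<close>-th from the left, \<open>j \<in> {1..m i}\<close>, of the bottom blocks of size \<open>i\<close> which lie on
  propagating parts of \<^term>\<open>a_diagram l n m\<close>; the blocks of sizes \<open>l, \<dots>, i + 1\<close> come first.\<close>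

definition bottom_block :: "nat \<Rightarrow> (nat \<Rightarrow> nat) \<Rightarrow> nat \<Rightarrow> nat \<Rightarrow> vertex set" where
  "bottom_block l m i j =
     (let d = (\<Sum>i'\<in>{i<..l}. i' * m i') + (j - 1) * i in Bot ` {d + 1..d + i})"

definition diagram_act :: "nat \<Rightarrow> (nat \<Rightarrow> nat) \<Rightarrow> diagram \<Rightarrow> perms \<Rightarrow> diagram" where
  "diagram_act l m p \<sigma> = {s \<in> p. \<not> propagating s} \<union>
     {(s \<inter> range Top) \<union> bottom_block l m i j | s i j.
        s \<in> p \<and> propagating s \<and> i \<in> {1..l} \<and> j \<in> {1..m i} \<and>
        s \<inter> range Bot = bottom_block l m i (\<sigma> i j)}"

definition cell_left_ideal :: "nat \<Rightarrow> nat \<Rightarrow> (nat \<Rightarrow> nat) \<Rightarrow> (diagram \<Rightarrow> int poly) set set" where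
  "cell_left_ideal l n m = {X \<otimes>\<^bsub>cell_alg l n m\<^esub> cls l n m (a_elt l n m) | X.
     X \<in> carrier (cell_alg l n m)}"

text \<open>The right action of the group algebra on the left ideal: expand in the basis of classes of
  \<^const>\<open>cell_diagrams\<close> and act on the basis.\<close>

definition cell_act :: "nat \<Rightarrow> nat \<Rightarrow> (nat \<Rightarrow> nat) \<Rightarrow> (diagram \<Rightarrow> int poly) set
    \<Rightarrow> (perms \<Rightarrow> int poly) \<Rightarrow> (diagram \<Rightarrow> int poly) set" where
  "cell_act l n m X x = (THE Y. \<exists>f\<in>carrier (free_mod (cell_diagrams l n m)).
     X = cls l n m f \<and>
     Y = cls l n m (bilin_ext (cell_diagrams l n m) (sym_prod l m)
           (\<lambda>p \<sigma>. basis_vec (diagram_act l m p \<sigma>)) f x))"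

definition std_module :: "nat \<Rightarrow> nat \<Rightarrow> (nat \<Rightarrow> nat) \<Rightarrow> (perms \<Rightarrow> int)
    \<Rightarrow> (int poly, (diagram \<Rightarrow> int poly) set) module" where
  "std_module l n m e = cell_alg l n m
     \<lparr>carrier := (\<lambda>X. cell_act l n m X (int_coeffs e)) ` cell_left_ideal l n m\<rparr>"

definition contra_form :: "nat \<Rightarrow> nat \<Rightarrow> (nat \<Rightarrow> nat) \<Rightarrow> (perms \<Rightarrow> int)
    \<Rightarrow> (diagram \<Rightarrow> int poly) set \<Rightarrow> (diagram \<Rightarrow> int poly) set \<Rightarrow> int poly" where
  "contra_form l n m e X Y = (THE c. cell_op l n X \<otimes>\<^bsub>cell_alg l n m\<^esub> Y
     = c \<odot>\<^bsub>cell_alg l n m\<^esub> cell_act l n m (cls l n m (a_elt l n m)) (int_coeffs e))"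

definition gram_matrix :: "nat \<Rightarrow> nat \<Rightarrow> (nat \<Rightarrow> nat) \<Rightarrow> (perms \<Rightarrow> int)
    \<Rightarrow> (diagram \<Rightarrow> int poly) set list \<Rightarrow> int poly mat" where
  "gram_matrix l n m e bs =
     mat (length bs) (length bs) (\<lambda>(i, j). contra_form l n m e (bs ! i) (bs ! j))"

end

theory Submission
  imports Defs
begin

text \<open>
  Write \<open>C\<close> for the basis of diagrams of the left ideal generated by \<open>a\<^sup>m\<close> and \<open>S\<close> for the product of
  symmetric groups. For \<open>p, q \<in> C\<close> the product \<open>p\<^sup>o\<^sup>p q\<close> is, modulo lower terms, either \<open>0\<close> or
  \<open>\<delta>\<^sup>c a\<^sup>m \<rho>\<close> with \<open>\<rho> \<in> S\<close>, which gives a form \<open>B\<close> on the span of \<open>C\<close> with values in \<open>k S\<close> satisfying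
  \<open>B(f x, g y) = x\<^sup>o\<^sup>p B(f, g) y\<close>. Hence \<open>B(f e, g e) = e B(f, g) e\<close> is \<open>(f e, g e)\<^sub>e\<close> times \<open>e\<close>, and
  reading off the coefficient of the identity, \<open>(w, w')\<^sub>e\<close> times the constant \<open>e(1)\<close> is the scalar
  form \<open>T(w, w') = \<Sum> w\<^sub>p w'\<^sub>q \<delta>\<^sup>c\<close>, summed over the pairs with \<open>p\<^sup>o\<^sup>p q = \<delta>\<^sup>c a\<^sup>m\<close>.

  The number \<open>c\<close> of loops is at most the mean of the numbers of non-propagating top parts of \<open>p\<close> and
  \<open>q\<close>, with equality only for \<open>p = q\<close>. So for \<open>w \<noteq> 0\<close> the top coefficient of \<open>T(w, w)\<close> is a sum of
  squares of leading coefficients and \<open>T(w, w) \<noteq> 0\<close>. A vanishing Gram determinant would yield a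
  nonzero \<open>w\<close> in the standard module orthogonal to everything, in particular to itself.
\<close>


section \<open>Connected components of a family of sets\<close>

text \<open>The form \<open>T\<close> is anisotropic on the whole span of \<open>C\<close>, and
  anisotropy passes to every submodule. So the standard module is handled without a basis adapted to
  Specht modules. There is no division by \<open>e(1)\<close> either: each Gram entry times
  \<open>e(1)\<close> is a value of \<open>T\<close>, which is enough to get
  \<open>T(w, w) = 0\<close> from a null vector.

  The main obstacle is the quotient. The ideal of lower terms is given as a span of products through
  the smaller \<open>a^m'\<close>, but calculating modulo it requires its diagrams: it is the span
  of those with strictly smaller propagating vector. One inclusion says that propagating vectors
  descend under composition, since gluing fuses propagating parts, which adds vectors
  \<open>v_ij\<close>, or cuts off components of tone 0, which adds \<open>v_ll\<close>. For the
  other, each lower diagram must be factored through some \<open>a^m'\<close> without creating a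
  loop, because \<open>\<delta>\<close> is not invertible. Afterwards a coset is a function known
  outside the lower diagrams, and identities in the quotient are compared coefficient by
  coefficient.\<close>

definition conn_parts :: "'a set set \<Rightarrow> 'a set set" where
  "conn_parts S = \<Union>S // (\<Union>s\<in>S. s \<times> s)\<^sup>+"

lemma equiv_conn: "equiv (\<Union>S) ((\<Union>s\<in>S. s \<times> s)\<^sup>+)"
proof -
  let ?R = "\<Union>s\<in>S. s \<times> s"
  have sym: "sym (?R\<^sup>+)" by (rule sym_trancl) (auto simp: sym_def)
  have sub: "?R\<^sup>+ \<subseteq> \<Union>S \<times> \<Union>S" by (rule trancl_subset_Sigma) auto
  have "refl_on (\<Union>S) (?R\<^sup>+)"
  proof (rule refl_onI)
    fix x assume "x \<in> \<Union>S"
    then have "(x, x) \<in> ?R" by auto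
    then show "(x, x) \<in> ?R\<^sup>+" by blast
  qed
  then show ?thesis using sym sub by (auto simp: equiv_def)
qed

lemma partition_on_conn: "partition_on (\<Union>S) (conn_parts S)"
  unfolding conn_parts_def by (rule partition_on_quotient[OF equiv_conn])

lemma conn_absorb:
  assumes "s \<in> S" "g \<in> conn_parts S" "s \<inter> g \<noteq> {}"
  shows "s \<subseteq> g"
proof -
  let ?R = "(\<Union>s\<in>S. s \<times> s)"
  obtain x where x: "g = ?R\<^sup>+ `` {x}" using assms(2) by (auto simp: conn_parts_def elim: quotientE)
  obtain y where y: "y \<in> s" "(x, y) \<in> ?R\<^sup>+" using assms(3) x by auto
  have "(x, z) \<in> ?R\<^sup>+" if "z \<in> s" for z
  proof -
    have "(y, z) \<in> ?R" using assms(1) y that by auto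
    then show ?thesis using y(2) by (meson trancl.trancl_into_trancl)
  qed
  then show ?thesis using x by auto
qed

text \<open>A path that starts in \<open>U\<close> never leaves \<open>U\<close>, because each step
  stays inside one set of \<open>S\<close>. Together with \<open>conn_absorb\<close> this replaces
  the transitive closure in the later arguments.\<close>

lemma conn_minimal:
  assumes g: "g \<in> conn_parts S" and gU: "g \<inter> U \<noteq> {}"
    and U: "\<And>s. s \<in> S \<Longrightarrow> s \<inter> U \<noteq> {} \<Longrightarrow> s \<subseteq> U"
  shows "g \<subseteq> U"
proof -
  let ?R = "(\<Union>s\<in>S. s \<times> s)"
  obtain y where y: "y \<in> g" "y \<in> U" using gU by auto
  have yS: "y \<in> \<Union>S" using partition_on_conn[of S] g y by (auto simp: partition_on_def)
  obtain x where x: "g = ?R\<^sup>+ `` {x}" using g by (auto simp: conn_parts_def elim: quotientE)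
  then have g': "g = ?R\<^sup>+ `` {y}" using equiv_class_eq[OF equiv_conn[of S], of x y] y by simp
  have "z \<in> U" if "(y, z) \<in> ?R\<^sup>+" for z using that
  proof (induction rule: trancl_induct)
    case (base z)
    then obtain s where "s \<in> S" "y \<in> s" "z \<in> s" by auto
    then show ?case using U[of s] y by auto
  next
    case (step z w)
    then obtain s where "s \<in> S" "z \<in> s" "w \<in> s" by auto
    then show ?case using U[of s] step by auto
  qed
  then show ?thesis using g' by auto
qed

lemma conn_disjoint:
  "g \<in> conn_parts S \<Longrightarrow> h \<in> conn_parts S \<Longrightarrow> x \<in> g \<Longrightarrow> x \<in> h \<Longrightarrow> g = h"
  using partition_on_conn[of S] by (auto simp: partition_on_def disjoint_def)

lemma conn_nonempty: "g \<in> conn_parts S \<Longrightarrow> g \<noteq> {}"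
  using partition_on_conn[of S] by (auto simp: partition_on_def)

lemma conn_cover: "x \<in> s \<Longrightarrow> s \<in> S \<Longrightarrow> \<exists>g\<in>conn_parts S. x \<in> g"
  using partition_on_conn[of S] by (auto simp: partition_on_def)

lemma conn_obtain:
  assumes "s \<in> S" "s \<noteq> {}"
  obtains g where "g \<in> conn_parts S" "s \<subseteq> g"
proof -
  obtain x where "x \<in> s" using assms by auto
  then obtain g where "g \<in> conn_parts S" "x \<in> g" using conn_cover assms by metis
  then show ?thesis using that conn_absorb[of s S g] assms \<open>x \<in> s\<close> by auto
qed

lemma conn_sub: "g \<in> conn_parts S \<Longrightarrow> g \<subseteq> \<Union>S"
  using partition_on_conn[of S] by (auto simp: partition_on_def)

text \<open>The last two hypotheses are the two inclusions between \<open>U\<close> and the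
  component of one of its points.\<close>

lemma conn_partI:
  assumes "U \<noteq> {}" "U \<subseteq> \<Union>S"
    and closed: "\<And>s. s \<in> S \<Longrightarrow> s \<inter> U \<noteq> {} \<Longrightarrow> s \<subseteq> U"
    and connected: "\<And>g. g \<in> conn_parts S \<Longrightarrow> g \<inter> U \<noteq> {} \<Longrightarrow> U \<subseteq> g"
  shows "U \<in> conn_parts S"
proof -
  obtain x where x: "x \<in> U" using assms(1) by auto
  then obtain s where s: "s \<in> S" "x \<in> s" using assms(2) by auto
  then obtain g where g: "g \<in> conn_parts S" "x \<in> g" using conn_cover by metis
  have "g \<subseteq> U" using conn_minimal[OF g(1) _ closed] g x by auto
  moreover have "U \<subseteq> g" using connected[OF g(1)] g x by auto
  ultimately show ?thesis using g by auto
qed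

lemma conn_isolated:
  assumes "s \<in> S" "s \<noteq> {}" and "\<And>t. t \<in> S \<Longrightarrow> t \<inter> s \<noteq> {} \<Longrightarrow> t \<subseteq> s"
  shows "s \<in> conn_parts S"
proof (rule conn_partI)
  show "s \<subseteq> g" if "g \<in> conn_parts S" "g \<inter> s \<noteq> {}" for g
    using conn_absorb[OF assms(1) that(1)] that(2) by (simp add: Int_commute)
qed (use assms in auto)

text \<open>Components are nonempty and pairwise disjoint, so a set of components that covers the
  ground set misses none.\<close>

lemma conn_eqI:
  assumes "Q \<subseteq> conn_parts S" "\<Union>S \<subseteq> \<Union>Q"
  shows "conn_parts S = Q"
proof
  show "conn_parts S \<subseteq> Q"
  proof
    fix g assume g: "g \<in> conn_parts S"
    then obtain x where x: "x \<in> g" using conn_nonempty by blast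
    then have "x \<in> \<Union>Q" using conn_sub[OF g] assms by blast
    then obtain q where "q \<in> Q" "x \<in> q" by auto
    then show "g \<in> Q" using conn_disjoint[OF g _ x] assms by auto
  qed
qed (rule assms)

text \<open>Gluing sees vertices only up to injective renaming. Applied to the reflection of
  diagrams and to permutations of bottom vertices.\<close>

lemma conn_parts_image:
  assumes inj: "inj f"
  shows "conn_parts ((`) f ` S) = (`) f ` conn_parts S"
proof (rule conn_eqI)
  show "(`) f ` conn_parts S \<subseteq> conn_parts ((`) f ` S)"
  proof clarify
    fix g assume g: "g \<in> conn_parts S"
    show "f ` g \<in> conn_parts ((`) f ` S)"
    proof (rule conn_partI)
      show "f ` g \<noteq> {}" using conn_nonempty[OF g] by simp
      show "f ` g \<subseteq> \<Union>((`) f ` S)"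
        using image_mono[OF conn_sub[OF g], of f] by (simp only: image_Union)
      show "s \<subseteq> f ` g" if s: "s \<in> (`) f ` S" "s \<inter> f ` g \<noteq> {}" for s
      proof -
        obtain t where t: "t \<in> S" "s = f ` t" using s by auto
        have "f ` (t \<inter> g) \<noteq> {}" using s(2) unfolding t(2) image_Int[OF inj] .
        then have "t \<inter> g \<noteq> {}" by (simp only: image_is_empty not_False_eq_True)
        then have "t \<subseteq> g" by (rule conn_absorb[OF t(1) g])
        then show ?thesis unfolding t(2) by (rule image_mono)
      qed
      fix h assume h: "h \<in> conn_parts ((`) f ` S)" "h \<inter> f ` g \<noteq> {}"
      have "g \<subseteq> f -` h"
      proof (rule conn_minimal[OF g])
        show "g \<inter> f -` h \<noteq> {}" using h(2) by blast
        fix s assume s: "s \<in> S" "s \<inter> f -` h \<noteq> {}"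
        have "f ` s \<subseteq> h" by (rule conn_absorb[OF _ h(1)]) (use s in blast)+
        then show "s \<subseteq> f -` h" by blast
      qed
      then show "f ` g \<subseteq> h" by blast
    qed
  qed
  have "\<Union>(conn_parts S) = \<Union>S" using partition_on_conn[of S] unfolding partition_on_def by blast
  then have "f ` \<Union>S \<subseteq> f ` \<Union>(conn_parts S)" by simp
  then show "\<Union>((`) f ` S) \<subseteq> \<Union>((`) f ` conn_parts S)" unfolding image_Union .
qed


section \<open>The cone of the index order\<close>

text \<open>The monoid generated by the \<open>v_ij\<close>, as a set of integer vectors: each
  component of a gluing contributes an integer vector, and these contributions are then added. Only
  the coordinates in \<open>{1..l}\<close> are constrained, hence \<open>cone_cong\<close>.\<close>

definition cone :: "nat \<Rightarrow> (nat \<Rightarrow> int) set" where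
  "cone l = {v. \<exists>c :: nat \<Rightarrow> nat \<Rightarrow> nat. \<forall>h\<in>{1..l}.
     v h = (\<Sum>j\<in>{1..l}. \<Sum>i\<in>{1..j}. int (c i j) * vvec l i j h)}"

lemma index_le_cone: "index_le l m' m \<longleftrightarrow> (\<lambda>h. int (m' h) - int (m h)) \<in> cone l"
  by (simp add: index_le_def cone_def)

lemma cone_cong: "v \<in> cone l \<Longrightarrow> (\<And>h. h \<in> {1..l} \<Longrightarrow> v h = w h) \<Longrightarrow> w \<in> cone l"
  by (simp add: cone_def)

lemma cone_0: "(\<lambda>h. 0) \<in> cone l"
  unfolding cone_def by (intro CollectI exI[of _ "\<lambda>i j. 0"]) simp

lemma cone_add: "v \<in> cone l \<Longrightarrow> w \<in> cone l \<Longrightarrow> (\<lambda>h. v h + w h) \<in> cone l"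
  unfolding cone_def
proof clarify
  fix c d :: "nat \<Rightarrow> nat \<Rightarrow> nat"
  assume "\<forall>h\<in>{1..l}. v h = (\<Sum>j\<in>{1..l}. \<Sum>i\<in>{1..j}. int (c i j) * vvec l i j h)"
   "\<forall>h\<in>{1..l}. w h = (\<Sum>j\<in>{1..l}. \<Sum>i\<in>{1..j}. int (d i j) * vvec l i j h)"
  then show "\<exists>c :: nat \<Rightarrow> nat \<Rightarrow> nat. \<forall>h\<in>{1..l}. v h + w h = (\<Sum>j\<in>{1..l}. \<Sum>i\<in>{1..j}. int (c i j) * vvec l i j h)"
    by (intro exI[of _ "\<lambda>i j. c i j + d i j"]) (simp add: algebra_simps sum.distrib)
qed

lemma cone_sum:
  "(\<And>x. x \<in> A \<Longrightarrow> f x \<in> cone l) \<Longrightarrow> (\<lambda>h. \<Sum>x\<in>A. f x h) \<in> cone l"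
proof (induction A rule: infinite_finite_induct)
  case (insert x A)
  then show ?case using cone_add[of "f x" l "\<lambda>h. \<Sum>x\<in>A. f x h"] by simp
qed (auto simp: cone_0)

lemma vvec_cone0:
  assumes "1 \<le> i" "i \<le> j" "j \<le> l"
  shows "vvec l i j \<in> cone l"
  unfolding cone_def
proof (intro CollectI exI[of _ "\<lambda>i' j'. if i' = i \<and> j' = j then 1 else 0"] ballI)
  fix h
  have "(\<Sum>j'\<in>{1..l}. \<Sum>i'\<in>{1..j'}. int (if i' = i \<and> j' = j then 1 else 0) * vvec l i' j' h)
     = (\<Sum>j'\<in>{1..l}. if j' = j then vvec l i j h else 0)"
  proof (rule sum.cong)
    fix j'
    have "(\<Sum>i'\<in>{1..j'}. int (if i' = i \<and> j' = j then 1 else 0) * vvec l i' j' h)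
      = (\<Sum>i'\<in>{1..j'}. if i' = i then (if j' = j then vvec l i j h else 0) else 0)"
      by (rule sum.cong) auto
    also have "\<dots> = (if j' = j then vvec l i j h else 0)" using assms by (auto simp: sum.delta)
    finally show "(\<Sum>i'\<in>{1..j'}. int (if i' = i \<and> j' = j then 1 else 0) * vvec l i' j' h) = (if j' = j then vvec l i j h else 0)" .
  qed simp
  also have "\<dots> = vvec l i j h" using assms by (simp add: sum.delta)
  finally show "vvec l i j h = (\<Sum>j'\<in>{1..l}. \<Sum>i'\<in>{1..j'}. int (if i' = i \<and> j' = j then 1 else 0) * vvec l i' j' h)" by simp
qed

lemma eps_mod: "i mod l = j mod l \<Longrightarrow> eps l i = eps l j"
  by (auto simp: eps_def)

definition rep :: "nat \<Rightarrow> nat \<Rightarrow> nat" where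
  "rep l i = (if i mod l = 0 then l else i mod l)"

lemma rep: "l \<ge> 1 \<Longrightarrow> rep l i \<in> {1..l}" "rep l i mod l = i mod l"
  by (simp_all add: rep_def less_imp_le)

lemma rep_unique:
  assumes "h \<in> {1..l}" "h mod l = i mod l"
  shows "h = rep l i"
proof (cases "h = l")
  case True then show ?thesis using assms by (auto simp: rep_def)
next
  case False
  then have "h mod l = h" using assms by auto
  then show ?thesis using assms by (auto simp: rep_def)
qed

text \<open>The generators have indices \<open>i \<le> j\<close> in \<open>{1..l}\<close>. Since
  \<open>eps\<close> depends only on residues and \<open>vvec\<close> is symmetric in its indices,
  every pair reduces to such a pair.\<close>

lemma vvec_cone: "l \<ge> 1 \<Longrightarrow> vvec l i j \<in> cone l"
proof -
  assume l: "l \<ge> 1"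
  have eq: "vvec l i j = vvec l (rep l i) (rep l j)"
  proof -
    have "(rep l i + rep l j) mod l = (i + j) mod l" by (rule mod_add_cong) (rule rep(2))+
    then have "eps l (rep l i + rep l j) = eps l (i + j)" by (rule eps_mod)
    moreover have "eps l (rep l i) = eps l i" "eps l (rep l j) = eps l j"
      by (rule eps_mod, rule rep(2))+
    ultimately show ?thesis by (simp add: vvec_def fun_eq_iff)
  qed
  show ?thesis
  proof (cases "rep l i \<le> rep l j")
    case True then show ?thesis unfolding eq using rep(1)[OF l] by (intro vvec_cone0) auto
  next
    case False
    then have "vvec l (rep l j) (rep l i) \<in> cone l" using rep(1)[OF l] by (intro vvec_cone0) auto
    moreover have "vvec l (rep l j) (rep l i) = vvec l (rep l i) (rep l j)"
      by (auto simp: vvec_def fun_eq_iff add.commute)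
    ultimately show ?thesis unfolding eq by simp
  qed
qed

text \<open>For \<open>i\<close> divisible by \<open>l\<close> the indices \<open>i + i\<close> and
  \<open>i\<close> agree modulo \<open>l\<close>, so \<open>vvec l i i\<close> collapses to
  \<open>- eps l i\<close>. This is the move in which a propagating part of tone 0 is cut
  off.\<close>

lemma neg_eps_cone: "l \<ge> 1 \<Longrightarrow> i mod l = 0 \<Longrightarrow> (\<lambda>h. - eps l i h) \<in> cone l"
proof -
  assume a: "l \<ge> 1" "i mod l = 0"
  have "eps l (i + i) = eps l i"
  proof (rule eps_mod)
    have "(i + i) mod l = (i mod l + i mod l) mod l" by (rule mod_add_eq[symmetric])
    also have "\<dots> = i mod l" by (simp only: a(2) add_0 mod_0)
    finally show "(i + i) mod l = i mod l" .
  qed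
  then have "vvec l i i = (\<lambda>h. - eps l i h)" by (auto simp: vvec_def fun_eq_iff)
  then show ?thesis using vvec_cone[OF a(1), of i i] by simp
qed

text \<open>Fusing parts one at a time: each further part adds one vector
  \<open>vvec\<close>.\<close>

lemma eps_sum_cone:
  assumes "l \<ge> 1" "finite F" "F \<noteq> {}"
  shows "(\<lambda>h. eps l (\<Sum>s\<in>F. \<tau> s) h - (\<Sum>s\<in>F. eps l (\<tau> s) h)) \<in> cone l"
  using assms(2,3)
proof (induction rule: finite_ne_induct)
  case (singleton x)
  then show ?case by (simp add: cone_0)
next
  case (insert x F)
  show ?case
    by (rule cone_cong[OF cone_add[OF insert.IH vvec_cone[OF assms(1), of "\<tau> x" "\<Sum>s\<in>F. \<tau> s"]]])
      (use insert.hyps in \<open>simp add: vvec_def\<close>)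
qed

lemma sum_eps: "l \<ge> 1 \<Longrightarrow> (\<Sum>h\<in>{1..l}. eps l i h) = 1"
proof -
  assume l: "l \<ge> 1"
  have "(\<Sum>h\<in>{1..l}. eps l i h) = (\<Sum>h\<in>{1..l}. if h = rep l i then 1 else 0)"
  proof (rule sum.cong[OF refl])
    fix h assume h: "h \<in> {1..l}"
    have "h mod l = i mod l \<longleftrightarrow> h = rep l i" using rep_unique[OF h] rep(2)[of l i] by blast
    then show "eps l i h = (if h = rep l i then 1 else 0)" using h by (simp add: eps_def)
  qed
  also have "\<dots> = 1" using rep(1)[OF l, of i] by simp
  finally show ?thesis .
qed

lemma sum_vvec: "l \<ge> 1 \<Longrightarrow> (\<Sum>h\<in>{1..l}. vvec l i j h) = -1"
  unfolding vvec_def by (simp only: sum_subtractf sum_eps)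

lemma index_le_trans: "index_le l a b \<Longrightarrow> index_le l b c \<Longrightarrow> index_le l a c"
proof -
  assume a: "index_le l a b" and b: "index_le l b c"
  show ?thesis unfolding index_le_cone
    by (rule cone_cong[OF cone_add[OF a[unfolded index_le_cone] b[unfolded index_le_cone]]]) simp
qed

text \<open>Every generator has coordinate sum \<open>-1\<close>, so the coordinate sum of
  \<open>v\<close> is minus the number of generators used, and it vanishes only when none is
  used.\<close>

lemma cone_total:
  assumes l: "l \<ge> 1" and v: "v \<in> cone l"
  shows "(\<Sum>h\<in>{1..l}. v h) \<le> 0"
    and "(\<Sum>h\<in>{1..l}. v h) = 0 \<Longrightarrow> h \<in> {1..l} \<Longrightarrow> v h = 0"
proof -
  obtain c :: "nat \<Rightarrow> nat \<Rightarrow> nat"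
    where c: "\<And>h. h \<in> {1..l} \<Longrightarrow> v h = (\<Sum>j\<in>{1..l}. \<Sum>i\<in>{1..j}. int (c i j) * vvec l i j h)"
    using v unfolding cone_def by blast
  define N where "N = (\<Sum>j\<in>{1..l}. \<Sum>i\<in>{1..j}. c i j)"
  have "(\<Sum>h\<in>{1..l}. v h) = (\<Sum>h\<in>{1..l}. \<Sum>j\<in>{1..l}. \<Sum>i\<in>{1..j}. int (c i j) * vvec l i j h)"
    by (rule sum.cong[OF refl c])
  also have "\<dots> = (\<Sum>j\<in>{1..l}. \<Sum>h\<in>{1..l}. \<Sum>i\<in>{1..j}. int (c i j) * vvec l i j h)"
    by (rule sum.swap)
  also have "\<dots> = (\<Sum>j\<in>{1..l}. \<Sum>i\<in>{1..j}. \<Sum>h\<in>{1..l}. int (c i j) * vvec l i j h)"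
    by (rule sum.cong[OF refl]) (rule sum.swap)
  also have "\<dots> = (\<Sum>j\<in>{1..l}. \<Sum>i\<in>{1..j}. - int (c i j))"
  proof (rule sum.cong[OF refl], rule sum.cong[OF refl])
    fix i j
    have "(\<Sum>h\<in>{1..l}. int (c i j) * vvec l i j h) = int (c i j) * (\<Sum>h\<in>{1..l}. vvec l i j h)"
      by (rule sum_distrib_left[symmetric])
    then show "(\<Sum>h\<in>{1..l}. int (c i j) * vvec l i j h) = - int (c i j)"
      unfolding sum_vvec[OF l] by simp
  qed
  also have "\<dots> = - int N" by (simp add: N_def sum_negf)
  finally have tot: "(\<Sum>h\<in>{1..l}. v h) = - int N" .
  show "(\<Sum>h\<in>{1..l}. v h) \<le> 0" unfolding tot by simp
  assume "(\<Sum>h\<in>{1..l}. v h) = 0" and h: "h \<in> {1..l}"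
  then have "N = 0" unfolding tot by simp
  then have "c i j = 0" if "j \<in> {1..l}" "i \<in> {1..j}" for i j
    using that by (simp add: N_def)
  then show "v h = 0" unfolding c[OF h] by (intro sum.neutral ballI) simp
qed

text \<open>Both differences lie in the cone and have opposite coordinate sums, which must therefore
  be 0.\<close>

lemma index_le_antisym:
  assumes l: "l \<ge> 1" and ab: "index_le l a b" and ba: "index_le l b a" and h: "h \<in> {1..l}"
  shows "a h = b h"
proof -
  have "(\<Sum>h\<in>{1..l}. int (a h) - int (b h)) \<le> 0"
    by (rule cone_total(1)[OF l ab[unfolded index_le_cone]])
  moreover have "(\<Sum>h\<in>{1..l}. int (b h) - int (a h)) \<le> 0"
    by (rule cone_total(1)[OF l ba[unfolded index_le_cone]])
  moreover have "(\<Sum>h\<in>{1..l}. int (b h) - int (a h)) = - (\<Sum>h\<in>{1..l}. int (a h) - int (b h))"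
    unfolding sum_subtractf by (rule minus_diff_eq[symmetric])
  moreover have "x = 0" if "x \<le> 0" "y \<le> 0" "y = - x" for x y :: int using that by linarith
  ultimately have "(\<Sum>h\<in>{1..l}. int (a h) - int (b h)) = 0" by blast
  with cone_total(2)[OF l ab[unfolded index_le_cone]] h
  have "int (a h) - int (b h) = 0" by blast
  then show ?thesis by simp
qed

section \<open>Gluing two partitions along a common row\<close>

definition meets :: "'a set \<Rightarrow> 'a set \<Rightarrow> bool" where
  "meets s A \<longleftrightarrow> s \<inter> A \<noteq> {}"

text \<open>\<open>X\<close>, \<open>Y\<close>, \<open>Z\<close> stand for the top, middle and
  bottom row. They are arbitrary sets so that \<open>swap\<close> turns each statement about the
  upper factor into one about the lower factor.\<close>

locale two_parts =
  fixes X Y Z :: "'a set" and P Q :: "'a set set"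
  assumes XY: "X \<inter> Y = {}" and XZ: "X \<inter> Z = {}" and YZ: "Y \<inter> Z = {}"
    and finX: "finite X" and finY: "finite Y" and finZ: "finite Z"
    and P: "partition_on (X \<union> Y) P" and Q: "partition_on (Y \<union> Z) Q"
begin

abbreviation "G \<equiv> conn_parts (P \<union> Q)"

lemma swap: "two_parts Z Y X Q P"
  using XY XZ YZ finX finY finZ P Q by unfold_locales (simp_all add: Int_commute Un_commute)

lemma cover: "\<Union>(P \<union> Q) = X \<union> Y \<union> Z"
  using P Q unfolding partition_on_def by auto

lemma finP: "finite P"
  using P finX finY by (intro finite_elements[of "X \<union> Y"]) auto

lemma finG: "finite G"
  using partition_on_conn[of "P \<union> Q"] finX finY finZ unfolding cover
  by (intro finite_elements[of "X \<union> Y \<union> Z"]) auto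

lemma G_sub: "g \<in> G \<Longrightarrow> g \<subseteq> X \<union> Y \<union> Z"
  using conn_sub[of g "P \<union> Q"] unfolding cover .

lemma P_ne: "s \<in> P \<Longrightarrow> s \<noteq> {}" using P by (auto simp: partition_on_def)

lemma P_sub: "s \<in> P \<Longrightarrow> s \<subseteq> X \<union> Y" using P by (auto simp: partition_on_def)

lemma P_disj: "s \<in> P \<Longrightarrow> t \<in> P \<Longrightarrow> x \<in> s \<Longrightarrow> x \<in> t \<Longrightarrow> s = t"
  using P by (auto simp: partition_on_def disjoint_def)

lemma P_cover: "x \<in> X \<union> Y \<Longrightarrow> \<exists>s\<in>P. x \<in> s"
  using P by (auto simp: partition_on_def)

lemma P_in: "s \<in> P \<Longrightarrow> g \<in> G \<Longrightarrow> x \<in> s \<Longrightarrow> x \<in> g \<Longrightarrow> s \<subseteq> g"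
  using conn_absorb[of s "P \<union> Q" g] by auto

lemma finite_G_part: "g \<in> G \<Longrightarrow> finite g"
  using G_sub finX finY finZ by (meson finite_Un finite_subset)

lemma host:
  assumes "s \<in> P"
  obtains g where "g \<in> G" "s \<subseteq> g"
  using conn_obtain[of s "P \<union> Q"] P_ne assms by blast

lemma restrict:
  assumes "g \<in> G" "A \<subseteq> X \<union> Y"
  shows "g \<inter> A = (\<Union>s\<in>{s \<in> P. s \<subseteq> g}. s \<inter> A)"
proof
  show "g \<inter> A \<subseteq> (\<Union>s\<in>{s \<in> P. s \<subseteq> g}. s \<inter> A)"
  proof
    fix x assume x: "x \<in> g \<inter> A"
    then obtain s where s: "s \<in> P" "x \<in> s" using P_cover[of x] assms(2) by blast
    then have "s \<subseteq> g" using P_in[OF s(1) assms(1) s(2)] x by simp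
    then show "x \<in> (\<Union>s\<in>{s \<in> P. s \<subseteq> g}. s \<inter> A)" using s x by blast
  qed
qed blast

lemma card_restrict:
  assumes "g \<in> G" "A \<subseteq> X \<union> Y"
  shows "card (g \<inter> A) = (\<Sum>s\<in>{s \<in> P. s \<subseteq> g}. card (s \<inter> A))"
  unfolding restrict[OF assms]
proof (rule card_UN_disjoint)
  show "finite {s \<in> P. s \<subseteq> g}" using finP by auto
  show "\<forall>s\<in>{s \<in> P. s \<subseteq> g}. finite (s \<inter> A)"
    using finite_G_part[OF assms(1)] by (auto intro: finite_subset)
  show "\<forall>s\<in>{s \<in> P. s \<subseteq> g}. \<forall>t\<in>{s \<in> P. s \<subseteq> g}. s \<noteq> t \<longrightarrow> s \<inter> A \<inter> (t \<inter> A) = {}"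
    using P_disj by blast
qed

text \<open>The parts of \<open>Q\<close> do not reach \<open>X\<close>, so nothing can be joined to
  a part of \<open>P\<close> that stays in \<open>X\<close>.\<close>

lemma X_isolated:
  assumes "s \<in> P" "\<not> meets s Y"
  shows "s \<in> G"
proof (rule conn_isolated)
  show "s \<in> P \<union> Q" "s \<noteq> {}" using assms P_ne by auto
  fix t assume t: "t \<in> P \<union> Q" "t \<inter> s \<noteq> {}"
  have "s \<subseteq> X" using assms P_sub[of s] by (auto simp: meets_def)
  then have "t \<notin> Q" using t Q XY XZ unfolding partition_on_def by blast
  then show "t \<subseteq> s" using t P_disj[of t s] assms by blast
qed

text \<open>If no part of \<open>P\<close> inside \<open>g\<close> crossed from \<open>X\<close> to
  \<open>Y\<close>, then \<open>g \<inter> X\<close> would be closed under the parts meeting it and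
  the component \<open>g\<close> would be trapped in \<open>X\<close>.\<close>

lemma meets_prop:
  assumes g: "g \<in> G" "meets g X" "\<not> g \<subseteq> X"
  shows "\<exists>s\<in>P. s \<subseteq> g \<and> meets s X \<and> meets s Y"
proof (rule ccontr)
  assume a: "\<not> ?thesis"
  have "g \<subseteq> g \<inter> X"
  proof (rule conn_minimal[OF g(1)])
    show "g \<inter> (g \<inter> X) \<noteq> {}" using g by (auto simp: meets_def)
    fix s assume s: "s \<in> P \<union> Q" "s \<inter> (g \<inter> X) \<noteq> {}"
    then have "s \<in> P" using Q XY XZ unfolding partition_on_def by blast
    moreover have sg: "s \<subseteq> g" using conn_absorb[OF s(1) g(1)] s(2) by blast
    ultimately have "\<not> meets s Y" using a s(2) unfolding meets_def by blast
    then show "s \<subseteq> g \<inter> X" using sg P_sub[OF \<open>s \<in> P\<close>] unfolding meets_def by blast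
  qed
  then show False using g by blast
qed

text \<open>\<open>PP\<close> collects the propagating parts of the upper factor, \<open>PG\<close>
  the components that become propagating parts of the composite.\<close>

definition "PP = {s \<in> P. meets s X \<and> meets s Y}"
definition "PG = {g \<in> G. meets g X \<and> meets g Z}"

lemma PG_prop: "g \<in> PG \<Longrightarrow> \<exists>s\<in>PP. s \<subseteq> g"
proof -
  assume g: "g \<in> PG"
  then have "\<not> g \<subseteq> X" using XZ unfolding PG_def meets_def by blast
  then show ?thesis using meets_prop[of g] g unfolding PG_def PP_def by blast
qed

text \<open>\<open>F\<close> is the set of loops, \<open>PY\<close> the set of isolated bottom parts
  of the upper factor, which bound their number.\<close>

definition "F = {g \<in> G. g \<subseteq> Y}"
definition "PY = {s \<in> P. s \<subseteq> Y}"

text \<open>A component inside the middle row is covered by parts of \<open>P\<close> inside the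
  middle row. Distinct components receive distinct parts because they are disjoint.\<close>

lemma F_choice: "\<exists>c. (\<forall>g\<in>F. c g \<in> PY \<and> c g \<subseteq> g) \<and> inj_on c F"
proof -
  have "\<exists>s\<in>PY. s \<subseteq> g" if "g \<in> F" for g
  proof -
    have g: "g \<in> G" "g \<subseteq> Y" using that by (auto simp: F_def)
    then obtain x where x: "x \<in> g" "x \<in> Y" using conn_nonempty by blast
    then obtain s where s: "s \<in> P" "x \<in> s" using P_cover[of x] by blast
    have "s \<subseteq> g" by (rule P_in[OF s(1) g(1) s(2) x(1)])
    then show ?thesis using s g unfolding PY_def by blast
  qed
  then obtain c where c: "\<forall>g\<in>F. c g \<in> PY \<and> c g \<subseteq> g" by metis
  have "inj_on c F"
  proof (rule inj_onI)
    fix g h assume a: "g \<in> F" "h \<in> F" "c g = c h"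
    have "c g \<noteq> {}" using c a(1) P_ne by (auto simp: PY_def)
    then obtain x where "x \<in> c g" by blast
    then have "x \<in> g" "x \<in> h" using c a by auto
    then show "g = h" using conn_disjoint[of g "P \<union> Q" h x] a(1,2) by (auto simp: F_def)
  qed
  then show ?thesis using c by blast
qed

lemma finPY: "finite PY" using finP by (simp add: PY_def)

lemma card_F_le: "card F \<le> card PY"
proof -
  obtain c where c: "\<forall>g\<in>F. c g \<in> PY \<and> c g \<subseteq> g" "inj_on c F" using F_choice by blast
  then show ?thesis by (intro card_inj_on_le[OF c(2) _ finPY]) blast
qed

text \<open>With equal cardinalities the choice of a part in each loop is onto, so a loop contains
  only one part of \<open>P\<close> and equals it.\<close>

lemma F_eq:
  assumes card: "card F = card PY"
  shows "F = PY"
proof -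
  obtain c where c: "\<forall>g\<in>F. c g \<in> PY \<and> c g \<subseteq> g" "inj_on c F" using F_choice by blast
  have "card (c ` F) = card PY" using card card_image[OF c(2)] by simp
  then have im: "c ` F = PY" by (intro card_subset_eq) (use finPY c in auto)
  have cg: "c g = g" if g: "g \<in> F" for g
  proof
    show "c g \<subseteq> g" using c g by blast
    have gG: "g \<in> G" "g \<subseteq> Y" using g by (auto simp: F_def)
    show "g \<subseteq> c g"
    proof
      fix x assume x: "x \<in> g"
      then obtain s where s: "s \<in> P" "x \<in> s" using P_cover[of x] gG by blast
      have sg: "s \<subseteq> g" by (rule P_in[OF s(1) gG(1) s(2) x])
      then have "s \<in> PY" using s gG by (auto simp: PY_def)
      then obtain h where h: "h \<in> F" "s = c h" using im by blast
      then have "x \<in> h" using c(1) s(2) by blast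
      then have "h = g" using conn_disjoint[of h "P \<union> Q" g x] h(1) gG(1) x by (auto simp: F_def)
      then show "x \<in> c g" using h s by simp
    qed
  qed
  have "c ` F = F" using cg by simp
  then show ?thesis using im by simp
qed

section \<open>Gluing of tonal partitions\<close>

context
  fixes l :: nat
  assumes l: "l \<ge> 1"
    and tP: "\<And>s. s \<in> P \<Longrightarrow> card (s \<inter> X) mod l = card (s \<inter> Y) mod l"
    and tQ: "\<And>t. t \<in> Q \<Longrightarrow> card (t \<inter> Y) mod l = card (t \<inter> Z) mod l"
begin

text \<open>\<open>X\<close> and \<open>Y\<close> are covered by the parts of \<open>P\<close>, so
  the congruences for the parts of \<open>P\<close> inside \<open>g\<close> add up; \<open>Q\<close>
  enters only through the question which of them lie in \<open>g\<close>.\<close>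

lemma conn_tonal_XY: "g \<in> G \<Longrightarrow> card (g \<inter> X) mod l = card (g \<inter> Y) mod l"
proof -
  assume g: "g \<in> G"
  have "card (g \<inter> X) mod l = (\<Sum>s\<in>{s \<in> P. s \<subseteq> g}. card (s \<inter> X) mod l) mod l"
    using card_restrict[OF g, of X] by (simp add: mod_sum_eq)
  also have "\<dots> = (\<Sum>s\<in>{s \<in> P. s \<subseteq> g}. card (s \<inter> Y) mod l) mod l"
    by (rule arg_cong[of _ _ "\<lambda>x. x mod l"], rule sum.cong[OF refl]) (simp add: tP)
  also have "\<dots> = card (g \<inter> Y) mod l"
    using card_restrict[OF g, of Y] by (simp add: mod_sum_eq)
  finally show ?thesis .
qed

text \<open>A tonal part that misses one of its rows has a multiple of \<open>l\<close> vertices in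
  the other, so modulo \<open>l\<close> only propagating parts contribute.\<close>

lemma tone_sum: 
  assumes g: "g \<in> G"
  shows "card (g \<inter> X) mod l = (\<Sum>s\<in>{s \<in> PP. s \<subseteq> g}. card (s \<inter> X)) mod l"
proof -
  have fin: "finite {s \<in> P. s \<subseteq> g}" using finP by auto
  have "card (g \<inter> X) mod l = (\<Sum>s\<in>{s \<in> P. s \<subseteq> g}. card (s \<inter> X) mod l) mod l"
    using card_restrict[OF g, of X] by (simp add: mod_sum_eq)
  also have "(\<Sum>s\<in>{s \<in> P. s \<subseteq> g}. card (s \<inter> X) mod l) = (\<Sum>s\<in>{s \<in> PP. s \<subseteq> g}. card (s \<inter> X) mod l)"
  proof (rule sum.mono_neutral_right[OF fin])
    show "\<forall>s\<in>{s \<in> P. s \<subseteq> g} - {s \<in> PP. s \<subseteq> g}. card (s \<inter> X) mod l = 0"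
    proof
      fix s assume "s \<in> {s \<in> P. s \<subseteq> g} - {s \<in> PP. s \<subseteq> g}"
      then have s: "s \<in> P" "s \<inter> X = {} \<or> s \<inter> Y = {}" by (auto simp: PP_def meets_def)
      then show "card (s \<inter> X) mod l = 0" using tP[of s] by auto
    qed
  qed (auto simp: PP_def)
  also have "\<dots> mod l = (\<Sum>s\<in>{s \<in> PP. s \<subseteq> g}. card (s \<inter> X)) mod l"
    by (rule mod_sum_eq)
  finally show ?thesis .
qed

lemma conn_tonal_YZ: "g \<in> G \<Longrightarrow> card (g \<inter> Y) mod l = card (g \<inter> Z) mod l"
proof -
  interpret S: two_parts Z Y X Q P by (rule swap)
  assume "g \<in> G"
  then show ?thesis using S.conn_tonal_XY[OF l tQ[symmetric] tP[symmetric], of g]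
    by (simp add: Un_commute)
qed

lemma PP_partition: "PP = (\<Union>g\<in>G. {s \<in> PP. s \<subseteq> g})"
proof
  show "PP \<subseteq> (\<Union>g\<in>G. {s \<in> PP. s \<subseteq> g})"
  proof
    fix s assume s: "s \<in> PP"
    then obtain g where "g \<in> G" "s \<subseteq> g" using host unfolding PP_def by blast
    then show "s \<in> (\<Union>g\<in>G. {s \<in> PP. s \<subseteq> g})" using s by blast
  qed
qed blast

text \<open>The change of the propagating vector is a sum over components. The propagating parts
  inside one component fuse, which \<open>eps_sum_cone\<close> accounts for. If the component does
  not reach the bottom row, its tone is 0 and \<open>neg_eps_cone\<close> removes it.\<close>

lemma conn_cone:
  "(\<lambda>h. (\<Sum>g\<in>PG. eps l (card (g \<inter> X)) h) - (\<Sum>s\<in>PP. eps l (card (s \<inter> X)) h)) \<in> cone l"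
proof -
  \<comment> \<open>The contribution of \<open>g\<close>: its own tone if it propagates, minus the
    tones of the propagating parts it swallows.\<close>
  define d where "d g = (\<lambda>h. (if g \<in> PG then eps l (card (g \<inter> X)) h else 0)
      - (\<Sum>s\<in>{s \<in> PP. s \<subseteq> g}. eps l (card (s \<inter> X)) h))" for g
  have finPP: "finite PP" using finP by (simp add: PP_def)
  have dc: "d g \<in> cone l" if g: "g \<in> G" for g
  proof (cases "{s \<in> PP. s \<subseteq> g} = {}")
    case True
    then have "g \<notin> PG" using PG_prop by blast
    then have "d g = (\<lambda>h. 0)" unfolding d_def True by simp
    then show ?thesis using cone_0 by simp
  next
    case False
    have e: "eps l (\<Sum>s\<in>{s \<in> PP. s \<subseteq> g}. card (s \<inter> X)) = eps l (card (g \<inter> X))"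
      by (rule eps_mod) (rule tone_sum[OF g, symmetric])
    have c: "(\<lambda>h. eps l (card (g \<inter> X)) h - (\<Sum>s\<in>{s \<in> PP. s \<subseteq> g}. eps l (card (s \<inter> X)) h)) \<in> cone l"
      using eps_sum_cone[OF l, of "{s \<in> PP. s \<subseteq> g}" "\<lambda>s. card (s \<inter> X)"] False finPP
      unfolding e by simp
    show ?thesis
    proof (cases "g \<in> PG")
      case True then show ?thesis using c unfolding d_def by simp
    next
      case nPG: False
      obtain s where "s \<in> PP" "s \<subseteq> g" using False by blast
      then have "meets g X" by (auto simp: PP_def meets_def)
      then have "g \<inter> Z = {}" using nPG g unfolding PG_def by (auto simp: meets_def)
      then have "card (g \<inter> X) mod l = 0" using conn_tonal_XY[OF g] conn_tonal_YZ[OF g] by simp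
      then have "(\<lambda>h. - eps l (card (g \<inter> X)) h) \<in> cone l" by (rule neg_eps_cone[OF l])
      from cone_add[OF this c] show ?thesis using nPG unfolding d_def by simp
    qed
  qed
  have "(\<Sum>g\<in>G. d g h) = (\<Sum>g\<in>PG. eps l (card (g \<inter> X)) h) - (\<Sum>s\<in>PP. eps l (card (s \<inter> X)) h)" for h
  proof -
    have "(\<Sum>g\<in>G. d g h) = (\<Sum>g\<in>G. if g \<in> PG then eps l (card (g \<inter> X)) h else 0)
      - (\<Sum>g\<in>G. \<Sum>s\<in>{s \<in> PP. s \<subseteq> g}. eps l (card (s \<inter> X)) h)"
      unfolding d_def by (rule sum_subtractf)
    also have "(\<Sum>g\<in>G. if g \<in> PG then eps l (card (g \<inter> X)) h else 0) = (\<Sum>g\<in>PG. eps l (card (g \<inter> X)) h)"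
      using finG by (simp add: sum.If_cases PG_def Int_def)
    also have "(\<Sum>g\<in>G. \<Sum>s\<in>{s \<in> PP. s \<subseteq> g}. eps l (card (s \<inter> X)) h) = (\<Sum>s\<in>PP. eps l (card (s \<inter> X)) h)"
    proof (subst (2) PP_partition, rule sum.UNION_disjoint[symmetric])
      show "\<forall>g\<in>G. finite {s \<in> PP. s \<subseteq> g}" using finPP by auto
      show "\<forall>g\<in>G. \<forall>h\<in>G. g \<noteq> h \<longrightarrow> {s \<in> PP. s \<subseteq> g} \<inter> {s \<in> PP. s \<subseteq> h} = {}"
      proof (intro ballI impI)
        fix g h assume gh: "g \<in> G" "h \<in> G" "g \<noteq> h"
        then have "g \<inter> h = {}" using conn_disjoint[OF gh(1,2)] by blast
        moreover have "s \<noteq> {}" if "s \<in> PP" for s using that P_ne unfolding PP_def by blast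
        ultimately show "{s \<in> PP. s \<subseteq> g} \<inter> {s \<in> PP. s \<subseteq> h} = {}" by blast
      qed
    qed (rule finG)
    finally show ?thesis .
  qed
  then show ?thesis using cone_sum[of G d l] dc by simp
qed

text \<open>Each propagating component contains a propagating part of \<open>P\<close>, and
  different components contain different ones. Equal numbers make this injection a bijection: no
  propagating part is lost and no two are fused.\<close>

lemma PP_host:
  assumes card: "card PG = card PP"
  shows "s \<in> PP \<Longrightarrow> g \<in> G \<Longrightarrow> s \<subseteq> g \<Longrightarrow> g \<in> PG"
    and "s \<in> PP \<Longrightarrow> s' \<in> PP \<Longrightarrow> g \<in> G \<Longrightarrow> s \<subseteq> g \<Longrightarrow> s' \<subseteq> g \<Longrightarrow> s = s'"
proof -
  have finPP: "finite PP" using finP by (simp add: PP_def)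
  obtain c where c: "\<And>g. g \<in> PG \<Longrightarrow> c g \<in> PP \<and> c g \<subseteq> g" using PG_prop by metis
  have host_unique: "g = h" if "s \<in> PP" "s \<subseteq> g" "s \<subseteq> h" "g \<in> G" "h \<in> G" for s g h
  proof -
    have "s \<noteq> {}" using that P_ne unfolding PP_def by blast
    then obtain x where "x \<in> s" by auto
    then show ?thesis using that conn_disjoint[of g "P \<union> Q" h x] by blast
  qed
  have PGG: "g \<in> G" if "g \<in> PG" for g using that by (simp add: PG_def)
  have "inj_on c PG"
  proof (rule inj_onI)
    fix g h assume a: "g \<in> PG" "h \<in> PG" "c g = c h"
    have "c g \<in> PP" "c g \<subseteq> g" "c g \<subseteq> h" using c[OF a(1)] c[OF a(2)] unfolding a(3) by blast+
    then show "g = h" using host_unique PGG[OF a(1)] PGG[OF a(2)] by blast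
  qed
  then have "card (c ` PG) = card PP" using card by (simp add: card_image)
  then have im: "c ` PG = PP" by (intro card_subset_eq) (use finPP c in auto)
  have key: "g \<in> PG \<and> c g = s" if s: "s \<in> PP" "g \<in> G" "s \<subseteq> g" for s g
  proof -
    obtain h where h: "h \<in> PG" "s = c h" using s(1) im by blast
    have "h = g" using host_unique[OF s(1) _ s(3) PGG[OF h(1)] s(2)] c[OF h(1)] h(2) by blast
    then show ?thesis using h by blast
  qed
  show "s \<in> PP \<Longrightarrow> g \<in> G \<Longrightarrow> s \<subseteq> g \<Longrightarrow> g \<in> PG" using key by blast
  show "s \<in> PP \<Longrightarrow> s' \<in> PP \<Longrightarrow> g \<in> G \<Longrightarrow> s \<subseteq> g \<Longrightarrow> s' \<subseteq> g \<Longrightarrow> s = s'"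
    using key by blast
qed

text \<open>Two parts of \<open>P\<close> in \<open>g\<close> that meet \<open>X\<close> coincide:
  if both propagate, by \<open>PP_host\<close>; otherwise one of them is a whole component, so it
  equals \<open>g\<close> and contains the other.\<close>

lemma PG_restrict:
  assumes card: "card PG = card PP"
    and g: "g \<in> G" and s: "s \<in> P" "s \<subseteq> g" "meets s X"
  shows "g \<inter> X = s \<inter> X"
proof -
  have "s' = s" if s': "s' \<in> P" "s' \<subseteq> g" "meets s' X" for s'
  proof (cases "meets s Y \<and> meets s' Y")
    case True
    then show ?thesis using PP_host(2)[OF card, of s' s g] s s' g unfolding PP_def by blast
  next
    case False
    have "t = g" if "t \<in> P" "t \<subseteq> g" "meets t X" "\<not> meets t Y" for t
    proof -
      have "t \<noteq> {}" using that by (auto simp: meets_def)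
      then obtain x where "x \<in> t" by blast
      then show ?thesis using conn_disjoint[OF X_isolated[OF that(1,4)] g, of x] that(2) by blast
    qed
    then have "s = g \<or> s' = g" using False s s' by blast
    moreover have "s \<noteq> {}" "s' \<noteq> {}" using P_ne s(1) s'(1) by blast+
    ultimately show ?thesis using P_disj[OF s'(1) s(1)] s(2) s'(2) by blast
  qed
  then have "{t \<in> P. t \<subseteq> g} \<subseteq> insert s {t \<in> P. \<not> meets t X}" by blast
  then have "(\<Union>t\<in>{t \<in> P. t \<subseteq> g}. t \<inter> X) \<subseteq> s \<inter> X" unfolding meets_def by blast
  then show ?thesis using restrict[OF g, of X] s by blast
qed

text \<open>The part of \<open>P\<close> at a top vertex of \<open>g\<close> cannot propagate, since
  \<open>g\<close> would then be in \<open>PG\<close>. So it is a component by itself and equals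
  \<open>g\<close>.\<close>

lemma PG_isolated:
  assumes card: "card PG = card PP"
    and g: "g \<in> G" "meets g X" "\<not> meets g Z"
  shows "g \<in> P" "\<not> meets g Y"
proof -
  obtain x where x: "x \<in> g" "x \<in> X" using g(2) by (auto simp: meets_def)
  then obtain s where s: "s \<in> P" "x \<in> s" using P_cover[of x] by blast
  have sg: "s \<subseteq> g" by (rule P_in[OF s(1) g(1) s(2) x(1)])
  have sX: "meets s X" using s x by (auto simp: meets_def)
  have nY: "\<not> meets s Y"
  proof
    assume "meets s Y"
    then have "s \<in> PP" using s sX by (simp add: PP_def)
    then have "g \<in> PG" using PP_host(1)[OF card _ g(1) sg] by blast
    then show False using g(3) by (simp add: PG_def)
  qed
  then have "s \<in> G" by (rule X_isolated[OF s(1)])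
  then have "s = g" using conn_disjoint[OF _ g(1) s(2) x(1)] by blast
  then show "g \<in> P" "\<not> meets g Y" using s nY by blast+
qed

text \<open>By \<open>F = PY\<close> the parts of \<open>P\<close> inside the middle row are loops
  and do not occur in a propagating component. Only its unique propagating part is left to fill the
  middle row of \<open>g\<close>.\<close>

lemma PG_middle:
  assumes card: "card PG = card PP" and F: "F = PY"
    and g: "g \<in> PG" and s: "s \<in> PP" "s \<subseteq> g"
  shows "g \<inter> Y = s \<inter> Y"
proof -
  have gG: "g \<in> G" using g by (simp add: PG_def)
  have "t = s" if t: "t \<in> P" "t \<subseteq> g" "meets t Y" for t
  proof (cases "meets t X")
    case True
    then have "t \<in> PP" using t by (simp add: PP_def)
    then show ?thesis using PP_host(2)[OF card _ s(1) gG t(2) s(2)] by blast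
  next
    case False
    then have "t \<in> F" unfolding F using t P_sub[OF t(1)] by (auto simp: PY_def meets_def)
    then have tG: "t \<in> G" "t \<subseteq> Y" by (auto simp: F_def)
    obtain x where "x \<in> t" using P_ne[OF t(1)] by blast
    then have "t = g" using conn_disjoint[OF tG(1) gG] t(2) by blast
    then show ?thesis using tG(2) g XY unfolding PG_def meets_def by blast
  qed
  then have "(\<Union>t\<in>{t \<in> P. t \<subseteq> g}. t \<inter> Y) \<subseteq> s \<inter> Y" unfolding meets_def by blast
  then show ?thesis using restrict[OF gG, of Y] s by blast
qed

end

end

lemma count_eps:
  fixes f :: "'a \<Rightarrow> nat"
  assumes "finite A" "h \<in> {1..l}"
  shows "int (card {s \<in> A. f s mod l = h mod l}) = (\<Sum>s\<in>A. eps l (f s) h)"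
proof -
  have "(\<Sum>s\<in>A. eps l (f s) h) = (\<Sum>s\<in>A. if f s mod l = h mod l then 1 else 0)"
    using assms(2) by (intro sum.cong refl) (auto simp: eps_def)
  also have "\<dots> = int (card {s \<in> A. f s mod l = h mod l})"
    using assms(1) by (simp add: sum.If_cases Int_def)
  finally show ?thesis by simp
qed

text \<open>Each residue has exactly one representative in \<open>{1..l}\<close>, so every element
  is counted once.\<close>

lemma sum_count:
  fixes f :: "'a \<Rightarrow> nat"
  assumes "l \<ge> 1" "finite A"
  shows "(\<Sum>h\<in>{1..l}. card {s \<in> A. f s mod l = h mod l}) = card A"
proof -
  have "int (\<Sum>h\<in>{1..l}. card {s \<in> A. f s mod l = h mod l}) = (\<Sum>h\<in>{1..l}. \<Sum>s\<in>A. eps l (f s) h)"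
    unfolding of_nat_sum using count_eps[OF assms(2)] by (intro sum.cong refl) blast
  also have "\<dots> = (\<Sum>s\<in>A. \<Sum>h\<in>{1..l}. eps l (f s) h)" by (rule sum.swap)
  also have "\<dots> = int (card A)" by (simp only: sum_eps[OF assms(1)]) simp
  finally show ?thesis unfolding of_nat_eq_iff .
qed

section \<open>Composition of diagrams\<close>

abbreviation "rT \<equiv> range Top"
abbreviation "rM \<equiv> range Mid"
abbreviation "rB \<equiv> range Bot"

lemma vertex_disjoint: "rT \<inter> rM = {}" "rT \<inter> rB = {}" "rM \<inter> rB = {}"
  by auto

text \<open>The two halves of \<open>stacked\<close>, kept apart so that they can serve as
  \<open>P\<close> and \<open>Q\<close> of \<open>two_parts\<close>.\<close>

definition upper :: "diagram \<Rightarrow> diagram" where "upper p = (`) bot_to_mid ` p"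
definition lower :: "diagram \<Rightarrow> diagram" where "lower p = (`) top_to_mid ` p"

lemma glue_conn: "glue p p' = conn_parts (upper p \<union> lower p')"
  by (simp add: glue_def conn_parts_def stacked_def upper_def lower_def)

lemma diagram_sub: "p \<in> diagrams n m \<Longrightarrow> s \<in> p \<Longrightarrow> s \<subseteq> Top ` {1..n} \<union> Bot ` {1..m}"
  by (auto simp: diagrams_def partition_on_def)

lemma diagram_ne: "p \<in> diagrams n m \<Longrightarrow> s \<in> p \<Longrightarrow> s \<noteq> {}"
  by (auto simp: diagrams_def partition_on_def)

lemma diagram_disj: "p \<in> diagrams n m \<Longrightarrow> s \<in> p \<Longrightarrow> t \<in> p \<Longrightarrow> x \<in> s \<Longrightarrow> x \<in> t \<Longrightarrow> s = t"
  by (auto simp: diagrams_def partition_on_def disjoint_def)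

lemma diagram_cover: "p \<in> diagrams n m \<Longrightarrow> x \<in> Top ` {1..n} \<union> Bot ` {1..m} \<Longrightarrow> \<exists>s\<in>p. x \<in> s"
  unfolding diagrams_def partition_on_def by blast

lemma finite_diagram: "p \<in> diagrams n m \<Longrightarrow> finite p"
  unfolding diagrams_def by (auto intro: finite_elements[of "Top ` {1..n} \<union> Bot ` {1..m}"])

lemma finite_part: "p \<in> diagrams n m \<Longrightarrow> s \<in> p \<Longrightarrow> finite s"
  using diagram_sub[of p n m s] by (auto intro: finite_subset)

lemma finite_diagrams: "finite (diagrams n m)"
proof (rule finite_subset)
  show "diagrams n m \<subseteq> Pow (Pow (Top ` {1..n} \<union> Bot ` {1..m}))"
    using diagram_sub by blast
qed simp

lemma bot_to_mid_image: "s \<subseteq> rT \<union> rB \<Longrightarrow> bot_to_mid ` s = (s \<inter> rT) \<union> bot_to_mid ` (s \<inter> rB)"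
proof -
  assume s: "s \<subseteq> rT \<union> rB"
  have "bot_to_mid ` (s \<inter> rT) = s \<inter> rT" proof -
    have "bot_to_mid ` (s \<inter> rT) = id ` (s \<inter> rT)" by (rule image_cong) auto
    then show ?thesis by simp
  qed
  moreover have "s = (s \<inter> rT) \<union> (s \<inter> rB)" using s by blast
  ultimately show ?thesis by (metis image_Un)
qed

lemma top_to_mid_image: "s \<subseteq> rT \<union> rB \<Longrightarrow> top_to_mid ` s = (s \<inter> rB) \<union> top_to_mid ` (s \<inter> rT)"
proof -
  assume s: "s \<subseteq> rT \<union> rB"
  have "top_to_mid ` (s \<inter> rB) = s \<inter> rB" proof -
    have "top_to_mid ` (s \<inter> rB) = id ` (s \<inter> rB)" by (rule image_cong) auto
    then show ?thesis by simp
  qed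
  moreover have "s = (s \<inter> rB) \<union> (s \<inter> rT)" using s by blast
  ultimately show ?thesis by (metis image_Un)
qed

lemma top_to_mid_rT: "top_to_mid ` (s \<inter> rT) \<subseteq> rM" by auto

lemma inj_bot_to_mid: "inj_on bot_to_mid (rT \<union> rB)" by (auto simp: inj_on_def)
lemma inj_top_to_mid: "inj_on top_to_mid (rT \<union> rB)" by (auto simp: inj_on_def)

lemma upper_parts:
  assumes "s \<subseteq> Top ` {1..n} \<union> Bot ` {1..m}"
  shows "bot_to_mid ` s \<inter> Top ` {1..n} = s \<inter> rT"
    and "bot_to_mid ` s \<inter> Mid ` {1..m} = bot_to_mid ` (s \<inter> rB)"
    and "card (bot_to_mid ` s \<inter> Top ` {1..n}) = ntop s"
    and "card (bot_to_mid ` s \<inter> Mid ` {1..m}) = nbot s"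
    and "meets (bot_to_mid ` s) (Top ` {1..n}) \<longleftrightarrow> s \<inter> rT \<noteq> {}"
    and "meets (bot_to_mid ` s) (Mid ` {1..m}) \<longleftrightarrow> s \<inter> rB \<noteq> {}"
proof -
  have sub: "s \<subseteq> rT \<union> rB" using assms by blast
  show a: "bot_to_mid ` s \<inter> Top ` {1..n} = s \<inter> rT"
    unfolding bot_to_mid_image[OF sub] using assms by auto
  show b: "bot_to_mid ` s \<inter> Mid ` {1..m} = bot_to_mid ` (s \<inter> rB)"
    unfolding bot_to_mid_image[OF sub] using assms by auto
  show "card (bot_to_mid ` s \<inter> Top ` {1..n}) = ntop s" unfolding a ntop_def ..
  show "card (bot_to_mid ` s \<inter> Mid ` {1..m}) = nbot s"
    unfolding b nbot_def by (rule card_image) (auto simp: inj_on_def)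
  show "meets (bot_to_mid ` s) (Top ` {1..n}) \<longleftrightarrow> s \<inter> rT \<noteq> {}" unfolding meets_def a ..
  show "meets (bot_to_mid ` s) (Mid ` {1..m}) \<longleftrightarrow> s \<inter> rB \<noteq> {}" unfolding meets_def b by simp
qed

lemma lower_parts:
  assumes "s \<subseteq> Top ` {1..n} \<union> Bot ` {1..m}"
  shows "top_to_mid ` s \<inter> Bot ` {1..m} = s \<inter> rB"
    and "top_to_mid ` s \<inter> Mid ` {1..n} = top_to_mid ` (s \<inter> rT)"
    and "card (top_to_mid ` s \<inter> Bot ` {1..m}) = nbot s"
    and "card (top_to_mid ` s \<inter> Mid ` {1..n}) = ntop s"
    and "meets (top_to_mid ` s) (Bot ` {1..m}) \<longleftrightarrow> s \<inter> rB \<noteq> {}"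
    and "meets (top_to_mid ` s) (Mid ` {1..n}) \<longleftrightarrow> s \<inter> rT \<noteq> {}"
proof -
  have sub: "s \<subseteq> rT \<union> rB" using assms by blast
  show a: "top_to_mid ` s \<inter> Bot ` {1..m} = s \<inter> rB"
    unfolding top_to_mid_image[OF sub] using assms by auto
  show b: "top_to_mid ` s \<inter> Mid ` {1..n} = top_to_mid ` (s \<inter> rT)"
    unfolding top_to_mid_image[OF sub] using assms by auto
  show "card (top_to_mid ` s \<inter> Bot ` {1..m}) = nbot s" unfolding a nbot_def ..
  show "card (top_to_mid ` s \<inter> Mid ` {1..n}) = ntop s"
    unfolding b ntop_def by (rule card_image) (auto simp: inj_on_def)
  show "meets (top_to_mid ` s) (Bot ` {1..m}) \<longleftrightarrow> s \<inter> rB \<noteq> {}" unfolding meets_def a ..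
  show "meets (top_to_mid ` s) (Mid ` {1..n}) \<longleftrightarrow> s \<inter> rT \<noteq> {}" unfolding meets_def b by simp
qed

lemma inj_image_diagram:
  assumes "p \<in> diagrams n m"
  shows "inj_on ((`) bot_to_mid) p" "inj_on ((`) top_to_mid) p"
proof -
  have sub: "s \<subseteq> rT \<union> rB" if "s \<in> p" for s using diagram_sub[OF assms that] by blast
  show "inj_on ((`) bot_to_mid) p"
    by (rule inj_onI) (use inj_on_image_eq_iff[OF inj_bot_to_mid sub sub] in blast)
  show "inj_on ((`) top_to_mid) p"
    by (rule inj_onI) (use inj_on_image_eq_iff[OF inj_top_to_mid sub sub] in blast)
qed

lemma partition_on_image:
  assumes "partition_on A P" "inj_on f A"
  shows "partition_on (f ` A) ((`) f ` P)"
proof -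
  have "{} \<notin> (`) f ` P" using assms(1) by (auto simp: partition_on_def)
  then show ?thesis using partition_on_inj_image[OF assms] by simp
qed

locale composable =
  fixes n m r :: nat and p p' :: diagram
  assumes p: "p \<in> diagrams n m" and p': "p' \<in> diagrams m r"

sublocale composable \<subseteq> two_parts "Top ` {1..n}" "Mid ` {1..m}" "Bot ` {1..r}" "upper p" "lower p'"
proof
  have "partition_on (bot_to_mid ` (Top ` {1..n} \<union> Bot ` {1..m})) ((`) bot_to_mid ` p)"
    by (rule partition_on_image) (use p in \<open>auto simp: diagrams_def inj_on_def\<close>)
  then show "partition_on (Top ` {1..n} \<union> Mid ` {1..m}) (upper p)"
    by (simp add: upper_def image_Un image_image)
  have "partition_on (top_to_mid ` (Top ` {1..m} \<union> Bot ` {1..r})) ((`) top_to_mid ` p')"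
    by (rule partition_on_image) (use p' in \<open>auto simp: diagrams_def inj_on_def\<close>)
  then show "partition_on (Mid ` {1..m} \<union> Bot ` {1..r}) (lower p')"
    by (simp add: lower_def image_Un image_image)
qed auto

context composable
begin

lemma glue_G: "glue p p' = G" by (rule glue_conn)

lemma dcompI: "g \<in> G \<Longrightarrow> g - rM \<noteq> {} \<Longrightarrow> g - rM \<in> dcomp p p'"
  by (auto simp: dcomp_def glue_G)

lemma dcompE:
  assumes "t \<in> dcomp p p'"
  obtains g where "g \<in> G" "t = g - rM" "t \<noteq> {}"
  using assms by (auto simp: dcomp_def glue_G)

lemma G_outer:
  assumes g: "g \<in> G"
  shows "(g - rM) \<inter> rT = g \<inter> Top ` {1..n}" "(g - rM) \<inter> rB = g \<inter> Bot ` {1..r}"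
    "g - rM = g \<inter> Top ` {1..n} \<union> g \<inter> Bot ` {1..r}" "g \<subseteq> rM \<longleftrightarrow> g \<subseteq> Mid ` {1..m}"
  using G_sub[OF g] by auto

lemma dcomp_diagrams: "dcomp p p' \<in> diagrams n r"
  unfolding diagrams_def
proof (intro CollectI partition_onI)
  show "{} \<notin> dcomp p p'" by (simp add: dcomp_def)
  show "\<Union>(dcomp p p') = Top ` {1..n} \<union> Bot ` {1..r}"
  proof
    show "\<Union>(dcomp p p') \<subseteq> Top ` {1..n} \<union> Bot ` {1..r}"
      using G_outer(3) by (auto elim!: dcompE)
    show "Top ` {1..n} \<union> Bot ` {1..r} \<subseteq> \<Union>(dcomp p p')"
    proof
      fix x assume x: "x \<in> Top ` {1..n} \<union> Bot ` {1..r}"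
      then have "x \<in> \<Union>(upper p \<union> lower p')" unfolding cover by blast
      then obtain g where g: "g \<in> G" "x \<in> g" using conn_cover by (metis UnionE)
      then have "x \<in> g - rM" using x by auto
      then show "x \<in> \<Union>(dcomp p p')" using dcompI[OF g(1)] by blast
    qed
  qed
  fix s t assume s: "s \<in> dcomp p p'" and t: "t \<in> dcomp p p'" and st: "s \<noteq> t"
  obtain g where g: "g \<in> G" "s = g - rM" using s by (rule dcompE)
  obtain h where h: "h \<in> G" "t = h - rM" using t by (rule dcompE)
  have "g \<noteq> h" using g h st by blast
  then show "disjnt s t" using conn_disjoint[OF g(1) h(1)] g(2) h(2) unfolding disjnt_def by blast
qed

lemma G_outer_inj: "g \<in> G \<Longrightarrow> h \<in> G \<Longrightarrow> g - rM = h - rM \<Longrightarrow> g - rM \<noteq> {} \<Longrightarrow> g = h"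
  using conn_disjoint by (metis Diff_iff ex_in_conv)

lemma propagating_outer: "g \<in> G \<Longrightarrow> propagating (g - rM) \<longleftrightarrow> meets g (Top ` {1..n}) \<and> meets g (Bot ` {1..r})"
  unfolding propagating_def meets_def using G_outer by simp

text \<open>Distinct components stay distinct after deletion of the middle row as soon as an outer
  vertex remains.\<close>

lemma bij_PG: "bij_betw (\<lambda>g. g - rM) PG {t \<in> dcomp p p'. propagating t}"
  unfolding bij_betw_def
proof
  have PG: "g \<in> G \<and> g - rM \<noteq> {} \<and> propagating (g - rM)" if "g \<in> PG" for g
  proof -
    have "g \<in> G" "propagating (g - rM)" using that propagating_outer[of g] unfolding PG_def by blast+
    then show ?thesis by (auto simp: propagating_def)
  qed
  show "inj_on (\<lambda>g. g - rM) PG"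
  proof (rule inj_onI)
    fix g h assume "g \<in> PG" "h \<in> PG" "g - rM = h - rM"
    then show "g = h" using G_outer_inj[of g h] PG[of g] PG[of h] by blast
  qed
  show "(\<lambda>g. g - rM) ` PG = {t \<in> dcomp p p'. propagating t}"
  proof
    show "(\<lambda>g. g - rM) ` PG \<subseteq> {t \<in> dcomp p p'. propagating t}" using PG dcompI by blast
    show "{t \<in> dcomp p p'. propagating t} \<subseteq> (\<lambda>g. g - rM) ` PG"
    proof clarify
      fix t assume t: "t \<in> dcomp p p'" "propagating t"
      obtain g where g: "g \<in> G" "t = g - rM" using t(1) by (rule dcompE)
      then have "g \<in> PG" using t(2) propagating_outer[of g] unfolding PG_def by blast
      then show "t \<in> (\<lambda>g. g - rM) ` PG" using g by blast
    qed
  qed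
qed

lemma bij_PP: "bij_betw ((`) bot_to_mid) {s \<in> p. propagating s} PP"
  unfolding bij_betw_def
proof
  show "inj_on ((`) bot_to_mid) {s \<in> p. propagating s}"
    using inj_image_diagram(1)[OF p] by (rule inj_on_subset) auto
  show "(`) bot_to_mid ` {s \<in> p. propagating s} = PP"
  proof -
    have "s \<in> p \<Longrightarrow> propagating s \<longleftrightarrow> bot_to_mid ` s \<in> PP" for s
      unfolding PP_def propagating_def
      using upper_parts(5,6)[OF diagram_sub[OF p, of s]] by (auto simp: upper_def)
    moreover have "PP \<subseteq> (`) bot_to_mid ` p" unfolding PP_def by (auto simp: upper_def)
    ultimately show ?thesis by blast
  qed
qed

lemma ntop_outer: "g \<in> G \<Longrightarrow> ntop (g - rM) = card (g \<inter> Top ` {1..n})"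
  "g \<in> G \<Longrightarrow> nbot (g - rM) = card (g \<inter> Bot ` {1..r})"
  unfolding ntop_def nbot_def by (simp_all only: G_outer(1,2))

end

section \<open>Composition of tonal diagrams\<close>

locale tonal_composable =
  fixes l n :: nat and p p' :: diagram
  assumes l: "l \<ge> 1" and p: "p \<in> tonal l n" and p': "p' \<in> tonal l n"

lemma tonal_diagram: "p \<in> tonal l n \<Longrightarrow> p \<in> diagrams n n"
  by (simp add: tonal_def)

sublocale tonal_composable \<subseteq> composable n n n p p'
  by unfold_locales (use p p' tonal_diagram in auto)

lemma prop_vec_eps:
  assumes "finite p" "h \<in> {1..l}"
  shows "int (prop_vec l p h) = (\<Sum>s\<in>{s \<in> p. propagating s}. eps l (ntop s) h)"
proof -
  have "{s \<in> p. propagating s \<and> ntop s mod l = h mod l} = {s \<in> {s \<in> p. propagating s}. ntop s mod l = h mod l}"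
    by auto
  then show ?thesis using count_eps[of "{s \<in> p. propagating s}" h l ntop] assms
    by (simp add: prop_vec_def)
qed

lemma prop_vec_sum:
  assumes "finite p" "l \<ge> 1"
  shows "(\<Sum>h\<in>{1..l}. prop_vec l p h) = card {s \<in> p. propagating s}"
proof -
  have "(\<Sum>h\<in>{1..l}. prop_vec l p h)
      = (\<Sum>h\<in>{1..l}. card {s \<in> {s \<in> p. propagating s}. ntop s mod l = h mod l})"
    by (rule sum.cong[OF refl]) (simp add: prop_vec_def conj_assoc)
  then show ?thesis using sum_count[OF assms(2), of "{s \<in> p. propagating s}" ntop] assms(1) by simp
qed

context tonal_composable
begin

lemma tone_P: "s \<in> upper p \<Longrightarrow> card (s \<inter> Top ` {1..n}) mod l = card (s \<inter> Mid ` {1..n}) mod l"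
proof -
  assume "s \<in> upper p"
  then obtain u where u: "u \<in> p" "s = bot_to_mid ` u" by (auto simp: upper_def)
  then have "ntop u mod l = nbot u mod l" using p by (auto simp: tonal_def)
  then show ?thesis
    using upper_parts(3,4)[OF diagram_sub[OF tonal_diagram[OF p] u(1)]] unfolding u(2) by argo
qed

lemma tone_Q: "s \<in> lower p' \<Longrightarrow> card (s \<inter> Mid ` {1..n}) mod l = card (s \<inter> Bot ` {1..n}) mod l"
proof -
  assume "s \<in> lower p'"
  then obtain u where u: "u \<in> p'" "s = top_to_mid ` u" by (auto simp: lower_def)
  then have "ntop u mod l = nbot u mod l" using p' by (auto simp: tonal_def)
  then show ?thesis
    using lower_parts(3,4)[OF diagram_sub[OF tonal_diagram[OF p'] u(1)]] unfolding u(2) by argo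
qed

lemma glue_tonal:
  assumes g: "g \<in> G"
  shows "card (g \<inter> Top ` {1..n}) mod l = card (g \<inter> Bot ` {1..n}) mod l"
proof -
  have "card (g \<inter> Top ` {1..n}) mod l = card (g \<inter> Mid ` {1..n}) mod l"
    by (rule conn_tonal_XY[OF l tone_P tone_Q g])
  also have "\<dots> = card (g \<inter> Bot ` {1..n}) mod l"
    by (rule conn_tonal_YZ[OF l tone_P tone_Q g])
  finally show ?thesis .
qed

lemma dcomp_tonal: "dcomp p p' \<in> tonal l n"
proof -
  have "ntop t mod l = nbot t mod l" if t: "t \<in> dcomp p p'" for t
  proof -
    obtain g where g: "g \<in> G" "t = g - rM" using t by (rule dcompE)
    show ?thesis unfolding g(2) ntop_outer[OF g(1)] by (rule glue_tonal[OF g(1)])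
  qed
  then show ?thesis using dcomp_diagrams by (simp add: tonal_def)
qed

lemma prop_vec_upper:
  assumes h: "h \<in> {1..l}"
  shows "int (prop_vec l p h) = (\<Sum>s\<in>PP. eps l (card (s \<inter> Top ` {1..n})) h)"
proof -
  have "(\<Sum>s\<in>{s \<in> p. propagating s}. eps l (ntop s) h)
      = (\<Sum>s\<in>{s \<in> p. propagating s}. eps l (card (bot_to_mid ` s \<inter> Top ` {1..n})) h)"
    by (rule sum.cong[OF refl])
      (simp only: upper_parts(3)[OF diagram_sub[OF tonal_diagram[OF p]]] mem_Collect_eq)
  also have "\<dots> = (\<Sum>s\<in>PP. eps l (card (s \<inter> Top ` {1..n})) h)"
    by (rule sum.reindex_bij_betw[OF bij_PP])
  finally show ?thesis
    using prop_vec_eps[OF finite_diagram[OF tonal_diagram[OF p]] h] by argo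
qed

lemma prop_vec_glue:
  assumes h: "h \<in> {1..l}"
  shows "int (prop_vec l (dcomp p p') h) = (\<Sum>g\<in>PG. eps l (card (g \<inter> Top ` {1..n})) h)"
proof -
  have "(\<Sum>g\<in>PG. eps l (card (g \<inter> Top ` {1..n})) h) = (\<Sum>g\<in>PG. eps l (ntop (g - rM)) h)"
    by (rule sum.cong[OF refl]) (simp only: PG_def mem_Collect_eq ntop_outer(1))
  also have "\<dots> = (\<Sum>s\<in>{s \<in> dcomp p p'. propagating s}. eps l (ntop s) h)"
    by (rule sum.reindex_bij_betw[OF bij_PG])
  finally show ?thesis
    using prop_vec_eps[OF finite_diagram[OF dcomp_diagrams] h] by argo
qed

lemma prop_vec_le_left: "index_le l (prop_vec l (dcomp p p')) (prop_vec l p)"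
  unfolding index_le_cone
proof (rule cone_cong)
  show "(\<lambda>h. (\<Sum>g\<in>PG. eps l (card (g \<inter> Top ` {1..n})) h)
      - (\<Sum>s\<in>PP. eps l (card (s \<inter> Top ` {1..n})) h)) \<in> cone l"
    by (rule conn_cone[OF l tone_P tone_Q])
qed (simp only: prop_vec_upper prop_vec_glue)

text \<open>The coordinates of a propagating vector add up to the number of propagating parts. This
  turns equality of vectors into the cardinality hypothesis of the rigidity lemmas such as
  \<open>PP_host\<close>.\<close>

lemma card_PG_left:
  assumes "prop_vec l (dcomp p p') = prop_vec l p"
  shows "card PG = card PP"
  using prop_vec_sum[OF finite_diagram[OF dcomp_diagrams] l]
    prop_vec_sum[OF finite_diagram[OF tonal_diagram[OF p]] l]
    bij_betw_same_card[OF bij_PP] bij_betw_same_card[OF bij_PG] assms by simp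

end

section \<open>Reflection of diagrams\<close>

lemma inj_flip_vertex: "inj flip_vertex"
  by (rule inj_on_inverseI[of _ flip_vertex]) (metis flip_vertex.simps vertex.exhaust)

lemma flip_flip_vertex [simp]: "flip_vertex (flip_vertex v) = v"
  by (cases v) auto

lemma flip_flip_part [simp]: "flip_vertex ` flip_vertex ` s = s"
  by (simp add: image_image)

lemma flip_flip [simp]: "flip (flip p) = p"
  by (simp add: flip_def image_image)

lemma flip_mem: "s \<in> flip p \<longleftrightarrow> flip_vertex ` s \<in> p"
proof -
  have "s \<in> flip p \<longleftrightarrow> (\<exists>t\<in>p. s = flip_vertex ` t)" by (auto simp: flip_def)
  also have "\<dots> \<longleftrightarrow> flip_vertex ` s \<in> p" by (metis flip_flip_part)
  finally show ?thesis .
qed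

lemma flip_vertex_range: "flip_vertex v \<in> rM \<longleftrightarrow> v \<in> rM" "flip_vertex v \<in> rT \<longleftrightarrow> v \<in> rB"
  "flip_vertex v \<in> rB \<longleftrightarrow> v \<in> rT"
  by (cases v; auto)+

lemma flip_part_Int: "flip_vertex ` s \<inter> rT = flip_vertex ` (s \<inter> rB)"
  "flip_vertex ` s \<inter> rB = flip_vertex ` (s \<inter> rT)"
  using flip_vertex_range by blast+

lemma ntop_flip: "ntop (flip_vertex ` s) = nbot s" "nbot (flip_vertex ` s) = ntop s"
  unfolding ntop_def nbot_def flip_part_Int
  by (rule card_image, rule inj_on_subset[OF inj_flip_vertex], simp)+

lemma propagating_flip: "propagating (flip_vertex ` s) = propagating s"
  unfolding propagating_def flip_part_Int by auto

lemma flip_diagrams: "p \<in> diagrams n m \<Longrightarrow> flip p \<in> diagrams m n"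
proof -
  assume "p \<in> diagrams n m"
  then have "partition_on (flip_vertex ` (Top ` {1..n} \<union> Bot ` {1..m})) (flip p)"
    unfolding flip_def diagrams_def
    by (intro partition_on_image inj_on_subset[OF inj_flip_vertex]) auto
  moreover have "flip_vertex ` (Top ` {1..n} \<union> Bot ` {1..m}) = Top ` {1..m} \<union> Bot ` {1..n}"
    by (simp add: image_Un image_image Un_commute)
  ultimately show ?thesis by (simp add: diagrams_def)
qed

lemma flip_tonal: "p \<in> tonal l n \<Longrightarrow> flip p \<in> tonal l n"
  using flip_diagrams[of p n n] unfolding tonal_def by (auto simp: flip_def ntop_flip)

text \<open>The tone of a part may be read in either row, by tonality.\<close>

lemma prop_vec_flip:
  assumes "p \<in> tonal l n"
  shows "prop_vec l (flip p) = prop_vec l p"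
proof
  fix h
  have "{s \<in> flip p. propagating s \<and> ntop s mod l = h mod l}
      = (`) flip_vertex ` {s \<in> p. propagating s \<and> nbot s mod l = h mod l}"
    by (auto simp: flip_def propagating_flip ntop_flip)
  also have "{s \<in> p. propagating s \<and> nbot s mod l = h mod l} = {s \<in> p. propagating s \<and> ntop s mod l = h mod l}"
    using assms by (auto simp: tonal_def)
  finally have "card {s \<in> flip p. propagating s \<and> ntop s mod l = h mod l}
     = card {s \<in> p. propagating s \<and> ntop s mod l = h mod l}"
    using card_image[of "(`) flip_vertex" "{s \<in> p. propagating s \<and> ntop s mod l = h mod l}"]
    by (metis (no_types, lifting) flip_flip_part inj_onI)
  then show "prop_vec l (flip p) h = prop_vec l p h" by (simp add: prop_vec_def)
qed

text \<open>The renaming has to respect the middle row, to which loops and deletion refer, but may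
  exchange top and bottom; this covers the reflection.\<close>

lemma glue_image:
  assumes f: "inj f" and M: "\<And>v. f v \<in> rM \<longleftrightarrow> v \<in> rM"
    and st: "stacked q q' = (`) f ` stacked p p'"
  shows "glue q q' = (`) f ` glue p p'"
    and "dcomp q q' = (`) f ` dcomp p p'" and "loops q q' = loops p p'"
proof -
  show g: "glue q q' = (`) f ` glue p p'"
    using conn_parts_image[OF f, of "stacked p p'"] unfolding st[symmetric]
    by (simp add: glue_def conn_parts_def)
  have d: "f ` t - rM = f ` (t - rM)" for t using M by auto
  have "(\<lambda>t. t - rM) ` (`) f ` glue p p' = (`) f ` (\<lambda>t. t - rM) ` glue p p'"
    by (simp add: image_image d)
  moreover have "(`) f ` X - {{}} = (`) f ` (X - {{}})" for X by blast
  ultimately show "dcomp q q' = (`) f ` dcomp p p'" unfolding dcomp_def g by simp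
  have "{t \<in> glue q q'. t \<subseteq> rM} = (`) f ` {t \<in> glue p p'. t \<subseteq> rM}" 
  proof -
    have "f ` t \<subseteq> rM \<longleftrightarrow> t \<subseteq> rM" for t using M by blast
    then show ?thesis unfolding g by blast
  qed
  moreover have "inj_on ((`) f) A" for A by (rule inj_onI) (use inj_image_eq_iff[OF f] in blast)
  ultimately show "loops q q' = loops p p'" unfolding loops_def by (simp add: card_image)
qed

lemma stacked_flip: "stacked (flip p') (flip p) = (`) flip_vertex ` stacked p p'"
proof -
  have 1: "bot_to_mid (flip_vertex v) = flip_vertex (top_to_mid v)" for v by (cases v) auto
  have 2: "top_to_mid (flip_vertex v) = flip_vertex (bot_to_mid v)" for v by (cases v) auto
  show ?thesis unfolding stacked_def flip_def by (simp add: image_Un image_image 1 2 Un_commute)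
qed

lemma flip_dcomp: "dcomp (flip p') (flip p) = flip (dcomp p p')"
  unfolding flip_def[of "dcomp p p'"]
  by (rule glue_image(2)[OF inj_flip_vertex flip_vertex_range(1) stacked_flip])

lemma flip_loops: "loops (flip p') (flip p) = loops p p'"
  by (rule glue_image(3)[OF inj_flip_vertex flip_vertex_range(1) stacked_flip])

context tonal_composable
begin

lemma flipped: "tonal_composable l n (flip p') (flip p)"
  using l p p' flip_tonal by unfold_locales

text \<open>Reflection exchanges the factors and preserves propagating vectors.\<close>

lemma prop_vec_le_right: "index_le l (prop_vec l (dcomp p p')) (prop_vec l p')"
  using tonal_composable.prop_vec_le_left[OF flipped] prop_vec_flip[OF p'] prop_vec_flip[OF dcomp_tonal]
  by (simp add: flip_dcomp)

end

text \<open>Renamings of the bottom row. On the lower factor they commute with composition and leave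
  the loops alone. They are to realise the action of the symmetric groups on bottom blocks.\<close>

definition bottom_map :: "(vertex \<Rightarrow> vertex) \<Rightarrow> bool" where
  "bottom_map f \<longleftrightarrow> inj f \<and> (\<forall>v. v \<notin> rB \<longrightarrow> f v = v) \<and> f ` rB \<subseteq> rB"

lemma bottom_map_range: 
  assumes "bottom_map f"
  shows "f v \<in> rM \<longleftrightarrow> v \<in> rM" "f v \<in> rT \<longleftrightarrow> v \<in> rT" "f v \<in> rB \<longleftrightarrow> v \<in> rB"
proof -
  have a: "v \<notin> rB \<Longrightarrow> f v = v" "v \<in> rB \<Longrightarrow> f v \<in> rB" using assms by (auto simp: bottom_map_def)
  show "f v \<in> rM \<longleftrightarrow> v \<in> rM" "f v \<in> rT \<longleftrightarrow> v \<in> rT" "f v \<in> rB \<longleftrightarrow> v \<in> rB"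
    by (cases "v \<in> rB"; use a in auto)+
qed

lemma stacked_bottom_map:
  assumes "bottom_map f"
  shows "stacked p ((`) f ` p') = (`) f ` stacked p p'"
proof -
  have 1: "f (bot_to_mid v) = bot_to_mid v" for v
    using assms by (cases v) (auto simp: bottom_map_def)
  have 2: "top_to_mid (f v) = f (top_to_mid v)" for v
  proof (cases "v \<in> rB")
    case True
    then have "f v \<in> rB" using assms by (auto simp: bottom_map_def)
    then show ?thesis using True by auto
  next
    case False
    then have "f v = v" "f (top_to_mid v) = top_to_mid v" using assms by (cases v; auto simp: bottom_map_def)+
    then show ?thesis by simp
  qed
  show ?thesis unfolding stacked_def by (simp add: image_Un image_image 1 2)
qed

lemma bottom_map_dcomp:
  assumes "bottom_map f"
  shows "dcomp p ((`) f ` p') = (`) f ` dcomp p p'" "loops p ((`) f ` p') = loops p p'"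
proof -
  have f: "inj f" using assms by (simp add: bottom_map_def)
  note * = glue_image[OF f bottom_map_range(1)[OF assms] stacked_bottom_map[OF assms, of p p']]
  show "dcomp p ((`) f ` p') = (`) f ` dcomp p p'" "loops p ((`) f ` p') = loops p p'" by (fact *)+
qed

section \<open>Rigidity when the propagating vector does not drop\<close>

lemma image_minus_eqI:
  assumes "\<And>t. t \<in> A \<Longrightarrow> f t \<noteq> {} \<Longrightarrow> f t \<in> f ` B"
    and "\<And>t. t \<in> B \<Longrightarrow> f t \<noteq> {} \<Longrightarrow> f t \<in> f ` A"
  shows "f ` A - {{}} = f ` B - {{}}"
  using assms by blast

context tonal_composable
begin

text \<open>When no propagating part is lost or fused, each component that reaches the top row meets
  it in a single part of \<open>p\<close>, and a component confined to top and middle row is an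
  isolated part of \<open>p\<close>.\<close>

lemma top_restrict:
  assumes pv: "prop_vec l (dcomp p p') = prop_vec l p"
  shows "(\<lambda>s. s \<inter> rT) ` dcomp p p' - {{}} = (\<lambda>s. s \<inter> rT) ` p - {{}}"
    and "{s \<in> dcomp p p'. s \<subseteq> rT} = {s \<in> p. s \<subseteq> rT}"
proof -
  note card = card_PG_left[OF pv]
  note sub = diagram_sub[OF tonal_diagram[OF p]]
  have key: "g \<inter> Top ` {1..n} = u \<inter> rT" if u: "u \<in> p" "u \<inter> rT \<noteq> {}" "g \<in> G" "bot_to_mid ` u \<subseteq> g" for u g
  proof -
    have "bot_to_mid ` u \<in> upper p" using u(1) by (simp add: upper_def)
    moreover have "meets (bot_to_mid ` u) (Top ` {1..n})" using upper_parts(5)[OF sub[OF u(1)]] u(2) by blast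
    ultimately have "g \<inter> Top ` {1..n} = bot_to_mid ` u \<inter> Top ` {1..n}"
      by (intro PG_restrict[OF l tone_P tone_Q card u(3) _ u(4)])
    then show ?thesis using upper_parts(1)[OF sub[OF u(1)]] by argo
  qed
  have 1: "t \<inter> rT \<in> (\<lambda>s. s \<inter> rT) ` p" if t: "t \<in> dcomp p p'" "t \<inter> rT \<noteq> {}" for t
  proof -
    obtain g where g: "g \<in> G" "t = g - rM" using t(1) by (rule dcompE)
    obtain x where x: "x \<in> g" "x \<in> Top ` {1..n}"
      using t(2) unfolding g(2) G_outer(1)[OF g(1)] by blast
    then obtain s where s: "s \<in> upper p" "x \<in> s" using P_cover[of x] by blast
    then obtain u where u: "u \<in> p" "s = bot_to_mid ` u" by (auto simp: upper_def)
    have "s \<subseteq> g" by (rule P_in[OF s(1) g(1) s(2) x(1)])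
    moreover have "u \<inter> rT \<noteq> {}"
      using upper_parts(1)[OF sub[OF u(1)]] x s unfolding u(2) by blast
    ultimately have "t \<inter> rT = u \<inter> rT"
      using key[OF u(1) _ g(1)] unfolding g(2) G_outer(1)[OF g(1)] u(2) by blast
    then show ?thesis using u(1) by blast
  qed
  have 2: "u \<inter> rT \<in> (\<lambda>s. s \<inter> rT) ` dcomp p p'" if u: "u \<in> p" "u \<inter> rT \<noteq> {}" for u
  proof -
    have "bot_to_mid ` u \<in> upper p" using u(1) by (simp add: upper_def)
    then obtain g where g: "g \<in> G" "bot_to_mid ` u \<subseteq> g" by (rule host)
    have "(g - rM) \<inter> rT = u \<inter> rT" using key[OF u g] G_outer(1)[OF g(1)] by argo
    moreover have "g - rM \<in> dcomp p p'" by (rule dcompI[OF g(1)]) (use calculation u in blast)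
    ultimately show ?thesis by (metis imageI)
  qed
  show "(\<lambda>s. s \<inter> rT) ` dcomp p p' - {{}} = (\<lambda>s. s \<inter> rT) ` p - {{}}"
    by (rule image_minus_eqI[OF 1 2])
  show "{s \<in> dcomp p p'. s \<subseteq> rT} = {s \<in> p. s \<subseteq> rT}"
  proof
    show "{s \<in> dcomp p p'. s \<subseteq> rT} \<subseteq> {s \<in> p. s \<subseteq> rT}"
    proof clarify
      fix t assume t: "t \<in> dcomp p p'" "t \<subseteq> rT"
      obtain g where g: "g \<in> G" "t = g - rM" "t \<noteq> {}" using t(1) by (rule dcompE)
      have "(g - rM) \<inter> rT \<noteq> {}" "(g - rM) \<inter> rB = {}" using t(2) g(2,3) by auto
      then have m: "meets g (Top ` {1..n})" "\<not> meets g (Bot ` {1..n})"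
        unfolding G_outer(1,2)[OF g(1)] meets_def by simp_all
      have gu: "g \<in> upper p" by (rule PG_isolated(1)[OF l tone_P tone_Q card g(1) m])
      have gY: "\<not> meets g (Mid ` {1..n})" by (rule PG_isolated(2)[OF l tone_P tone_Q card g(1) m])
      obtain u where u: "u \<in> p" "g = bot_to_mid ` u" using gu by (auto simp: upper_def)
      have "u \<inter> rB = {}" using gY upper_parts(6)[OF sub[OF u(1)]] unfolding u(2) by blast
      moreover have "u \<subseteq> rT \<union> rB" using sub[OF u(1)] by blast
      ultimately have "u \<subseteq> rT" "g = u" unfolding u(2) using bot_to_mid_image[of u] by auto
      moreover have "u - rM = u" if "u \<subseteq> rT" using that by auto
      ultimately show "t \<in> p" using u(1) g(2) by simp
    qed
    show "{s \<in> p. s \<subseteq> rT} \<subseteq> {s \<in> dcomp p p'. s \<subseteq> rT}"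
    proof clarify
      fix u assume u: "u \<in> p" "u \<subseteq> rT"
      have "u \<inter> rB = {}" using u(2) by auto
      then have e: "bot_to_mid ` u = u" "\<not> meets (bot_to_mid ` u) (Mid ` {1..n})"
        using bot_to_mid_image[of u] upper_parts(6)[OF sub[OF u(1)]] u(2) by (simp_all add: Int_absorb2 le_supI1)
      have "bot_to_mid ` u \<in> upper p" using u(1) by (simp add: upper_def)
      then have "u \<in> G" using X_isolated[OF _ e(2)] unfolding e(1) by blast
      moreover have "u - rM = u" using u(2) by auto
      ultimately show "u \<in> dcomp p p'"
        using dcompI[of u] diagram_ne[OF tonal_diagram[OF p] u(1)] by simp
    qed
  qed
qed

end

lemma Int_rT_flip: "(\<lambda>s. s \<inter> rB) ` q - {{}} = (`) flip_vertex ` ((\<lambda>s. s \<inter> rT) ` flip q - {{}})"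
proof -
  have "s \<inter> rB = flip_vertex ` (flip_vertex ` s \<inter> rT)" for s by (simp add: flip_part_Int)
  then have "(\<lambda>s. s \<inter> rB) ` q = (`) flip_vertex ` (\<lambda>s. s \<inter> rT) ` flip q"
    unfolding flip_def by (simp add: image_image)
  moreover have "(`) flip_vertex ` X - {{}} = (`) flip_vertex ` (X - {{}})" for X by blast
  ultimately show ?thesis by simp
qed

lemma flip_sub: "flip_vertex ` s \<subseteq> rT \<longleftrightarrow> s \<subseteq> rB" "flip_vertex ` s \<subseteq> rB \<longleftrightarrow> s \<subseteq> rT"
  using flip_vertex_range by blast+

lemma sub_rB_flip: "{s \<in> q. s \<subseteq> rB} = (`) flip_vertex ` {s \<in> flip q. s \<subseteq> rT}"
proof -
  have "{s \<in> flip q. s \<subseteq> rT} = (`) flip_vertex ` {s \<in> q. s \<subseteq> rB}"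
    unfolding flip_def using flip_sub by blast
  then show ?thesis by (simp add: image_image)
qed

context tonal_composable
begin

lemma bottom_restrict:
  assumes "prop_vec l (dcomp p p') = prop_vec l p'"
  shows "(\<lambda>s. s \<inter> rB) ` dcomp p p' - {{}} = (\<lambda>s. s \<inter> rB) ` p' - {{}}"
    and "{s \<in> dcomp p p'. s \<subseteq> rB} = {s \<in> p'. s \<subseteq> rB}"
proof -
  interpret S: tonal_composable l n "flip p'" "flip p" by (rule flipped)
  have "prop_vec l (dcomp (flip p') (flip p)) = prop_vec l (flip p')"
    unfolding flip_dcomp prop_vec_flip[OF dcomp_tonal] prop_vec_flip[OF p'] by (rule assms)
  note * = S.top_restrict[OF this, unfolded flip_dcomp]
  show "(\<lambda>s. s \<inter> rB) ` dcomp p p' - {{}} = (\<lambda>s. s \<inter> rB) ` p' - {{}}"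
    unfolding Int_rT_flip *(1) ..
  show "{s \<in> dcomp p p'. s \<subseteq> rB} = {s \<in> p'. s \<subseteq> rB}"
    unfolding sub_rB_flip *(2) ..
qed

lemma loops_F: "loops p p' = card F"
proof -
  have "{t \<in> glue p p'. t \<subseteq> rM} = F" unfolding F_def glue_G using G_outer(4) by blast
  then show ?thesis by (simp add: loops_def)
qed

lemma PY_eq: "PY = (`) bot_to_mid ` {s \<in> p. s \<subseteq> rB}"
proof -
  have "bot_to_mid ` s \<subseteq> Mid ` {1..n} \<longleftrightarrow> s \<subseteq> rB" if "s \<in> p" for s
    using diagram_sub[OF tonal_diagram[OF p] that] by force
  then show ?thesis unfolding PY_def unfolding upper_def by blast
qed

lemma card_PY: "card PY = card {s \<in> p. s \<subseteq> rB}"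
  unfolding PY_eq
  by (rule card_image, rule inj_on_subset[OF inj_image_diagram(1)[OF tonal_diagram[OF p]]]) auto

lemma loops_le_left: "loops p p' \<le> card {s \<in> p. s \<subseteq> rB}"
  unfolding loops_F card_PY[symmetric] by (rule card_F_le)

lemma loops_le_right: "loops p p' \<le> card {s \<in> p'. s \<subseteq> rT}"
proof -
  interpret S: tonal_composable l n "flip p'" "flip p" by (rule flipped)
  have "card {s \<in> flip p'. s \<subseteq> rB} = card ((`) flip_vertex ` {s \<in> p'. s \<subseteq> rT})"
    using sub_rB_flip[of "flip p'"] by simp
  also have "\<dots> \<le> card {s \<in> p'. s \<subseteq> rT}"
    by (rule card_image_le) (use finite_diagram[OF tonal_diagram[OF p']] in simp)
  finally show ?thesis using S.loops_le_left by (simp add: flip_loops)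
qed

lemma card_PG_right:
  assumes "prop_vec l (dcomp p p') = prop_vec l p'"
  shows "card PG = card {s \<in> p'. propagating s}"
  using prop_vec_sum[OF finite_diagram[OF dcomp_diagrams] l]
    prop_vec_sum[OF finite_diagram[OF tonal_diagram[OF p']] l]
    bij_betw_same_card[OF bij_PG] assms by simp

end

lemma flip_top_to_mid: "s \<subseteq> rB \<Longrightarrow> top_to_mid ` flip_vertex ` s = bot_to_mid ` s"
  unfolding image_image by (rule image_cong) auto

lemma top_to_mid_inj: "s \<subseteq> rT \<Longrightarrow> t \<subseteq> rT \<Longrightarrow> top_to_mid ` s = top_to_mid ` t \<Longrightarrow> s = t"
  by (rule iffD1[OF inj_on_image_eq_iff[OF inj_top_to_mid]]) auto

context tonal_composable
begin

text \<open>Both bounds on the number of loops are attained, so the loops are exactly the isolated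
  middle parts of \<open>p\<close> and also those of \<open>p'\<close>. The rest of the middle row
  is matched: each propagating component is formed by one propagating part of \<open>p\<close> and
  one of \<open>p'\<close> with the same middle row.\<close>

lemma extremal_loops:
  assumes pv: "prop_vec l (dcomp p p') = prop_vec l p" "prop_vec l (dcomp p p') = prop_vec l p'"
    and lo: "loops p p' = card {s \<in> p. s \<subseteq> rB}" "loops p p' = card {s \<in> p'. s \<subseteq> rT}"
  shows "(`) flip_vertex ` {s \<in> p. s \<subseteq> rB} = {s \<in> p'. s \<subseteq> rT}"
    and "s \<in> p \<Longrightarrow> propagating s \<Longrightarrow>
      \<exists>t\<in>p'. propagating t \<and> t \<inter> rT = flip_vertex ` (s \<inter> rB) \<and> (s \<inter> rT) \<union> (t \<inter> rB) \<in> dcomp p p'"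
proof -
  \<comment> \<open>The same gluing read from below supplies the statements about
    \<open>p'\<close>.\<close>
  interpret S: two_parts "Bot ` {1..n}" "Mid ` {1..n}" "Top ` {1..n}" "lower p'" "upper p" by (rule swap)
  have SG: "S.G = G" by (simp add: Un_commute)
  have SF: "S.F = F" unfolding S.F_def F_def SG ..
  have SPG: "S.PG = PG" unfolding S.PG_def PG_def SG by blast
  note sub = diagram_sub[OF tonal_diagram[OF p]]
  note sub' = diagram_sub[OF tonal_diagram[OF p']]
  have SPY: "S.PY = (`) top_to_mid ` {s \<in> p'. s \<subseteq> rT}"
  proof -
    have "top_to_mid ` s \<subseteq> Mid ` {1..n} \<longleftrightarrow> s \<subseteq> rT" if "s \<in> p'" for s
      using sub'[OF that] by force
    then show ?thesis unfolding S.PY_def unfolding lower_def by blast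
  qed
  have SPP: "S.PP = (`) top_to_mid ` {s \<in> p'. propagating s}"
  proof -
    have "propagating s \<longleftrightarrow> top_to_mid ` s \<in> S.PP" if "s \<in> p'" for s
      unfolding S.PP_def propagating_def
      using lower_parts(5,6)[OF sub'[OF that]] that by (auto simp: lower_def)
    then have e: "{s \<in> p'. propagating s} = {s \<in> p'. top_to_mid ` s \<in> S.PP}" by blast
    have "S.PP \<subseteq> (`) top_to_mid ` p'" unfolding S.PP_def by (auto simp: lower_def)
    then show ?thesis unfolding e by blast
  qed
  have inj': "inj_on ((`) top_to_mid) A" if "A \<subseteq> p'" for A
    using inj_on_subset[OF inj_image_diagram(2)[OF tonal_diagram[OF p']] that] .
  have Fl: "F = PY" by (rule F_eq) (use lo(1) in \<open>simp only: loops_F card_PY\<close>)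
  have "card S.PY = card {s \<in> p'. s \<subseteq> rT}" unfolding SPY by (rule card_image, rule inj') auto
  then have Fr: "F = S.PY" unfolding SF[symmetric] by (intro S.F_eq) (use lo(2) in \<open>simp only: loops_F SF\<close>)
  have eq: "(`) bot_to_mid ` {s \<in> p. s \<subseteq> rB} = (`) top_to_mid ` {s \<in> p'. s \<subseteq> rT}"
    using Fl Fr unfolding PY_eq SPY by simp
  show "(`) flip_vertex ` {s \<in> p. s \<subseteq> rB} = {s \<in> p'. s \<subseteq> rT}"
  proof -
    have h1: "(`) top_to_mid ` (`) flip_vertex ` {s \<in> p. s \<subseteq> rB} = (`) top_to_mid ` {s \<in> p'. s \<subseteq> rT}"
      unfolding eq[symmetric] using flip_top_to_mid by (simp add: image_image)
    have h2: "inj_on ((`) top_to_mid) (Pow rT)" by (rule inj_onI, rule top_to_mid_inj) auto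
    have h3: "(`) flip_vertex ` {s \<in> p. s \<subseteq> rB} \<subseteq> Pow rT" using flip_sub(1) by blast
    have h4: "{s \<in> p'. s \<subseteq> rT} \<subseteq> Pow rT" by blast
    show ?thesis by (rule iffD1[OF inj_on_image_eq_iff[OF h2 h3 h4] h1])
  qed
  assume s: "s \<in> p" "propagating s"
  note cl = card_PG_left[OF pv(1)]
  have "card S.PP = card {s \<in> p'. propagating s}" unfolding SPP by (rule card_image, rule inj') auto
  then have cr: "card S.PG = card S.PP" using card_PG_right[OF pv(2)] SPG by simp
  have sPP: "bot_to_mid ` s \<in> PP" using bij_PP s unfolding bij_betw_def by blast
  then obtain g where g: "g \<in> G" "bot_to_mid ` s \<subseteq> g" using host[of "bot_to_mid ` s"] unfolding PP_def by blast
  have gPG: "g \<in> PG" by (rule PP_host(1)[OF l tone_P tone_Q cl sPP g])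
  then obtain t' where "t' \<in> S.PP" "t' \<subseteq> g" using S.PG_prop[of g] unfolding SPG by blast
  then obtain t where t: "t \<in> p'" "propagating t" "top_to_mid ` t \<in> S.PP" "top_to_mid ` t \<subseteq> g"
    unfolding SPP by blast
  \<comment> \<open>The middle row of \<open>g\<close> is computed from \<open>s\<close> and from
    \<open>t\<close>; comparing the results matches the two parts.\<close>
  have 1: "g \<inter> Mid ` {1..n} = bot_to_mid ` (s \<inter> rB)"
    unfolding upper_parts(2)[OF sub[OF s(1)], symmetric]
    by (rule PG_middle[OF l tone_P tone_Q cl Fl gPG sPP g(2)])
  have gS: "g \<in> S.PG" using gPG SPG by simp
  have 2: "g \<inter> Mid ` {1..n} = top_to_mid ` (t \<inter> rT)"
    unfolding lower_parts(2)[OF sub'[OF t(1)], symmetric]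
    by (rule S.PG_middle[OF l tone_Q[symmetric] tone_P[symmetric] cr _ gS t(3,4)]) (assumption | rule trans[OF SF Fr])+
  have 3: "g \<inter> Top ` {1..n} = s \<inter> rT"
    using PG_restrict[OF l tone_P tone_Q cl g(1) _ g(2)] sPP upper_parts(1)[OF sub[OF s(1)]]
    unfolding PP_def by blast
  have 4: "g \<inter> Bot ` {1..n} = t \<inter> rB"
    using S.PG_restrict[OF l tone_Q[symmetric] tone_P[symmetric] cr _ _ t(4)] g(1) t(3)
      lower_parts(1)[OF sub'[OF t(1)]]
    unfolding SG S.PP_def by blast
  have "top_to_mid ` (t \<inter> rT) = top_to_mid ` flip_vertex ` (s \<inter> rB)"
    using 1 2 flip_top_to_mid[of "s \<inter> rB"] by simp
  then have "t \<inter> rT = flip_vertex ` (s \<inter> rB)"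
    by (rule top_to_mid_inj[rotated 2]) (use flip_sub(1) in blast)+
  moreover have "(s \<inter> rT) \<union> (t \<inter> rB) \<in> dcomp p p'"
    using dcompI[OF g(1)] G_outer(3)[OF g(1)] s(2) unfolding 3 4 propagating_def by auto
  ultimately show "\<exists>t\<in>p'. propagating t \<and> t \<inter> rT = flip_vertex ` (s \<inter> rB) \<and> (s \<inter> rT) \<union> (t \<inter> rB) \<in> dcomp p p'"
    using t by blast
qed

end

section \<open>The diagrams \<open>a\<^sup>m\<close>\<close>

lemma shift_shift: "shift a a (shift b b v) = shift (a + b) (a + b) v"
  by (cases v) auto

lemma shift_0 [simp]: "shift 0 0 v = v"
  by (cases v) auto

lemma shift_image_image: "(`) (shift a a) ` (`) (shift b b) ` p = (`) (shift (a + b) (a + b)) ` p"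
  by (simp add: image_image shift_shift)

lemma inj_shift: "inj (shift a a)"
proof (rule injI)
  fix v w assume "shift a a v = shift a a w"
  then show "v = w" by (cases v; cases w) auto
qed

lemma shift_range: "shift a a v \<in> rT \<longleftrightarrow> v \<in> rT" "shift a a v \<in> rB \<longleftrightarrow> v \<in> rB"
  by (cases v; auto)+

lemma shift_Top: "shift a a ` Top ` A = Top ` (+) a ` A" "shift a a ` Bot ` A = Bot ` (+) a ` A"
  by (simp_all add: image_image)

lemma juxt_list_append:
  "juxt_list (ps @ qs) = juxt_list ps
     \<union> (`) (shift (sum_list (map fst ps)) (sum_list (map fst ps))) ` juxt_list qs"
proof (induction ps)
  case (Cons x ps)
  obtain d p where x: "x = (d, p)" by (cases x)
  show ?case unfolding x using Cons by (simp add: juxt_def image_Un shift_image_image Un_assoc)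
qed simp

lemma juxt_list_replicate:
  "juxt_list (replicate k (d, p)) = (\<Union>j<k. (`) (shift (j * d) (j * d)) ` p)"
proof (induction k)
  case (Suc k)
  have "juxt_list (replicate (Suc k) (d, p)) = p \<union> (\<Union>j<k. (`) (shift (Suc j * d) (Suc j * d)) ` p)"
    using Suc by (simp add: juxt_def image_UN shift_image_image)
  also have "\<dots> = (\<Union>j<Suc k. (`) (shift (j * d) (j * d)) ` p)"
    unfolding lessThan_Suc_eq_insert_0 by (simp add: image_image)
  finally show ?case .
qed simp

lemma juxt_diagrams:
  assumes p: "p \<in> diagrams d d" and q: "q \<in> diagrams e e"
  shows "juxt d d p q \<in> diagrams (d + e) (d + e)"
proof -
  have 1: "partition_on (Top ` {1..d} \<union> Bot ` {1..d}) p" using p by (simp add: diagrams_def)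
  have 2: "partition_on (shift d d ` (Top ` {1..e} \<union> Bot ` {1..e})) ((`) (shift d d) ` q)"
    by (rule partition_on_image) (use q inj_shift in \<open>auto simp: diagrams_def intro: inj_on_subset\<close>)
  have e: "shift d d ` (Top ` {1..e} \<union> Bot ` {1..e}) = Top ` {d + 1..d + e} \<union> Bot ` {d + 1..d + e}"
    unfolding image_Un shift_Top by (simp add: add.commute)
  have iv: "{1..d} \<union> {d + 1..d + e} = {1..d + e}" by auto
  have "partition_on ((Top ` {1..d} \<union> Bot ` {1..d}) \<union> (Top ` {d + 1..d + e} \<union> Bot ` {d + 1..d + e}))
     (p \<union> (`) (shift d d) ` q)"
  proof (rule partition_onI)
    note 2 = 2[unfolded e]
    show "\<Union>(p \<union> (`) (shift d d) ` q)
        = (Top ` {1..d} \<union> Bot ` {1..d}) \<union> (Top ` {d + 1..d + e} \<union> Bot ` {d + 1..d + e})"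
      using 1 2 unfolding partition_on_def Union_Un_distrib by metis
    show "{} \<notin> p \<union> (`) (shift d d) ` q" using 1 2 unfolding partition_on_def by blast
    have U: "\<Union>p \<inter> \<Union>((`) (shift d d) ` q) = {}"
    proof -
      have "\<Union>p = Top ` {1..d} \<union> Bot ` {1..d}"
        "\<Union>((`) (shift d d) ` q) = Top ` {d + 1..d + e} \<union> Bot ` {d + 1..d + e}"
        using 1 2 unfolding partition_on_def by argo+
      then show ?thesis by auto
    qed
    have "disjoint (p \<union> (`) (shift d d) ` q)"
      by (rule disjoint_union[OF _ _ U]) (use 1 2 in \<open>simp_all add: partition_on_def\<close>)
    then show "\<And>s t. s \<in> p \<union> (`) (shift d d) ` q \<Longrightarrow> t \<in> p \<union> (`) (shift d d) ` q \<Longrightarrow> s \<noteq> t \<Longrightarrow> disjnt s t"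
      unfolding disjnt_def by (rule pairwiseD)
  qed
  moreover have "(Top ` {1..d} \<union> Bot ` {1..d}) \<union> (Top ` {d + 1..d + e} \<union> Bot ` {d + 1..d + e})
      = Top ` {1..d + e} \<union> Bot ` {1..d + e}"
    unfolding iv[symmetric] by auto
  ultimately show ?thesis by (simp add: diagrams_def juxt_def)
qed

lemma shift_part_Int: "shift d d ` s \<inter> rT = shift d d ` (s \<inter> rT)" "shift d d ` s \<inter> rB = shift d d ` (s \<inter> rB)"
  using shift_range by blast+

lemma ntop_shift: "ntop (shift d d ` s) = ntop s" "nbot (shift d d ` s) = nbot s"
  unfolding ntop_def nbot_def shift_part_Int
  by (rule card_image, rule inj_on_subset[OF inj_shift], simp)+

lemma juxt_tonal:
  assumes "p \<in> tonal l d" "q \<in> tonal l e"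
  shows "juxt d d p q \<in> tonal l (d + e)"
  using assms juxt_diagrams[of p d q e] unfolding tonal_def by (auto simp: juxt_def ntop_shift)

lemma juxt_list_tonal:
  assumes "\<And>d p. (d, p) \<in> set ps \<Longrightarrow> p \<in> tonal l d"
  shows "juxt_list ps \<in> tonal l (sum_list (map fst ps))"
  using assms
proof (induction ps)
  case Nil
  then show ?case by (simp add: tonal_def diagrams_def partition_on_def)
next
  case (Cons x ps)
  obtain d p where x: "x = (d, p)" by (cases x)
  have "juxt_list ps \<in> tonal l (sum_list (map fst ps))" by (rule Cons.IH) (use Cons.prems in auto)
  then show ?case unfolding x using juxt_tonal[of p l d] Cons.prems[of d p] x by simp
qed

lemma flip_juxt_list:
  assumes "\<And>d p. (d, p) \<in> set ps \<Longrightarrow> flip p = p"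
  shows "flip (juxt_list ps) = juxt_list ps"
  using assms
proof (induction ps)
  case (Cons x ps)
  obtain d p where x: "x = (d, p)" by (cases x)
  have c: "flip_vertex (shift d d v) = shift d d (flip_vertex v)" for v by (cases v) auto
  have "flip (juxt_list ps) = juxt_list ps" by (rule Cons.IH) (use Cons.prems in auto)
  moreover have "flip p = p" by (rule Cons.prems[of d]) (simp add: x)
  moreover have "flip (juxt d d p q) = juxt d d (flip p) (flip q)" for q
    unfolding juxt_def flip_def by (simp add: image_Un image_image c)
  ultimately show ?case unfolding x by simp
qed (simp add: flip_def)

lemma b_tonal: "i \<ge> 1 \<Longrightarrow> b_diagram i \<in> tonal l i"
proof -
  assume i: "i \<ge> 1"
  have "(Top ` {1..i} \<union> Bot ` {1..i}) \<inter> rT = Top ` {1..i}" "(Top ` {1..i} \<union> Bot ` {1..i}) \<inter> rB = Bot ` {1..i}"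
    by auto
  then have "ntop (Top ` {1..i} \<union> Bot ` {1..i}) = i" "nbot (Top ` {1..i} \<union> Bot ` {1..i}) = i"
    unfolding ntop_def nbot_def by (simp_all add: card_image inj_on_def)
  then show ?thesis using i by (simp add: tonal_def diagrams_def b_diagram_def partition_on_def disjoint_def)
qed

lemma flip_b: "flip (b_diagram i) = b_diagram i"
  by (simp add: flip_def b_diagram_def image_Un image_image Un_commute)

text \<open>The middle row is empty, so gluing joins nothing.\<close>

lemma ww_star:
  assumes "l \<ge> 1"
  shows "dcomp (w_diagram l) (w_star l) = {Top ` {1..l}, Bot ` {1..l}}"
proof -
  have d: "w_diagram l \<in> diagrams l 0" "w_star l \<in> diagrams 0 l"
    using assms by (simp_all add: diagrams_def w_diagram_def w_star_def partition_on_def disjoint_def)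
  interpret composable l 0 l "w_diagram l" "w_star l" using d by unfold_locales
  have st: "upper (w_diagram l) \<union> lower (w_star l) = {Top ` {1..l}, Bot ` {1..l}}"
  proof -
    have "upper (w_diagram l) = {Top ` {1..l}}" "lower (w_star l) = {Bot ` {1..l}}"
      unfolding upper_def lower_def w_diagram_def w_star_def by (simp_all add: image_image)
    then show ?thesis by blast
  qed
  have "conn_parts {Top ` {1..l}, Bot ` {1..l}} = {Top ` {1..l}, Bot ` {1..l}}"
  proof (rule conn_eqI)
    have "Top ` {1..l} \<in> conn_parts {Top ` {1..l}, Bot ` {1..l}}"
      by (rule conn_isolated) (use assms in auto)
    moreover have "Bot ` {1..l} \<in> conn_parts {Top ` {1..l}, Bot ` {1..l}}"
      by (rule conn_isolated) (use assms in auto)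
    ultimately show "{Top ` {1..l}, Bot ` {1..l}} \<subseteq> conn_parts {Top ` {1..l}, Bot ` {1..l}}" by blast
  qed simp
  then have "glue (w_diagram l) (w_star l) = {Top ` {1..l}, Bot ` {1..l}}"
    unfolding glue_G st .
  moreover have "Top ` {1..l} - rM = Top ` {1..l}" "Bot ` {1..l} - rM = Bot ` {1..l}" by auto
  ultimately show ?thesis using assms unfolding dcomp_def by auto
qed

lemma ww_tonal:
  assumes "l \<ge> 1"
  shows "dcomp (w_diagram l) (w_star l) \<in> tonal l l"
proof -
  have "Top ` {1..l} \<inter> rT = Top ` {1..l}" "Top ` {1..l} \<inter> rB = {}"
    "Bot ` {1..l} \<inter> rB = Bot ` {1..l}" "Bot ` {1..l} \<inter> rT = {}" by auto
  then have "ntop (Top ` {1..l}) = l" "nbot (Top ` {1..l}) = 0" "nbot (Bot ` {1..l}) = l" "ntop (Bot ` {1..l}) = 0"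
    unfolding ntop_def nbot_def by (simp_all add: card_image inj_on_def)
  then show ?thesis unfolding ww_star[OF assms] using assms
    by (auto simp: tonal_def diagrams_def partition_on_def disjoint_def)
qed

lemma flip_ww:
  assumes "l \<ge> 1"
  shows "flip (dcomp (w_diagram l) (w_star l)) = dcomp (w_diagram l) (w_star l)"
proof -
  have "flip {Top ` {1..l}, Bot ` {1..l}} = {Bot ` {1..l}, Top ` {1..l}}"
    unfolding flip_def by (simp add: image_image)
  also have "\<dots> = {Top ` {1..l}, Bot ` {1..l}}" by (rule insert_commute)
  finally show ?thesis unfolding ww_star[OF assms] .
qed

section \<open>Coordinates for the propagating parts of a^m\<close>

definition blk :: "nat \<Rightarrow> (nat \<Rightarrow> nat) \<Rightarrow> nat \<times> nat \<Rightarrow> nat set" where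
  "blk l m = (\<lambda>(i, j). {(\<Sum>i'\<in>{i<..l}. i' * m i') + (j - 1) * i + 1..(\<Sum>i'\<in>{i<..l}. i' * m i') + (j - 1) * i + i})"

text \<open>Pairs (size, position from the left): the names of the propagating parts of
  \<open>a_diagram\<close>, each of which is a \<open>strand\<close>.\<close>

definition slots :: "nat \<Rightarrow> (nat \<Rightarrow> nat) \<Rightarrow> (nat \<times> nat) set" where
  "slots l m = (SIGMA i : {1..l}. {1..m i})"

definition strand :: "nat \<Rightarrow> (nat \<Rightarrow> nat) \<Rightarrow> nat \<times> nat \<Rightarrow> vertex set" where
  "strand l m c = Top ` blk l m c \<union> Bot ` blk l m c"

lemma bottom_block_blk: "bottom_block l m i j = Bot ` blk l m (i, j)"
  by (simp add: bottom_block_def blk_def Let_def)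

lemma card_blk: "card (blk l m c) = fst c"
  by (cases c) (simp add: blk_def)

text \<open>The lower bound \<open>a\<close> is a parameter for the sake of induction: sizes come in
  decreasing order, so lowering \<open>a\<close> appends blocks at the right end.\<close>

definition prop_list :: "nat \<Rightarrow> (nat \<Rightarrow> nat) \<Rightarrow> nat \<Rightarrow> (nat \<times> diagram) list" where
  "prop_list l m a = concat (map (\<lambda>i. replicate (m i) (i, b_diagram i)) (rev [a..<Suc l]))"

lemma prop_list_Suc: "a \<le> l \<Longrightarrow> prop_list l m a = prop_list l m (Suc a) @ replicate (m a) (a, b_diagram a)"
  unfolding prop_list_def by (subst upt_conv_Cons) auto

lemma sum_prop_list: "sum_list (map fst (prop_list l m a)) = (\<Sum>i\<in>{a..l}. i * m i)"
proof (induction "Suc l - a" arbitrary: a)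
  case 0
  then show ?case by (simp add: prop_list_def)
next
  case (Suc k)
  then have a: "a \<le> l" "k = Suc l - Suc a" by auto
  have "{a..l} = insert a {Suc a..l}" using a by auto
  then show ?case unfolding prop_list_Suc[OF a(1)]
    using Suc(1)[OF a(2)] by (simp add: sum_list_replicate)
qed

lemma juxt_prop_list: "juxt_list (prop_list l m a) = strand l m ` (SIGMA i : {a..l}. {1..m i})"
proof (induction "Suc l - a" arbitrary: a)
  case 0
  then show ?case by (simp add: prop_list_def)
next
  case (Suc k)
  then have a: "a \<le> l" "k = Suc l - Suc a" by auto
  \<comment> \<open>The larger blocks stand further left; \<open>?D\<close> is the width they
    occupy.\<close>
  let ?D = "\<Sum>i\<in>{Suc a..l}. i * m i"
  have "(`) (shift ?D ?D) ` juxt_list (replicate (m a) (a, b_diagram a))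
      = (\<Union>j<m a. {strand l m (a, Suc j)})"
  proof -
    have "(`) (shift ?D ?D) ` (`) (shift (j * a) (j * a)) ` b_diagram a = {strand l m (a, Suc j)}" for j
    proof -
      have "(`) (shift ?D ?D) ` (`) (shift (j * a) (j * a)) ` b_diagram a
        = {Top ` (+) (?D + j * a) ` {1..a} \<union> Bot ` (+) (?D + j * a) ` {1..a}}"
        unfolding shift_image_image b_diagram_def by (simp add: image_Un shift_Top del: image_add_atLeastAtMost)
      moreover have "{a<..l} = {Suc a..l}" by auto
      then have "(+) (?D + j * a) ` {1..a} = blk l m (a, Suc j)" by (simp add: blk_def)
      ultimately show ?thesis by (simp add: strand_def)
    qed
    then show ?thesis unfolding juxt_list_replicate image_UN by simp
  qed
  also have "\<dots> = strand l m ` ({a} \<times> {1..m a})"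
  proof -
    have "{1..m a} = Suc ` {..<m a}" by (simp add: lessThan_atLeast0 image_Suc_atLeastLessThan atLeastLessThanSuc_atLeastAtMost)
    then show ?thesis by auto
  qed
  finally have 1: "(`) (shift ?D ?D) ` juxt_list (replicate (m a) (a, b_diagram a)) = strand l m ` ({a} \<times> {1..m a})" .
  have "(SIGMA i : {a..l}. {1..m i}) = (SIGMA i : {Suc a..l}. {1..m i}) \<union> {a} \<times> {1..m a}"
    using a(1) by (auto simp: Suc_le_eq le_less)
  then show ?case
    unfolding prop_list_Suc[OF a(1)] juxt_list_append sum_prop_list 1 Suc(1)[OF a(2)] by (simp add: image_Un)
qed

lemma a_diagram_prop_list:
  "a_diagram l n m = juxt_list (prop_list l m 1
    @ replicate ((n - rank_sum l m) div l) (l, dcomp (w_diagram l) (w_star l)))"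
  by (simp add: a_diagram_def prop_list_def)

lemma set_prop_list: "(d, p) \<in> set (prop_list l m 1) \<Longrightarrow> d \<ge> 1 \<and> p = b_diagram d"
  by (auto simp: prop_list_def in_set_replicate)

locale cell =
  fixes l n :: nat and m :: "nat \<Rightarrow> nat"
  assumes l: "l \<ge> 1" and m: "m \<in> index_set l n"
begin

abbreviation "a \<equiv> a_diagram l n m"
abbreviation "B \<equiv> blk l m"
abbreviation "I \<equiv> slots l m"

lemma a_tonal: "a \<in> tonal l n"
proof -
  let ?ps = "prop_list l m 1 @ replicate ((n - rank_sum l m) div l) (l, dcomp (w_diagram l) (w_star l))"
  have "juxt_list ?ps \<in> tonal l (sum_list (map fst ?ps))"
  proof (rule juxt_list_tonal)
    fix d p assume "(d, p) \<in> set ?ps"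
    then consider "(d, p) \<in> set (prop_list l m 1)" | "(d, p) = (l, dcomp (w_diagram l) (w_star l))"
      by (auto simp: in_set_replicate)
    then show "p \<in> tonal l d"
    proof cases
      case 1 then show ?thesis using set_prop_list[OF 1] b_tonal by blast
    next
      case 2 then show ?thesis using ww_tonal[OF l] by simp
    qed
  qed
  moreover have "sum_list (map fst ?ps) = n"
  proof -
    have "rank_sum l m \<le> n" "l dvd n - rank_sum l m" using m by (auto simp: index_set_def)
    moreover have "sum_list (map fst ?ps) = rank_sum l m + (n - rank_sum l m) div l * l"
      using sum_prop_list[of l m 1] by (simp add: sum_list_replicate rank_sum_def)
    ultimately show ?thesis by simp
  qed
  ultimately show ?thesis by (simp add: a_diagram_prop_list)
qed

lemma flip_a: "flip a = a"
  unfolding a_diagram_prop_list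
proof (rule flip_juxt_list)
  fix d p assume "(d, p) \<in> set (prop_list l m 1 @ replicate ((n - rank_sum l m) div l) (l, dcomp (w_diagram l) (w_star l)))"
  then consider "(d, p) \<in> set (prop_list l m 1)" | "(d, p) = (l, dcomp (w_diagram l) (w_star l))"
    by (auto simp: in_set_replicate)
  then show "flip p = p"
  proof cases
    case 1 then show ?thesis using set_prop_list[OF 1] flip_b by blast
  next
    case 2 then show ?thesis using flip_ww[OF l] by simp
  qed
qed

lemma strand_a: "c \<in> I \<Longrightarrow> strand l m c \<in> a"
  unfolding a_diagram_prop_list juxt_list_append juxt_prop_list slots_def by blast

lemma a_cases:
  assumes "s \<in> a"
  shows "(\<exists>c\<in>I. s = strand l m c) \<or> s \<subseteq> rT \<or> s \<subseteq> rB"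
proof (cases "s \<in> strand l m ` I")
  case False
  then obtain D t where s: "s = shift D D ` t" "t \<in> juxt_list (replicate ((n - rank_sum l m) div l) (l, dcomp (w_diagram l) (w_star l)))"
    using assms unfolding a_diagram_prop_list juxt_list_append juxt_prop_list slots_def by blast
  then obtain E u where t: "t = shift E E ` u" "u \<in> {Top ` {1..l}, Bot ` {1..l}}"
    unfolding juxt_list_replicate ww_star[OF l] by blast
  have sub: "shift A A ` v \<subseteq> rT" if "v \<subseteq> rT" for A v
    by (rule image_subsetI) (use that shift_range(1)[of A] in blast)
  have sub': "shift A A ` v \<subseteq> rB" if "v \<subseteq> rB" for A v
    by (rule image_subsetI) (use that shift_range(2)[of A] in blast)
  have "u \<subseteq> rT \<or> u \<subseteq> rB" using t(2) by auto
  then show ?thesis unfolding s(1) t(1) using sub sub' by meson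
qed blast

lemma strand_Int: "strand l m c \<inter> rT = Top ` B c" "strand l m c \<inter> rB = Bot ` B c"
  by (auto simp: strand_def)

lemma slots_I: "c \<in> I \<Longrightarrow> fst c \<in> {1..l}" "c \<in> I \<Longrightarrow> snd c \<in> {1..m (fst c)}"
  by (auto simp: slots_def)

lemma finite_I: "finite I" by (simp add: slots_def)

lemma B_ne: "c \<in> I \<Longrightarrow> B c \<noteq> {}"
  using slots_I(1)[of c] by (cases c) (auto simp: blk_def)

lemma B_inj: "c \<in> I \<Longrightarrow> c' \<in> I \<Longrightarrow> B c = B c' \<Longrightarrow> c = c'"
proof -
  assume c: "c \<in> I" "c' \<in> I" and e: "B c = B c'"
  have 1: "fst c = fst c'" using e card_blk by metis
  obtain i j where ij: "c = (i, j)" by (cases c)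
  obtain j' where j': "c' = (i, j')" using 1 ij by (cases c') auto
  have i: "i \<ge> 1" "j \<ge> 1" "j' \<ge> 1" using slots_I[OF c(1)] slots_I[OF c(2)] ij j' by auto
  then have "(j - 1) * i = (j' - 1) * i" using e unfolding ij j' blk_def by (simp add: Icc_eq_Icc)
  then have "j - 1 = j' - 1" using i(1) by simp
  then show "c = c'" using ij j' i by simp
qed

lemma strand_propagating: "c \<in> I \<Longrightarrow> propagating (strand l m c)"
  using B_ne by (auto simp: propagating_def strand_Int)

text \<open>Inherited from the disjointness of the parts of \<open>a\<close>: blocks sharing a
  vertex belong to the same strand.\<close>

lemma B_disj: "c \<in> I \<Longrightarrow> c' \<in> I \<Longrightarrow> x \<in> B c \<Longrightarrow> x \<in> B c' \<Longrightarrow> c = c'"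
proof -
  assume c: "c \<in> I" "c' \<in> I" "x \<in> B c" "x \<in> B c'"
  have "strand l m c = strand l m c'"
  proof (rule diagram_disj[OF tonal_diagram[OF a_tonal] strand_a[OF c(1)] strand_a[OF c(2)]])
    show "Top x \<in> strand l m c" "Top x \<in> strand l m c'" using c(3,4) by (auto simp: strand_def)
  qed
  then have "Top ` B c = Top ` B c'" using strand_Int(1) by metis
  then have "B c = B c'" by (rule iffD1[OF inj_image_eq_iff, rotated]) (simp add: inj_def)
  then show ?thesis using B_inj c by blast
qed

lemma B_sub: "c \<in> I \<Longrightarrow> B c \<subseteq> {1..n}"
  using diagram_sub[OF tonal_diagram[OF a_tonal] strand_a[of c]] by (auto simp: strand_def)

lemma prop_a: "{s \<in> a. propagating s} = strand l m ` I"
proof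
  show "{s \<in> a. propagating s} \<subseteq> strand l m ` I"
    using a_cases by (auto simp: propagating_def)
  show "strand l m ` I \<subseteq> {s \<in> a. propagating s}" using strand_a strand_propagating by blast
qed

lemma inj_strand: "inj_on (strand l m) I"
proof (rule inj_onI)
  fix c c' assume c: "c \<in> I" "c' \<in> I" "strand l m c = strand l m c'"
  obtain x where x: "x \<in> B c" using B_ne[OF c(1)] by blast
  then have "Top x \<in> strand l m c'" using c(3) by (auto simp: strand_def)
  then have "x \<in> B c'" by (auto simp: strand_def)
  then show "c = c'" using B_disj[OF c(1,2) x] by blast
qed

lemma ntop_strand: "ntop (strand l m c) = fst c" "nbot (strand l m c) = fst c"
  unfolding ntop_def nbot_def strand_Int by (simp_all add: card_image inj_on_def card_blk)

lemma mod_range_eq: "i \<in> {1..l} \<Longrightarrow> h \<in> {1..l} \<Longrightarrow> i mod l = h mod l \<Longrightarrow> i = h"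
  using rep_unique[of i l h] rep_unique[of h l h] by simp

text \<open>Block sizes lie in \<open>{1..l}\<close>, where residues determine them, so the
  propagating parts of residue \<open>h\<close> are the \<open>m h\<close> blocks of size
  \<open>h\<close>.\<close>

lemma prop_vec_a: "prop_vec l a = m"
proof
  fix h
  show "prop_vec l a h = m h"
  proof (cases "h \<in> {1..l}")
    case True
    have "{s \<in> a. propagating s \<and> ntop s mod l = h mod l} = {s \<in> strand l m ` I. ntop s mod l = h mod l}"
      unfolding prop_a[symmetric] by blast
    also have "\<dots> = strand l m ` {c \<in> I. fst c mod l = h mod l}" using ntop_strand by auto
    also have "{c \<in> I. fst c mod l = h mod l} = {h} \<times> {1..m h}"
    proof -
      have "fst c mod l = h mod l \<longleftrightarrow> fst c = h" if "c \<in> I" for c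
        using mod_range_eq[OF slots_I(1)[OF that] True] by blast
      then have "{c \<in> I. fst c mod l = h mod l} = {c \<in> I. fst c = h}" by blast
      also have "\<dots> = {h} \<times> {1..m h}" using True by (auto simp: slots_def)
      finally show ?thesis .
    qed
    finally have "card {s \<in> a. propagating s \<and> ntop s mod l = h mod l} = card (strand l m ` ({h} \<times> {1..m h}))"
      by simp
    also have "\<dots> = card ({h} \<times> {1..m h})"
      by (rule card_image, rule inj_on_subset[OF inj_strand]) (use True in \<open>auto simp: slots_def\<close>)
    finally have "card {s \<in> a. propagating s \<and> ntop s mod l = h mod l} = m h" by simp
    then show ?thesis using True by (simp add: prop_vec_def)
  next
    case False
    then have "prop_vec l a h = 0" unfolding prop_vec_def by argo
    moreover have "m h = 0" using m False unfolding index_set_def by blast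
    ultimately show ?thesis by simp
  qed
qed


section \<open>The diagrams that span the left ideal of a^m\<close>

abbreviation "C \<equiv> cell_diagrams l n m"

lemma C_tonal: "p \<in> C \<Longrightarrow> p \<in> tonal l n" by (simp add: cell_diagrams_def)
lemma C_diagram: "p \<in> C \<Longrightarrow> p \<in> diagrams n n" by (simp add: cell_diagrams_def tonal_def)
lemma C_prop_vec: "p \<in> C \<Longrightarrow> prop_vec l p = m" by (simp add: cell_diagrams_def)
lemma C_bottom: "p \<in> C \<Longrightarrow> (\<lambda>s. s \<inter> rB) ` p - {{}} = (\<lambda>s. s \<inter> rB) ` a - {{}}"
  by (simp add: cell_diagrams_def)
lemma C_isolated: "p \<in> C \<Longrightarrow> {s \<in> p. s \<subseteq> rB} = {s \<in> a. s \<subseteq> rB}"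
  by (simp add: cell_diagrams_def)

lemma finite_C: "finite C"
  by (rule finite_subset[OF _ finite_diagrams[of n n]]) (use C_diagram in blast)

lemma a_C: "a \<in> C"
  using a_tonal prop_vec_a by (simp add: cell_diagrams_def)

text \<open>The restriction to the bottom row alone would allow a propagating part to sit on an
  isolated bottom part of \<open>a\<close>. The condition on isolated bottom parts excludes this,
  since such a set is already a whole part of \<open>p\<close>.\<close>

lemma C_slot:
  assumes p: "p \<in> C" and s: "s \<in> p" "propagating s"
  shows "\<exists>c\<in>I. s \<inter> rB = Bot ` B c"
proof -
  have "s \<inter> rB \<in> (\<lambda>s. s \<inter> rB) ` p - {{}}" using s by (auto simp: propagating_def)
  then obtain t where t: "t \<in> a" "s \<inter> rB = t \<inter> rB" unfolding C_bottom[OF p] by blast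
  have "s \<inter> rB \<noteq> {}" using s by (simp add: propagating_def)
  then have "\<not> t \<subseteq> rT" using t(2) by auto
  moreover have "\<not> t \<subseteq> rB"
  proof
    assume tB: "t \<subseteq> rB"
    then have "t \<in> p" using C_isolated[OF p] t(1) by blast
    moreover obtain x where "x \<in> s \<inter> rB" using \<open>s \<inter> rB \<noteq> {}\<close> by blast
    ultimately have "s = t" using diagram_disj[OF C_diagram[OF p] s(1), of t x] t(2) by blast
    then show False using tB s(2) by (auto simp: propagating_def)
  qed
  ultimately obtain c where "c \<in> I" "t = strand l m c" using a_cases[OF t(1)] by blast
  then show ?thesis using t(2) strand_Int by auto
qed

text \<open>A part with this bottom row and no top vertex would be a part of \<open>a\<close> and
  hence equal to a strand, which propagates.\<close>

lemma C_part:
  assumes p: "p \<in> C" and c: "c \<in> I"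
  shows "\<exists>s\<in>p. propagating s \<and> s \<inter> rB = Bot ` B c"
proof -
  have ne: "Bot ` B c \<noteq> {}" using B_ne[OF c] by simp
  have "Bot ` B c \<in> (\<lambda>s. s \<inter> rB) ` a" using strand_a[OF c] strand_Int(2)[of c] by (metis imageI)
  then have "Bot ` B c \<in> (\<lambda>s. s \<inter> rB) ` p - {{}}" unfolding C_bottom[OF p] using ne by blast
  then obtain s where s: "s \<in> p" "s \<inter> rB = Bot ` B c" by blast
  have "\<not> s \<subseteq> rB"
  proof
    assume sB: "s \<subseteq> rB"
    then have sa: "s \<in> a" using C_isolated[OF p] s(1) by blast
    obtain x where x: "x \<in> s" using s(2) ne by blast
    then have "x \<in> strand l m c" using sB s(2) by (auto simp: strand_def)
    then have "s = strand l m c"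
      using diagram_disj[OF tonal_diagram[OF a_tonal] sa strand_a[OF c] x] by blast
    then show False using sB strand_propagating[OF c] by (auto simp: propagating_def)
  qed
  moreover have "s \<subseteq> rT \<union> rB" using diagram_sub[OF C_diagram[OF p] s(1)] by auto
  ultimately have "s \<inter> rT \<noteq> {}" by blast
  then show ?thesis using s ne unfolding propagating_def by auto
qed

lemma dcomp_C:
  assumes r: "r \<in> tonal l n" and q: "q \<in> C" and pv: "prop_vec l (dcomp r q) = m"
  shows "dcomp r q \<in> C"
proof -
  interpret tonal_composable l n r q using l r C_tonal[OF q] by unfold_locales
  have e: "prop_vec l (dcomp r q) = prop_vec l q" using pv C_prop_vec[OF q] by simp
  show ?thesis using bottom_restrict[OF e] dcomp_tonal pv C_bottom[OF q] C_isolated[OF q]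
    by (simp add: cell_diagrams_def)
qed

text \<open>If the propagating vector does not drop, the bottom row of \<open>q\<close> survives. So
  the span of \<open>C\<close> is stable under left multiplication modulo lower terms.\<close>

lemma dcomp_C_cases:
  assumes r: "r \<in> tonal l n" and q: "q \<in> C"
  shows "dcomp r q \<in> C \<or> index_less l (prop_vec l (dcomp r q)) m"
proof -
  interpret tonal_composable l n r q using l r C_tonal[OF q] by unfold_locales
  have "index_le l (prop_vec l (dcomp r q)) m" using prop_vec_le_right C_prop_vec[OF q] by simp
  then show ?thesis using dcomp_C[OF r q] by (auto simp: index_less_def)
qed


section \<open>The action of the symmetric groups\<close>

text \<open>A lift carries the block named by \<open>\<sigma> i j\<close> to the block named by
  \<open>j\<close> and fixes all vertices outside the bottom blocks. It presents
  \<open>diagram_act\<close> as the image under a vertex map, to which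
  \<open>bottom_map_dcomp\<close> applies. How vertices are matched inside a block is left open,
  since diagrams in \<open>C\<close> never split a block.\<close>

definition lift :: "perms \<Rightarrow> (vertex \<Rightarrow> vertex) \<Rightarrow> bool" where
  "lift \<sigma> f \<longleftrightarrow> bottom_map f \<and> (\<forall>(i, j)\<in>I. f ` Bot ` B (i, \<sigma> i j) = Bot ` B (i, j)) \<and>
     (\<forall>v. v \<notin> Bot ` (\<Union>c\<in>I. B c) \<longrightarrow> f v = v)"

abbreviation "S \<equiv> sym_prod l m"

lemma S_slot: "\<sigma> \<in> S \<Longrightarrow> (i, j) \<in> I \<Longrightarrow> (i, \<sigma> i j) \<in> I"
  using permutes_in_image[of "\<sigma> i" "{1..m i}" j] by (auto simp: sym_prod_def slots_def)

lemma S_surj: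
  assumes "\<sigma> \<in> S" "(i, j) \<in> I"
  obtains j' where "(i, j') \<in> I" "j = \<sigma> i j'"
proof -
  have ij: "i \<in> {1..l}" "j \<in> {1..m i}" using assms(2) by (auto simp: slots_def)
  then have "\<sigma> i permutes {1..m i}" using assms(1) by (auto simp: sym_prod_def)
  then have "\<sigma> i ` {1..m i} = {1..m i}" by (rule permutes_image)
  then obtain j' where "j' \<in> {1..m i}" "j = \<sigma> i j'" using ij by blast
  then show ?thesis using that ij by (auto simp: slots_def)
qed

lemma S_inj: "\<sigma> \<in> S \<Longrightarrow> i \<in> {1..l} \<Longrightarrow> inj (\<sigma> i)"
  by (auto simp: sym_prod_def intro: permutes_inj)

text \<open>The blocks \<open>B (i, \<sigma> i j)\<close> and \<open>B (i, j)\<close> have the same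
  size; bijections between them are chosen and pasted, with the identity elsewhere.\<close>

lemma lift_exists:
  assumes s: "\<sigma> \<in> S"
  obtains f where "lift \<sigma> f"
proof -
  define U where "U = (\<Union>c\<in>I. B c)"
  have "\<exists>h. bij_betw h (B (i, \<sigma> i j)) (B (i, j))" for i j
    by (rule finite_same_card_bij) (simp_all add: card_blk, simp_all add: blk_def)
  then have "\<forall>c. \<exists>h. bij_betw h (B (fst c, \<sigma> (fst c) (snd c))) (B c)" by simp
  then have "\<exists>h. \<forall>c. bij_betw (h c) (B (fst c, \<sigma> (fst c) (snd c))) (B c)" by (rule choice)
  then obtain h where h: "\<And>c. bij_betw (h c) (B (fst c, \<sigma> (fst c) (snd c))) (B c)" by blast
  define \<sigma>' where "\<sigma>' = (\<lambda>(i, j). (i, \<sigma> i j))"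
  have hc: "bij_betw (h c) (B (\<sigma>' c)) (B c)" for c using h[of c] by (cases c) (simp add: \<sigma>'_def)
  have s'I: "\<sigma>' c \<in> I" if "c \<in> I" for c using S_slot[OF s] that by (cases c) (auto simp: \<sigma>'_def)
  have s'_inj: "c = d" if "c \<in> I" "d \<in> I" "\<sigma>' c = \<sigma>' d" for c d
  proof -
    obtain i j i' j' where cd: "c = (i, j)" "d = (i', j')" by (cases c; cases d) auto
    have "i' = i" "\<sigma> i j = \<sigma> i j'" using that(3) unfolding cd \<sigma>'_def by auto
    then show ?thesis using injD[OF S_inj[OF s], of i j j'] slots_I(1)[OF that(1)] cd by simp
  qed
  have s'_surj: "\<exists>d\<in>I. \<sigma>' d = c" if "c \<in> I" for c
  proof (cases c)
    case (Pair i j)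
    have "(i, j) \<in> I" using that Pair by simp
    then obtain j' where "(i, j') \<in> I" "j = \<sigma> i j'" by (rule S_surj[OF s])
    then show ?thesis using Pair by (auto simp: \<sigma>'_def intro!: bexI[of _ "(i, j')"])
  qed
  \<comment> \<open>The unique slot \<open>c\<close> with \<open>x\<close> in the source block
    \<open>B (\<sigma>' c)\<close>; it selects the bijection to be applied to
    \<open>x\<close>.\<close>
  define slot where "slot x = (SOME c. c \<in> I \<and> x \<in> B (\<sigma>' c))" for x
  have slot: "slot x = c" if "c \<in> I" "x \<in> B (\<sigma>' c)" for c x
  proof -
    have "slot x \<in> I \<and> x \<in> B (\<sigma>' (slot x))" unfolding slot_def by (rule someI[of _ c]) (use that in simp)
    then have "\<sigma>' (slot x) = \<sigma>' c" using B_disj s'I that by meson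
    then show ?thesis using s'_inj that \<open>slot x \<in> I \<and> _\<close> by blast
  qed
  have slot_ex: "\<exists>c\<in>I. x \<in> B (\<sigma>' c)" if "x \<in> U" for x
    using that s'_surj unfolding U_def by (metis UN_E)
  define g where "g x = (if x \<in> U then h (slot x) x else x)" for x
  have g_blk: "g x = h c x" if "c \<in> I" "x \<in> B (\<sigma>' c)" for c x
    using slot[OF that] s'I[OF that(1)] that by (auto simp: g_def U_def)
  have g_im: "g ` B (\<sigma>' c) = B c" if "c \<in> I" for c
  proof -
    have "g ` B (\<sigma>' c) = h c ` B (\<sigma>' c)" by (rule image_cong) (use g_blk that in auto)
    then show ?thesis using hc[of c] by (simp add: bij_betw_def)
  qed
  have gU: "g x \<in> U \<longleftrightarrow> x \<in> U" for x
  proof (cases "x \<in> U")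
    case True
    then obtain c where "c \<in> I" "x \<in> B (\<sigma>' c)" using slot_ex by blast
    then show ?thesis using g_im[of c] True unfolding U_def by blast
  qed (simp add: g_def)
  have g_inj: "x = y" if e: "g x = g y" for x y
  proof (cases "x \<in> U")
    case True
    then have y: "y \<in> U" using gU[of x] gU[of y] e by simp
    obtain c where c: "c \<in> I" "x \<in> B (\<sigma>' c)" using slot_ex True by blast
    obtain d where d: "d \<in> I" "y \<in> B (\<sigma>' d)" using slot_ex y by blast
    have "g x \<in> B c" "g y \<in> B d" using g_im c d by blast+
    then have "c = d" using B_disj[OF c(1) d(1)] e by simp
    then show ?thesis using g_blk[OF c] g_blk[OF d] e hc[of c] c d by (auto simp: bij_betw_def inj_on_def)
  next
    case False
    then have "y \<notin> U" using gU[of x] gU[of y] e by simp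
    then show ?thesis using e False by (simp add: g_def)
  qed
  define f where "f v = (case v of Bot x \<Rightarrow> Bot (g x) | _ \<Rightarrow> v)" for v
  have f_Bot: "f ` Bot ` A = Bot ` g ` A" for A by (simp add: image_image f_def)
  have "lift \<sigma> f"
    unfolding lift_def
  proof (intro conjI)
    show "bottom_map f" unfolding bottom_map_def
    proof (intro conjI)
      show "inj f" by (rule injI) (auto simp: f_def g_inj split: vertex.splits)
      show "\<forall>v. v \<notin> rB \<longrightarrow> f v = v" by (auto simp: f_def split: vertex.splits)
      show "f ` rB \<subseteq> rB" by (auto simp: f_def)
    qed
    show "\<forall>(i, j)\<in>I. f ` Bot ` B (i, \<sigma> i j) = Bot ` B (i, j)"
    proof clarify
      fix i j assume "(i, j) \<in> I"
      then have "g ` B (i, \<sigma> i j) = B (i, j)" using g_im[of "(i, j)"] by (simp add: \<sigma>'_def)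
      then show "f ` Bot ` B (i, \<sigma> i j) = Bot ` B (i, j)" unfolding f_Bot by simp
    qed
    show "\<forall>v. v \<notin> Bot ` (\<Union>c\<in>I. B c) \<longrightarrow> f v = v"
      unfolding U_def[symmetric] by (auto simp: f_def g_def split: vertex.splits)
  qed
  then show ?thesis by (rule that)
qed

lemma lift_bottom: "lift \<sigma> f \<Longrightarrow> bottom_map f" by (simp add: lift_def)

lemma lift_blk: "lift \<sigma> f \<Longrightarrow> (i, j) \<in> I \<Longrightarrow> f ` Bot ` B (i, \<sigma> i j) = Bot ` B (i, j)"
  unfolding lift_def by blast

lemma lift_Top: "lift \<sigma> f \<Longrightarrow> s \<subseteq> rT \<Longrightarrow> f ` s = s"
proof -
  assume a: "lift \<sigma> f" "s \<subseteq> rT"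
  have "f v = v" if "v \<in> s" for v using that a unfolding lift_def by auto
  then show ?thesis by simp
qed

text \<open>By \<open>C_part\<close> every vertex of a block lies in a propagating part, so a lift
  moves no vertex of any other part.\<close>

lemma lift_nonprop:
  assumes f: "lift \<sigma> f" and p: "p \<in> C" and s: "s \<in> p" "\<not> propagating s"
  shows "f ` s = s"
proof -
  have "v \<notin> Bot ` (\<Union>c\<in>I. B c)" if v: "v \<in> s" for v
  proof
    assume "v \<in> Bot ` (\<Union>c\<in>I. B c)"
    then obtain c where c: "c \<in> I" "v \<in> Bot ` B c" by blast
    obtain t where t: "t \<in> p" "propagating t" "t \<inter> rB = Bot ` B c" using C_part[OF p c(1)] by blast
    then have "s = t" using diagram_disj[OF C_diagram[OF p] s(1) t(1) v] c(2) by blast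
    then show False using t s by simp
  qed
  then have "f v = v" if "v \<in> s" for v using that f unfolding lift_def by meson
  then show ?thesis by simp
qed

lemma lift_prop:
  assumes f: "lift \<sigma> f" and s: "s \<subseteq> rT \<union> rB" "s \<inter> rB = Bot ` B (i, \<sigma> i j)" "(i, j) \<in> I"
  shows "f ` s = (s \<inter> rT) \<union> Bot ` B (i, j)"
proof -
  have "s = (s \<inter> rT) \<union> (s \<inter> rB)" using s(1) by blast
  then have "f ` s = f ` (s \<inter> rT) \<union> f ` (s \<inter> rB)" by (metis image_Un)
  then show ?thesis unfolding s(2) lift_blk[OF f s(3)] using lift_Top[OF f, of "s \<inter> rT"] by simp
qed

lemma diagram_act_lift:
  assumes \<sigma>: "\<sigma> \<in> S" and f: "lift \<sigma> f" and p: "p \<in> C"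
  shows "diagram_act l m p \<sigma> = (`) f ` p"
proof
  have sub: "s \<subseteq> rT \<union> rB" if "s \<in> p" for s using diagram_sub[OF C_diagram[OF p] that] by blast
  have sl: "(i, j) \<in> I \<longleftrightarrow> i \<in> {1..l} \<and> j \<in> {1..m i}" for i j by (auto simp: slots_def)
  show "diagram_act l m p \<sigma> \<subseteq> (`) f ` p"
  proof
    fix t assume "t \<in> diagram_act l m p \<sigma>"
    then consider "t \<in> p" "\<not> propagating t"
      | s i j where "t = (s \<inter> rT) \<union> Bot ` B (i, j)" "s \<in> p" "(i, j) \<in> I" "s \<inter> rB = Bot ` B (i, \<sigma> i j)"
      unfolding diagram_act_def bottom_block_blk sl by blast
    then show "t \<in> (`) f ` p"
    proof cases
      case 1 then show ?thesis using lift_nonprop[OF f p 1] by (metis imageI)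
    next
      case 2 then show ?thesis using lift_prop[OF f sub[OF 2(2)] 2(4,3)] by (metis imageI)
    qed
  qed
  show "(`) f ` p \<subseteq> diagram_act l m p \<sigma>"
  proof
    fix t assume "t \<in> (`) f ` p"
    then obtain s where s: "s \<in> p" "t = f ` s" by blast
    show "t \<in> diagram_act l m p \<sigma>"
    proof (cases "propagating s")
      case False
      then have "t = s" using lift_nonprop[OF f p s(1)] s(2) by simp
      then show ?thesis using False s(1) unfolding diagram_act_def by blast
    next
      case True
      then obtain c where c: "c \<in> I" "s \<inter> rB = Bot ` B c" using C_slot[OF p s(1)] by blast
      obtain i j where ij: "c = (i, j)" by (cases c)
      obtain j' where j': "(i, j') \<in> I" "j = \<sigma> i j'" using S_surj[OF \<sigma>] c(1) ij by blast
      have e: "s \<inter> rB = Bot ` B (i, \<sigma> i j')" using c(2) ij j' by simp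
      have "t = (s \<inter> rT) \<union> Bot ` B (i, j')" unfolding s(2) by (rule lift_prop[OF f sub[OF s(1)] e j'(1)])
      then show ?thesis unfolding diagram_act_def bottom_block_blk using s(1) True j'(1) e unfolding sl by blast
    qed
  qed
qed

end

section \<open>The product of symmetric groups\<close>

lemma perms_mult_assoc: "perms_mult (perms_mult \<rho> \<sigma>) \<tau> = perms_mult \<rho> (perms_mult \<sigma> \<tau>)"
  by (simp add: perms_mult_def comp_assoc)

lemma perms_mult_one [simp]: "perms_mult (\<lambda>i. id) \<sigma> = \<sigma>" "perms_mult \<sigma> (\<lambda>i. id) = \<sigma>"
  by (simp_all add: perms_mult_def)

lemma perms_mult_closed: "\<sigma> \<in> sym_prod l m \<Longrightarrow> \<tau> \<in> sym_prod l m \<Longrightarrow> perms_mult \<sigma> \<tau> \<in> sym_prod l m"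
  by (auto simp: sym_prod_def perms_mult_def intro: permutes_compose)

lemma perms_one_closed: "(\<lambda>i. id) \<in> sym_prod l m"
  by (simp add: sym_prod_def permutes_id)

lemma perms_bij: "\<sigma> \<in> sym_prod l m \<Longrightarrow> bij (\<sigma> i)"
proof -
  assume s: "\<sigma> \<in> sym_prod l m"
  show "bij (\<sigma> i)"
  proof (cases "i \<in> {1..l}")
    case True
    then have "\<sigma> i permutes {1..m i}" using s unfolding sym_prod_def by blast
    then show ?thesis by (rule permutes_bij)
  next
    case False
    then have "\<sigma> i = id" using s unfolding sym_prod_def by blast
    then show ?thesis by simp
  qed
qed

lemma perms_inv_closed: "\<sigma> \<in> sym_prod l m \<Longrightarrow> perms_inv \<sigma> \<in> sym_prod l m"
  by (auto simp: sym_prod_def perms_inv_def intro: permutes_inv)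

lemma perms_inv_mult:
  assumes "\<sigma> \<in> sym_prod l m"
  shows "perms_mult (perms_inv \<sigma>) \<sigma> = (\<lambda>i. id)" "perms_mult \<sigma> (perms_inv \<sigma>) = (\<lambda>i. id)"
  using perms_bij[OF assms] unfolding perms_mult_def perms_inv_def
  by (auto simp: fun_eq_iff bij_def surj_f_inv_f)

lemma perms_inv_inv: "\<sigma> \<in> sym_prod l m \<Longrightarrow> perms_inv (perms_inv \<sigma>) = \<sigma>"
  using perms_bij[of \<sigma> l m] unfolding perms_inv_def by (simp add: inv_inv_eq)

lemma perms_inv_cancel:
  assumes "\<sigma> \<in> sym_prod l m"
  shows "perms_mult (perms_inv \<sigma>) (perms_mult \<sigma> \<tau>) = \<tau>" "perms_mult \<sigma> (perms_mult (perms_inv \<sigma>) \<tau>) = \<tau>"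
  using perms_inv_mult[OF assms] by (simp_all add: perms_mult_assoc[symmetric])

lemma finite_sym_prod: "finite (sym_prod l m)"
proof -
  have "finite (\<Pi>\<^sub>E i\<in>{1..l}. {\<pi>. \<pi> permutes {1..m i}})"
    by (intro finite_PiE) (auto intro: finite_permutations)
  moreover have "inj_on (\<lambda>\<sigma>. restrict \<sigma> {1..l}) (sym_prod l m)"
  proof (rule inj_onI)
    fix \<sigma> \<tau> assume a: "\<sigma> \<in> sym_prod l m" "\<tau> \<in> sym_prod l m" "restrict \<sigma> {1..l} = restrict \<tau> {1..l}"
    show "\<sigma> = \<tau>"
    proof
      fix i
      show "\<sigma> i = \<tau> i"
      proof (cases "i \<in> {1..l}")
        case True then show ?thesis using a(3) by (metis restrict_apply')
      next
        case False then show ?thesis using a(1,2) unfolding sym_prod_def by auto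
      qed
    qed
  qed
  moreover have "(\<lambda>\<sigma>. restrict \<sigma> {1..l}) ` sym_prod l m \<subseteq> (\<Pi>\<^sub>E i\<in>{1..l}. {\<pi>. \<pi> permutes {1..m i}})"
    by (auto simp: sym_prod_def)
  ultimately show ?thesis by (meson inj_on_finite)
qed

text \<open>Both partition the same set. This reduces later identifications of diagrams to one
  inclusion.\<close>

lemma diagram_subset_eq:
  assumes p: "p \<in> diagrams n m" and q: "q \<in> diagrams n m" and "p \<subseteq> q"
  shows "p = q"
proof
  show "q \<subseteq> p"
  proof
    fix s assume s: "s \<in> q"
    then obtain x where x: "x \<in> s" using diagram_ne[OF q] by blast
    then obtain t where t: "t \<in> p" "x \<in> t" using diagram_cover[OF p, of x] diagram_sub[OF q s] by blast
    then have "t = s" using diagram_disj[OF q _ s, of t x] x assms(3) by blast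
    then show "s \<in> p" using t by simp
  qed
qed fact

lemma nonprop_cases: "p \<in> diagrams k k' \<Longrightarrow> s \<in> p \<Longrightarrow> \<not> propagating s \<Longrightarrow> s \<subseteq> rT \<or> s \<subseteq> rB"
proof -
  assume "p \<in> diagrams k k'" "s \<in> p" "\<not> propagating s"
  then have "s \<subseteq> rT \<union> rB" "s \<inter> rT = {} \<or> s \<inter> rB = {}"
    using diagram_sub[of p k k' s] by (auto simp: propagating_def)
  then show ?thesis by blast
qed

context cell
begin

abbreviation "act \<equiv> diagram_act l m"

lemma lift_part_Int:
  assumes "lift \<sigma> f"
  shows "f ` s \<inter> rT = s \<inter> rT" "f ` s \<inter> rB = f ` (s \<inter> rB)"
proof -
  note r = bottom_map_range[OF lift_bottom[OF assms]]
  have "f ` s \<inter> rT = f ` (s \<inter> rT)" using r(2) by blast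
  then show "f ` s \<inter> rT = s \<inter> rT" using lift_Top[OF assms, of "s \<inter> rT"] by simp
  show "f ` s \<inter> rB = f ` (s \<inter> rB)" using r(3) by blast
qed

lemma lift_inj: "lift \<sigma> f \<Longrightarrow> inj f"
  using lift_bottom by (auto simp: bottom_map_def)

lemma lift_sub: "lift \<sigma> f \<Longrightarrow> f ` s \<subseteq> rB \<longleftrightarrow> s \<subseteq> rB"
  using bottom_map_range(3)[OF lift_bottom] by blast

lemma lift_counts:
  assumes "lift \<sigma> f"
  shows "ntop (f ` s) = ntop s" "nbot (f ` s) = nbot s" "propagating (f ` s) = propagating s"
proof -
  show "ntop (f ` s) = ntop s" unfolding ntop_def lift_part_Int[OF assms] ..
  show "nbot (f ` s) = nbot s" unfolding nbot_def lift_part_Int[OF assms]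
    by (rule card_image, rule inj_on_subset[OF lift_inj[OF assms]]) simp
  show "propagating (f ` s) = propagating s" unfolding propagating_def lift_part_Int[OF assms] by simp
qed

text \<open>A lift permutes the blocks among themselves and fixes the other vertices; hence images
  of diagrams are again partitions of the two rows.\<close>

lemma lift_union:
  assumes \<sigma>: "\<sigma> \<in> S" and f: "lift \<sigma> f"
  shows "f ` (Top ` {1..n} \<union> Bot ` {1..n}) = Top ` {1..n} \<union> Bot ` {1..n}"
proof -
  let ?U = "\<Union>c\<in>I. B c"
  have U: "f ` Bot ` ?U = Bot ` ?U"
  proof
    show "f ` Bot ` ?U \<subseteq> Bot ` ?U"
    proof clarify
      fix x i j assume x: "(i, j) \<in> I" "x \<in> B (i, j)"
      obtain j' where j': "(i, j') \<in> I" "j = \<sigma> i j'" using S_surj[OF \<sigma> x(1)] .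
      have "f (Bot x) \<in> Bot ` B (i, j')" using lift_blk[OF f j'(1)] x(2) j'(2) by blast
      then show "f (Bot x) \<in> Bot ` ?U" using j'(1) by blast
    qed
    show "Bot ` ?U \<subseteq> f ` Bot ` ?U"
    proof clarify
      fix x i j assume x: "(i, j) \<in> I" "x \<in> B (i, j)"
      then have "Bot x \<in> f ` Bot ` B (i, \<sigma> i j)" using lift_blk[OF f x(1)] by blast
      then show "Bot x \<in> f ` Bot ` ?U" using S_slot[OF \<sigma> x(1)] by blast
    qed
  qed
  have "?U \<subseteq> {1..n}" using B_sub by blast
  then have e: "Bot ` {1..n} = Bot ` ?U \<union> Bot ` ({1..n} - ?U)" by blast
  have "f v = v" if v: "v \<in> Bot ` ({1..n} - ?U)" for v
  proof -
    have "v \<notin> Bot ` ?U" using v by auto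
    then show ?thesis using f unfolding lift_def by simp
  qed
  then have "f ` Bot ` ({1..n} - ?U) = Bot ` ({1..n} - ?U)" by simp
  then have "f ` Bot ` {1..n} = Bot ` {1..n}" using U e by (metis image_Un)
  moreover have "f ` Top ` {1..n} = Top ` {1..n}" by (rule lift_Top[OF f]) auto
  ultimately show ?thesis by (simp only: image_Un)
qed

text \<open>Only the bottom blocks of propagating parts are permuted, among blocks of equal size,
  and everything else is kept; so each condition defining \<open>C\<close> survives.\<close>

lemma act_C:
  assumes p: "p \<in> C" and \<sigma>: "\<sigma> \<in> S"
  shows "act p \<sigma> \<in> C"
proof -
  obtain f where f: "lift \<sigma> f" by (rule lift_exists[OF \<sigma>])
  have e: "act p \<sigma> = (`) f ` p" by (rule diagram_act_lift[OF \<sigma> f p])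
  have "partition_on (f ` (Top ` {1..n} \<union> Bot ` {1..n})) ((`) f ` p)"
    by (rule partition_on_image[OF _ inj_on_subset[OF lift_inj[OF f]]])
      (use C_diagram[OF p] in \<open>simp_all add: diagrams_def\<close>)
  then have dg: "(`) f ` p \<in> diagrams n n" unfolding lift_union[OF \<sigma> f] by (simp add: diagrams_def)
  have tn: "(`) f ` p \<in> tonal l n"
    using dg C_tonal[OF p] unfolding tonal_def by (auto simp: lift_counts[OF f])
  have pv: "prop_vec l ((`) f ` p) = prop_vec l p"
  proof
    fix h
    have "{s \<in> (`) f ` p. propagating s \<and> ntop s mod l = h mod l}
        = (`) f ` {s \<in> p. propagating s \<and> ntop s mod l = h mod l}"
      by (auto simp: lift_counts[OF f])
    moreover have "inj_on ((`) f) A" for A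
      by (rule inj_onI) (use inj_image_eq_iff[OF lift_inj[OF f]] in blast)
    ultimately show "prop_vec l ((`) f ` p) h = prop_vec l p h" by (simp add: prop_vec_def card_image)
  qed
  have iso: "{s \<in> (`) f ` p. s \<subseteq> rB} = {s \<in> p. s \<subseteq> rB}"
  proof -
    have "{s \<in> (`) f ` p. s \<subseteq> rB} = (`) f ` {s \<in> p. s \<subseteq> rB}" using lift_sub[OF f] by blast
    also have "\<dots> = (\<lambda>s. s) ` {s \<in> p. s \<subseteq> rB}"
    proof (rule image_cong[OF refl])
      fix s assume s: "s \<in> {s \<in> p. s \<subseteq> rB}"
      then have "\<not> propagating s" by (auto simp: propagating_def)
      then show "f ` s = s" using lift_nonprop[OF f p] s by blast
    qed
    finally show ?thesis by simp
  qed
  have bot: "(\<lambda>s. s \<inter> rB) ` ((`) f ` p) - {{}} = (\<lambda>s. s \<inter> rB) ` p - {{}}"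
  proof -
    have sub: "s \<subseteq> rT \<union> rB" if "s \<in> p" for s using diagram_sub[OF C_diagram[OF p] that] by blast
    have 1: "f ` s \<inter> rB \<in> (\<lambda>s. s \<inter> rB) ` p" if s: "s \<in> p" for s
    proof (cases "propagating s")
      case False then show ?thesis using lift_nonprop[OF f p s] s by simp
    next
      case True
      then obtain c where c: "c \<in> I" "s \<inter> rB = Bot ` B c" using C_slot[OF p s] by blast
      obtain i j where ij: "c = (i, j)" by (cases c)
      obtain j' where j': "(i, j') \<in> I" "j = \<sigma> i j'" using S_surj[OF \<sigma>] c(1) ij by blast
      have "f ` s \<inter> rB = Bot ` B (i, j')"
        unfolding lift_part_Int(2)[OF f] c(2) ij j'(2) by (rule lift_blk[OF f j'(1)])
      then show ?thesis using C_part[OF p j'(1)] by (metis imageI)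
    qed
    have 2: "s \<inter> rB \<in> (\<lambda>s. s \<inter> rB) ` (`) f ` p" if s: "s \<in> p" for s
    proof (cases "propagating s")
      case False then show ?thesis using lift_nonprop[OF f p s] s by (metis imageI)
    next
      case True
      then obtain c where c: "c \<in> I" "s \<inter> rB = Bot ` B c" using C_slot[OF p s] by blast
      obtain i j where ij: "c = (i, j)" by (cases c)
      then have I: "(i, j) \<in> I" using c by simp
      obtain t where t: "t \<in> p" "t \<inter> rB = Bot ` B (i, \<sigma> i j)" using C_part[OF p S_slot[OF \<sigma> I]] by blast
      have "f ` t \<inter> rB = Bot ` B (i, j)"
        unfolding lift_part_Int(2)[OF f] t(2) by (rule lift_blk[OF f I])
      then have "s \<inter> rB = f ` t \<inter> rB" using c(2) ij by simp
      then show ?thesis using t(1) by blast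
    qed
    show ?thesis using 1 2 by auto
  qed
  show ?thesis unfolding e cell_diagrams_def
    using tn pv iso bot C_prop_vec[OF p] C_bottom[OF p] C_isolated[OF p] by simp
qed

text \<open>The order is reversed because a lift undoes its permutation on names: \<open>f\<close>
  carries the block \<open>\<sigma> (\<tau> j)\<close> to \<open>\<tau> j\<close>, and
  \<open>g\<close> carries that to \<open>j\<close>. This is what makes \<open>act\<close> a right
  action.\<close>

lemma lift_mult:
  assumes f: "lift \<sigma> f" and g: "lift \<tau> g" and \<tau>: "\<tau> \<in> S"
  shows "lift (perms_mult \<sigma> \<tau>) (g \<circ> f)"
  unfolding lift_def
proof (intro conjI)
  show "bottom_map (g \<circ> f)"
  proof -
    have "inj (g \<circ> f)" by (rule inj_compose[OF lift_inj[OF g] lift_inj[OF f]])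
    moreover have "(g \<circ> f) v = v" if "v \<notin> rB" for v
      using that lift_bottom[OF f] lift_bottom[OF g] unfolding bottom_map_def by simp
    moreover have "(g \<circ> f) ` rB \<subseteq> rB"
    proof -
      have "f ` rB \<subseteq> rB" "g ` rB \<subseteq> rB" using lift_bottom[OF f] lift_bottom[OF g] by (simp_all add: bottom_map_def)
      then have "g ` f ` rB \<subseteq> rB" by (metis image_mono order_trans)
      with image_comp[of g f rB, symmetric] show ?thesis by (rule ord_eq_le_trans)
    qed
    ultimately show ?thesis unfolding bottom_map_def by blast
  qed
  show "\<forall>(i, j)\<in>I. (g \<circ> f) ` Bot ` B (i, perms_mult \<sigma> \<tau> i j) = Bot ` B (i, j)"
  proof clarify
    fix i j assume I: "(i, j) \<in> I"
    have "(g \<circ> f) ` Bot ` B (i, perms_mult \<sigma> \<tau> i j) = g ` f ` Bot ` B (i, \<sigma> i (\<tau> i j))"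
      by (simp add: perms_mult_def image_comp)
    also have "f ` Bot ` B (i, \<sigma> i (\<tau> i j)) = Bot ` B (i, \<tau> i j)" by (rule lift_blk[OF f S_slot[OF \<tau> I]])
    also have "g ` Bot ` B (i, \<tau> i j) = Bot ` B (i, j)" by (rule lift_blk[OF g I])
    finally show "(g \<circ> f) ` Bot ` B (i, perms_mult \<sigma> \<tau> i j) = Bot ` B (i, j)" .
  qed
  show "\<forall>v. v \<notin> Bot ` (\<Union>c\<in>I. B c) \<longrightarrow> (g \<circ> f) v = v" using f g unfolding lift_def by simp
qed

lemma act_mult:
  assumes p: "p \<in> C" and \<sigma>: "\<sigma> \<in> S" and \<tau>: "\<tau> \<in> S"
  shows "act (act p \<sigma>) \<tau> = act p (perms_mult \<sigma> \<tau>)"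
proof -
  obtain f where f: "lift \<sigma> f" by (rule lift_exists[OF \<sigma>])
  obtain g where g: "lift \<tau> g" by (rule lift_exists[OF \<tau>])
  have "act (act p \<sigma>) \<tau> = (`) g ` (`) f ` p"
    using diagram_act_lift[OF \<tau> g act_C[OF p \<sigma>]] diagram_act_lift[OF \<sigma> f p] by simp
  also have "\<dots> = (`) (g \<circ> f) ` p" by (simp add: image_image image_comp)
  also have "\<dots> = act p (perms_mult \<sigma> \<tau>)"
    using diagram_act_lift[OF perms_mult_closed[OF \<sigma> \<tau>] lift_mult[OF f g \<tau>] p] by simp
  finally show ?thesis .
qed

lemma act_one: "p \<in> C \<Longrightarrow> act p (\<lambda>i. id) = p"
proof -
  assume p: "p \<in> C"
  have "lift (\<lambda>i. id) id" unfolding lift_def bottom_map_def by auto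
  from diagram_act_lift[OF perms_one_closed this p] show ?thesis by simp
qed

lemma act_inv: "p \<in> C \<Longrightarrow> \<sigma> \<in> S \<Longrightarrow> act (act p \<sigma>) (perms_inv \<sigma>) = p"
  "p \<in> C \<Longrightarrow> \<sigma> \<in> S \<Longrightarrow> act (act p (perms_inv \<sigma>)) \<sigma> = p"
  by (simp_all add: act_mult perms_inv_closed perms_inv_mult act_one)

section \<open>The orbit of a^m under the symmetric groups\<close>

lemma orbit_part:
  assumes \<sigma>: "\<sigma> \<in> S" and I: "(i, j) \<in> I"
  shows "Top ` B (i, \<sigma> i j) \<union> Bot ` B (i, j) \<in> act a \<sigma>"
proof -
  obtain f where f: "lift \<sigma> f" by (rule lift_exists[OF \<sigma>])
  have I': "(i, \<sigma> i j) \<in> I" by (rule S_slot[OF \<sigma> I])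
  have "f ` strand l m (i, \<sigma> i j) = (strand l m (i, \<sigma> i j) \<inter> rT) \<union> Bot ` B (i, j)"
    by (rule lift_prop[OF f _ _ I]) (auto simp: strand_def)
  then show ?thesis using strand_a[OF I'] unfolding diagram_act_lift[OF \<sigma> f a_C] strand_Int by (metis imageI)
qed

lemma orbit_nonprop:
  assumes \<sigma>: "\<sigma> \<in> S" and s: "s \<in> a" "\<not> propagating s"
  shows "s \<in> act a \<sigma>"
proof -
  obtain f where f: "lift \<sigma> f" by (rule lift_exists[OF \<sigma>])
  show ?thesis using lift_nonprop[OF f a_C s] s(1) unfolding diagram_act_lift[OF \<sigma> f a_C] by (metis imageI)
qed

text \<open>The top block joined to the bottom block \<open>B (i, j)\<close> has the name
  \<open>\<sigma> i j\<close>, so the diagram determines \<open>\<sigma>\<close>.\<close>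

lemma orbit_inj:
  assumes \<sigma>: "\<sigma> \<in> S" and \<tau>: "\<tau> \<in> S" and e: "act a \<sigma> = act a \<tau>"
  shows "\<sigma> = \<tau>"
proof (intro ext)
  fix i j
  show "\<sigma> i j = \<tau> i j"
  proof (cases "(i, j) \<in> I")
    case True
    have 1: "Top ` B (i, \<sigma> i j) \<union> Bot ` B (i, j) \<in> act a \<sigma>" by (rule orbit_part[OF \<sigma> True])
    have 2: "Top ` B (i, \<tau> i j) \<union> Bot ` B (i, j) \<in> act a \<sigma>" unfolding e by (rule orbit_part[OF \<tau> True])
    obtain x where "x \<in> B (i, j)" using B_ne[OF True] by blast
    then have "Top ` B (i, \<sigma> i j) \<union> Bot ` B (i, j) = Top ` B (i, \<tau> i j) \<union> Bot ` B (i, j)"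
      by (intro diagram_disj[OF C_diagram[OF act_C[OF a_C \<sigma>]] 1 2, of "Bot x"]) auto
    then have "B (i, \<sigma> i j) \<subseteq> B (i, \<tau> i j)" by auto
    moreover obtain y where "y \<in> B (i, \<sigma> i j)" using B_ne[OF S_slot[OF \<sigma> True]] by blast
    ultimately show ?thesis using B_disj[OF S_slot[OF \<sigma> True] S_slot[OF \<tau> True]] by blast
  next
    case False
    show ?thesis
    proof (cases "i \<in> {1..l}")
      case True
      then have "j \<notin> {1..m i}" "\<sigma> i permutes {1..m i}" "\<tau> i permutes {1..m i}"
        using False \<sigma> \<tau> by (auto simp: slots_def sym_prod_def)
      then show ?thesis by (metis permutes_not_in)
    next
      case False
      then show ?thesis using \<sigma> \<tau> unfolding sym_prod_def by auto
    qed
  qed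
qed

text \<open>Both rows of \<open>D\<close> have the blocks of \<open>a\<close>. A propagating part
  joins a top block to a bottom block of the same residue and hence of the same size, because sizes
  in \<open>{1..l}\<close> are determined modulo \<open>l\<close>. So \<open>D\<close> differs from
  \<open>a\<close> by permutations among blocks of equal size.\<close>

lemma orbit_exists:
  assumes D: "D \<in> C" and fD: "flip D \<in> C"
  shows "\<exists>\<sigma>\<in>S. D = act a \<sigma>"
proof -
  have key: "\<exists>j'. (i, j') \<in> I \<and> Top ` B (i, j') \<union> Bot ` B (i, j) \<in> D" if I: "(i, j) \<in> I" for i j
  proof -
    obtain s where s: "s \<in> D" "propagating s" "s \<inter> rB = Bot ` B (i, j)" using C_part[OF D I] by blast
    have fs: "flip_vertex ` s \<in> flip D" "propagating (flip_vertex ` s)"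
      using s(1,2) by (auto simp: flip_def propagating_flip)
    obtain c where c: "c \<in> I" "flip_vertex ` s \<inter> rB = Bot ` B c" using C_slot[OF fD fs] by blast
    have "flip_vertex ` (flip_vertex ` s \<inter> rB) = s \<inter> rT" unfolding flip_part_Int by simp
    then have sT: "s \<inter> rT = Top ` B c" unfolding c(2) by (simp add: image_image)
    have "ntop s mod l = nbot s mod l" using C_tonal[OF D] s(1) by (auto simp: tonal_def)
    then have "fst c mod l = i mod l" unfolding ntop_def nbot_def sT s(3) by (simp add: card_image inj_on_def card_blk)
    then have "fst c = i" using mod_range_eq slots_I(1)[OF c(1)] slots_I(1)[OF I] by simp
    then obtain j' where "c = (i, j')" by (cases c) auto
    moreover have "s \<subseteq> rT \<union> rB" using diagram_sub[OF C_diagram[OF D] s(1)] by blast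
    then have "s = (s \<inter> rT) \<union> (s \<inter> rB)" by blast
    ultimately show ?thesis using s sT c(1) by metis
  qed
  then obtain k where k: "\<And>i j. (i, j) \<in> I \<Longrightarrow> (i, k i j) \<in> I \<and> Top ` B (i, k i j) \<union> Bot ` B (i, j) \<in> D"
    by metis
  \<comment> \<open>The identity outside the slots, as membership in \<open>S\<close>
    demands.\<close>
  define \<sigma> where "\<sigma> = (\<lambda>i j. if (i, j) \<in> I then k i j else j)"
  have k_inj: "j = j'" if I: "(i, j) \<in> I" "(i, j') \<in> I" and e: "k i j = k i j'" for i j j'
  proof -
    obtain x where x: "x \<in> B (i, k i j)" using B_ne k[OF I(1)] by blast
    have "Top ` B (i, k i j) \<union> Bot ` B (i, j) = Top ` B (i, k i j') \<union> Bot ` B (i, j')"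
      by (rule diagram_disj[OF C_diagram[OF D], of _ _ "Top x"]) (use k[OF I(1)] k[OF I(2)] x e in auto)
    then have "B (i, j) \<subseteq> B (i, j')" by auto
    moreover obtain y where "y \<in> B (i, j)" using B_ne[OF I(1)] by blast
    ultimately show ?thesis using B_disj[OF I] by blast
  qed
  have \<sigma>S: "\<sigma> \<in> S"
    unfolding sym_prod_def
  proof (intro CollectI conjI ballI allI impI)
    fix i assume i: "i \<in> {1..l}"
    have Ii: "(i, j) \<in> I \<longleftrightarrow> j \<in> {1..m i}" for j using i by (auto simp: slots_def)
    have inj: "inj_on (\<sigma> i) {1..m i}"
    proof (rule inj_onI)
      fix j j' assume "j \<in> {1..m i}" "j' \<in> {1..m i}" "\<sigma> i j = \<sigma> i j'"
      then show "j = j'" using k_inj[of i j j'] unfolding Ii[symmetric] by (simp add: \<sigma>_def)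
    qed
    have "\<sigma> i ` {1..m i} \<subseteq> {1..m i}"
    proof (rule image_subsetI)
      fix j assume "j \<in> {1..m i}"
      then have "(i, j) \<in> I" using Ii by blast
      then have "(i, \<sigma> i j) \<in> I" using k[of i j] by (simp add: \<sigma>_def)
      then show "\<sigma> i j \<in> {1..m i}" using Ii by blast
    qed
    then have "\<sigma> i ` {1..m i} = {1..m i}" using endo_inj_surj[OF _ _ inj] by simp
    then have "bij_betw (\<sigma> i) {1..m i} {1..m i}" using inj by (simp add: bij_betw_def)
    moreover have "\<sigma> i j = j" if "j \<notin> {1..m i}" for j using that Ii[of j] unfolding \<sigma>_def by argo
    ultimately show "\<sigma> i permutes {1..m i}" by (rule bij_imp_permutes)
  next
    fix i assume i: "i \<notin> {1..l}"
    show "\<sigma> i = id" using slots_I(1)[of "(i, _)"] i unfolding \<sigma>_def by (auto simp: fun_eq_iff)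
  qed
  have "D \<subseteq> act a \<sigma>"
  proof
    fix s assume s: "s \<in> D"
    show "s \<in> act a \<sigma>"
    proof (cases "propagating s")
      case True
      then obtain c where c: "c \<in> I" "s \<inter> rB = Bot ` B c" using C_slot[OF D s] by blast
      obtain i j where ij: "c = (i, j)" by (cases c)
      then have I: "(i, j) \<in> I" using c by simp
      obtain x where "x \<in> B (i, j)" using B_ne[OF I] by blast
      then have xx: "Bot x \<in> s" "Bot x \<in> Top ` B (i, k i j) \<union> Bot ` B (i, j)" using c(2) ij by blast+
      have kD: "Top ` B (i, k i j) \<union> Bot ` B (i, j) \<in> D" using k[OF I] by blast
      have "s = Top ` B (i, k i j) \<union> Bot ` B (i, j)"
        by (rule diagram_disj[OF C_diagram[OF D] s kD xx])
      then show ?thesis using orbit_part[OF \<sigma>S I] I unfolding \<sigma>_def by simp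
    next
      case False
      \<comment> \<open>Isolated bottom parts are read off from \<open>D\<close>, isolated top parts
        from \<open>flip D\<close> and the symmetry of \<open>a\<close>.\<close>
      have "s \<in> a"
      proof (cases "s \<subseteq> rB")
        case True then show ?thesis using C_isolated[OF D] s by blast
      next
        case nB: False
        then have "s \<subseteq> rT" using nonprop_cases[OF C_diagram[OF D] s False] by blast
        then have "flip_vertex ` s \<subseteq> rB" using flip_sub(2) by blast
        moreover have "flip_vertex ` s \<in> flip D" using s by (simp add: flip_def)
        ultimately have "flip_vertex ` s \<in> a" using C_isolated[OF fD] by blast
        then have "flip_vertex ` flip_vertex ` s \<in> flip a" unfolding flip_def by (rule imageI)
        then show ?thesis unfolding flip_a by simp
      qed
      then show ?thesis by (rule orbit_nonprop[OF \<sigma>S _ False])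
    qed
  qed
  then have "D = act a \<sigma>" by (rule diagram_subset_eq[OF C_diagram[OF D] C_diagram[OF act_C[OF a_C \<sigma>S]]])
  then show ?thesis using \<sigma>S by blast
qed

text \<open>In \<open>act a \<sigma>\<close> the top block \<open>\<sigma> i j\<close> is joined to
  the bottom block \<open>j\<close>; reflection exchanges the two roles and so inverts
  \<open>\<sigma>\<close>.\<close>

lemma flip_orbit:
  assumes \<sigma>: "\<sigma> \<in> S"
  shows "flip (act a \<sigma>) = act a (perms_inv \<sigma>)"
proof -
  note \<sigma>' = perms_inv_closed[OF \<sigma>]
  obtain f where f: "lift \<sigma> f" by (rule lift_exists[OF \<sigma>])
  note e = diagram_act_lift[OF \<sigma> f a_C]
  have "flip (act a \<sigma>) \<subseteq> act a (perms_inv \<sigma>)"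
  proof
    fix t assume "t \<in> flip (act a \<sigma>)"
    then obtain s where s: "s \<in> a" "t = flip_vertex ` f ` s" unfolding e flip_def by blast
    show "t \<in> act a (perms_inv \<sigma>)"
    proof (cases "propagating s")
      case True
      then obtain c where c: "c \<in> I" "s = strand l m c" using prop_a s(1) by blast
      obtain i j where ij: "c = (i, j)" by (cases c)
      obtain j' where j': "(i, j') \<in> I" "j = \<sigma> i j'" using S_surj[OF \<sigma>] c(1) ij by blast
      have "f ` strand l m (i, j) = (strand l m (i, j) \<inter> rT) \<union> Bot ` B (i, j')"
        by (rule lift_prop[OF f _ _ j'(1)]) (auto simp: strand_def j'(2))
      then have "t = Top ` B (i, j') \<union> Bot ` B (i, j)"
        unfolding s(2) c(2) ij strand_Int by (simp add: image_Un image_image Un_commute)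
      moreover have "j' = perms_inv \<sigma> i j" unfolding j'(2) perms_inv_def
        using perms_bij[OF \<sigma>, of i] by (simp add: bij_is_inj)
      ultimately show ?thesis using orbit_part[OF \<sigma>', of i j] c(1) ij by simp
    next
      case False
      then have "t = flip_vertex ` s" using lift_nonprop[OF f a_C s(1)] s(2) by simp
      then have "t \<in> flip a" "\<not> propagating t" using s(1) False by (auto simp: flip_def propagating_flip)
      then show ?thesis using orbit_nonprop[OF \<sigma>'] unfolding flip_a by blast
    qed
  qed
  then show ?thesis
    by (rule diagram_subset_eq[OF flip_diagrams[OF C_diagram[OF act_C[OF a_C \<sigma>]]] C_diagram[OF act_C[OF a_C \<sigma>']]])
qed

text \<open>The reflected product is of the same kind, with \<open>p\<close> and \<open>q\<close>
  exchanged. So both rows of the product are those of \<open>a\<close>, and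
  \<open>orbit_exists\<close> applies.\<close>

lemma dcomp_flip_orbit:
  assumes p: "p \<in> C" and q: "q \<in> C" and D: "dcomp (flip p) q \<in> C"
  shows "\<exists>\<rho>\<in>S. dcomp (flip p) q = act a \<rho>"
proof (rule orbit_exists[OF D])
  have e: "flip (dcomp (flip p) q) = dcomp (flip q) p" using flip_dcomp[of q "flip p"] by simp
  have "prop_vec l (flip (dcomp (flip p) q)) = m" using prop_vec_flip[OF C_tonal[OF D]] C_prop_vec[OF D] by simp
  then show "flip (dcomp (flip p) q) \<in> C"
    unfolding e by (rule dcomp_C[OF flip_tonal[OF C_tonal[OF q]] p])
qed

text \<open>A lift renames only bottom vertices of the lower factor, which composition from above
  does not see. For a product in \<open>C\<close> the same lift computes the action on the
  product.\<close>

lemma dcomp_act: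
  assumes q: "q \<in> C" and \<tau>: "\<tau> \<in> S"
  shows "loops r (act q \<tau>) = loops r q" "dcomp r q \<in> C \<Longrightarrow> dcomp r (act q \<tau>) = act (dcomp r q) \<tau>"
proof -
  obtain f where f: "lift \<tau> f" by (rule lift_exists[OF \<tau>])
  show "loops r (act q \<tau>) = loops r q"
    unfolding diagram_act_lift[OF \<tau> f q] by (rule bottom_map_dcomp(2)[OF lift_bottom[OF f]])
  show "dcomp r q \<in> C \<Longrightarrow> dcomp r (act q \<tau>) = act (dcomp r q) \<tau>"
    using diagram_act_lift[OF \<tau> f] bottom_map_dcomp(1)[OF lift_bottom[OF f], of r q] q by simp
qed

lemma loops_act:
  assumes p: "p \<in> C" and q: "q \<in> C" and \<sigma>: "\<sigma> \<in> S" and \<tau>: "\<tau> \<in> S"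
  shows "loops (flip (act p \<sigma>)) (act q \<tau>) = loops (flip p) q"
proof -
  have "loops (flip (act p \<sigma>)) (act q \<tau>) = loops (flip (act p \<sigma>)) q" by (rule dcomp_act(1)[OF q \<tau>])
  also have "\<dots> = loops (flip q) (act p \<sigma>)" using flip_loops[of q "flip (act p \<sigma>)"] by simp
  also have "\<dots> = loops (flip q) p" by (rule dcomp_act(1)[OF p \<sigma>])
  also have "\<dots> = loops (flip p) q" using flip_loops[of q "flip p"] by simp
  finally show ?thesis .
qed

lemma orbit_act: "\<pi> \<in> S \<Longrightarrow> \<tau> \<in> S \<Longrightarrow> act (act a \<pi>) \<tau> = act a (perms_mult \<pi> \<tau>)"
  by (rule act_mult[OF a_C])

lemma perms_inv_mult_distrib:
  assumes "\<sigma> \<in> S" "\<tau> \<in> S"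
  shows "perms_inv (perms_mult \<sigma> \<tau>) = perms_mult (perms_inv \<tau>) (perms_inv \<sigma>)"
  unfolding perms_inv_def perms_mult_def
  using perms_bij[OF assms(1)] perms_bij[OF assms(2)] by (simp add: o_inv_distrib fun_eq_iff)

text \<open>The permutation of \<open>p\<close> reaches the product through a reflection before and
  after: \<open>(p \<sigma>)^op q\<close> is the reflection of \<open>q^op (p \<sigma>)\<close>.
  This is where \<open>\<sigma>\<close> becomes its inverse on the left.\<close>

lemma dcomp_act_orbit:
  assumes p: "p \<in> C" and q: "q \<in> C" and \<sigma>: "\<sigma> \<in> S" and \<tau>: "\<tau> \<in> S" and \<pi>: "\<pi> \<in> S"
    and D: "dcomp (flip p) q = act a \<pi>"
  shows "dcomp (flip (act p \<sigma>)) (act q \<tau>) = act a (perms_mult (perms_mult (perms_inv \<sigma>) \<pi>) \<tau>)"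
proof -
  have DC: "act a \<pi> \<in> C" "act a (perms_inv \<pi>) \<in> C" by (rule act_C[OF a_C] \<pi> perms_inv_closed)+
  have 1: "dcomp (flip q) p = act a (perms_inv \<pi>)"
    using flip_dcomp[of q "flip p"] D flip_orbit[OF \<pi>] by simp
  then have "dcomp (flip q) (act p \<sigma>) = act (act a (perms_inv \<pi>)) \<sigma>"
    using dcomp_act(2)[OF p \<sigma>, of "flip q"] DC by simp
  also have "\<dots> = act a (perms_mult (perms_inv \<pi>) \<sigma>)" by (rule orbit_act[OF perms_inv_closed[OF \<pi>] \<sigma>])
  finally have 2: "dcomp (flip q) (act p \<sigma>) = act a (perms_mult (perms_inv \<pi>) \<sigma>)" .
  have cl: "perms_mult (perms_inv \<pi>) \<sigma> \<in> S" by (intro perms_mult_closed perms_inv_closed \<pi> \<sigma>)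
  have "dcomp (flip (act p \<sigma>)) q = act a (perms_inv (perms_mult (perms_inv \<pi>) \<sigma>))"
    using flip_dcomp[of "act p \<sigma>" "flip q"] 2 flip_orbit[OF cl] by simp
  also have "perms_inv (perms_mult (perms_inv \<pi>) \<sigma>) = perms_mult (perms_inv \<sigma>) \<pi>"
    using perms_inv_mult_distrib[OF perms_inv_closed[OF \<pi>] \<sigma>] perms_inv_inv[OF \<pi>] by simp
  finally have 3: "dcomp (flip (act p \<sigma>)) q = act a (perms_mult (perms_inv \<sigma>) \<pi>)" .
  have cl': "perms_mult (perms_inv \<sigma>) \<pi> \<in> S" by (intro perms_mult_closed perms_inv_closed \<pi> \<sigma>)
  have "dcomp (flip (act p \<sigma>)) (act q \<tau>) = act (act a (perms_mult (perms_inv \<sigma>) \<pi>)) \<tau>"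
    using dcomp_act(2)[OF q \<tau>, of "flip (act p \<sigma>)"] 3 act_C[OF a_C cl'] by simp
  then show ?thesis using orbit_act[OF cl' \<tau>] by simp
qed

section \<open>Counting the loops of p^op q\<close>

definition nt :: "diagram \<Rightarrow> nat" where "nt p = card {s \<in> p. s \<subseteq> rT}"

lemma isolated_flip: "{s \<in> flip p. s \<subseteq> rB} = (`) flip_vertex ` {s \<in> p. s \<subseteq> rT}"
  using sub_rB_flip[of "flip p"] by simp

lemma card_isolated_flip: "card {s \<in> flip p. s \<subseteq> rB} = nt p"
  unfolding isolated_flip nt_def
  by (rule card_image, rule inj_onI) (use inj_image_eq_iff[OF inj_flip_vertex] in blast)

text \<open>The loops are bounded by the isolated top parts of \<open>p\<close> and by those of
  \<open>q\<close> separately; adding the bounds gives the symmetric estimate on which the degree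
  argument rests.\<close>

lemma loops_le_nt:
  assumes p: "p \<in> C" and q: "q \<in> C"
  shows "2 * loops (flip p) q \<le> nt p + nt q"
proof -
  interpret tonal_composable l n "flip p" q using l flip_tonal[OF C_tonal[OF p]] C_tonal[OF q] by unfold_locales
  show ?thesis using loops_le_left loops_le_right unfolding card_isolated_flip nt_def by linarith
qed

text \<open>Equality forces both bounds, so \<open>extremal_loops\<close> matches the isolated top
  parts of \<open>p\<close> and \<open>q\<close> and the top rows of their propagating parts. Since
  the product is \<open>a\<close> itself and not \<open>act a \<rho>\<close> for another
  \<open>\<rho>\<close>, matched parts sit on the same bottom block.\<close>

lemma loops_eq_nt:
  assumes pC: "p \<in> C" and qC: "q \<in> C" and D: "dcomp (flip p) q = a"
    and lo: "2 * loops (flip p) q = nt p + nt q"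
  shows "p = q"
proof -
  interpret tonal_composable l n "flip p" q using l flip_tonal[OF C_tonal[OF pC]] C_tonal[OF qC] by unfold_locales
  have pv: "prop_vec l (dcomp (flip p) q) = prop_vec l (flip p)" "prop_vec l (dcomp (flip p) q) = prop_vec l q"
    unfolding D prop_vec_a prop_vec_flip[OF C_tonal[OF pC]] using C_prop_vec pC qC by simp_all
  have lo': "loops (flip p) q = card {s \<in> flip p. s \<subseteq> rB}" "loops (flip p) q = card {s \<in> q. s \<subseteq> rT}"
    using loops_le_left loops_le_right lo unfolding card_isolated_flip nt_def by linarith+
  note ex = extremal_loops[OF pv lo']
  have tops: "{s \<in> p. s \<subseteq> rT} = {s \<in> q. s \<subseteq> rT}"
    using ex(1) unfolding isolated_flip by (simp add: image_image)
  have "p \<subseteq> q"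
  proof
    fix u assume u: "u \<in> p"
    show "u \<in> q"
    proof (cases "propagating u")
      case False
      have bots: "{s \<in> p. s \<subseteq> rB} = {s \<in> q. s \<subseteq> rB}" using C_isolated[OF pC] C_isolated[OF qC] by simp
      have "u \<subseteq> rT \<or> u \<subseteq> rB" by (rule nonprop_cases[OF C_diagram[OF pC] u False])
      then have "u \<in> {s \<in> p. s \<subseteq> rT} \<or> u \<in> {s \<in> p. s \<subseteq> rB}" using u by simp
      then show ?thesis unfolding tops bots by blast
    next
      case True
      let ?s = "flip_vertex ` u"
      have s: "?s \<in> flip p" "propagating ?s" using u True by (auto simp: flip_def propagating_flip)
      obtain t where t: "t \<in> q" "propagating t" "t \<inter> rT = flip_vertex ` (?s \<inter> rB)" "(?s \<inter> rT) \<union> (t \<inter> rB) \<in> a"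
        using ex(2)[OF s] unfolding D by blast
      obtain c where c: "c \<in> I" "u \<inter> rB = Bot ` B c" using C_slot[OF pC u True] by blast
      have tT: "t \<inter> rT = u \<inter> rT" unfolding t(3) flip_part_Int by simp
      have sT: "?s \<inter> rT = Top ` B c" unfolding flip_part_Int c(2) by (simp add: image_image)
      have "t \<inter> rB \<noteq> {}" "Top ` B c \<noteq> {}" using t(2) B_ne[OF c(1)] by (auto simp: propagating_def)
      moreover have Int: "(Top ` B c \<union> (t \<inter> rB)) \<inter> rT = Top ` B c" "(Top ` B c \<union> (t \<inter> rB)) \<inter> rB = t \<inter> rB"
        by auto
      ultimately have "propagating (Top ` B c \<union> (t \<inter> rB))" unfolding propagating_def by simp
      then have "Top ` B c \<union> (t \<inter> rB) \<in> {s \<in> a. propagating s}" using t(4) unfolding sT by simp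
      \<comment> \<open>This part of the product is a strand of \<open>a\<close>, which has the same
        block in both rows.\<close>
      then obtain d where d: "d \<in> I" "Top ` B c \<union> (t \<inter> rB) = strand l m d" unfolding prop_a by (rule imageE)
      have "Top ` B c = Top ` B d"
        using arg_cong[OF d(2), of "\<lambda>s. s \<inter> rT"] unfolding strand_Int Int .
      then have "B c = B d" by (rule iffD1[OF inj_image_eq_iff, rotated]) (simp add: inj_def)
      then have "c = d" by (rule B_inj[OF c(1) d(1)])
      moreover have "t \<inter> rB = Bot ` B d"
        using arg_cong[OF d(2), of "\<lambda>s. s \<inter> rB"] unfolding strand_Int Int .
      ultimately have tB: "t \<inter> rB = u \<inter> rB" using c(2) by simp
      have "t \<subseteq> rT \<union> rB" "u \<subseteq> rT \<union> rB"
        using diagram_sub[OF C_diagram[OF qC] t(1)] diagram_sub[OF C_diagram[OF pC] u] by auto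
      then have "t = u" using tT tB by blast
      then show ?thesis using t(1) by simp
    qed
  qed
  then show ?thesis by (rule diagram_subset_eq[OF C_diagram[OF pC] C_diagram[OF qC]])
qed

end

section \<open>Factoring a diagram through \<open>a\<^sup>m\<close>\<close>

text \<open>No chain can pass through more than one upper part, because a lower part meets the
  middle row inside a single one. So the components are the upper parts with lower parts hung onto
  them.\<close>

lemma (in two_parts) coarse_glue:
  assumes c: "\<And>t. t \<in> Q \<Longrightarrow> meets t Y \<Longrightarrow> \<exists>s\<in>P. t \<inter> Y \<subseteq> s"
  shows "G = (\<lambda>s. s \<union> \<Union>{t \<in> Q. t \<inter> s \<noteq> {}}) ` P \<union> {t \<in> Q. \<not> meets t Y}"
proof (rule conn_eqI)
  interpret S: two_parts Z Y X Q P by (rule swap)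
  have Q_Y: "x \<in> Y" if "x \<in> s" "x \<in> t" "s \<in> P" "t \<in> Q" for x s t
    using that P_sub S.P_sub XZ by blast
  have bot: "t \<in> G" if "t \<in> Q" "\<not> meets t Y" for t
    using S.X_isolated[OF that] by (simp add: Un_commute)
  have "s \<union> \<Union>{t \<in> Q. t \<inter> s \<noteq> {}} \<in> G" (is "?U \<in> G") if s: "s \<in> P" for s
  proof (rule conn_partI)
    show "?U \<noteq> {}" using P_ne[OF s] by blast
    show "?U \<subseteq> \<Union>(P \<union> Q)" using s by blast
    fix s' assume s': "s' \<in> P \<union> Q" "s' \<inter> ?U \<noteq> {}"
    \<comment> \<open>A lower part that touches both \<open>s\<close> and \<open>s'\<close> does so
      in the middle row, where it lies inside one upper part.\<close>
    have tin: "s' = s" if P': "s' \<in> P" and t: "t \<in> Q" "t \<inter> s \<noteq> {}" "s' \<inter> t \<noteq> {}" for t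
    proof -
      obtain x where x: "x \<in> t" "x \<in> s" using t(2) by blast
      obtain y where y: "y \<in> t" "y \<in> s'" using t(3) by blast
      have xY: "x \<in> Y" by (rule Q_Y[OF x(2,1) s t(1)])
      have yY: "y \<in> Y" by (rule Q_Y[OF y(2,1) P' t(1)])
      obtain u where u: "u \<in> P" "t \<inter> Y \<subseteq> u" using c[OF t(1)] x xY unfolding meets_def by blast
      have "u = s" using P_disj[OF u(1) s, of x] u(2) x xY by blast
      moreover have "u = s'" using P_disj[OF u(1) P', of y] u(2) y yY by blast
      ultimately show ?thesis by simp
    qed
    show "s' \<subseteq> ?U"
    proof (cases "s' \<in> P")
      case True
      then have "s' = s" using s' tin[OF True] P_disj[OF True s] by blast
      then show ?thesis by blast
    next
      case False
      then have Q': "s' \<in> Q" using s'(1) by blast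
      show ?thesis
      proof (cases "s' \<inter> s = {}")
        case True
        then obtain t where "t \<in> Q" "t \<inter> s \<noteq> {}" "s' \<inter> t \<noteq> {}" using s'(2) by blast
        then have "s' = t" using S.P_disj[OF Q', of t] by blast
        then show ?thesis using True \<open>t \<inter> s \<noteq> {}\<close> by blast
      next
        case False then show ?thesis using Q' by blast
      qed
    qed
  next
    fix g assume g: "g \<in> G" "g \<inter> ?U \<noteq> {}"
    have absorb: "t \<subseteq> g" if "t \<in> P \<union> Q" "t \<inter> g \<noteq> {}" for t by (rule conn_absorb[OF that(1) g(1) that(2)])
    have "s \<subseteq> g"
    proof (cases "s \<inter> g = {}")
      case True
      then obtain t where t: "t \<in> Q" "t \<inter> s \<noteq> {}" "t \<inter> g \<noteq> {}" using g(2) by blast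
      then have "t \<subseteq> g" using absorb by blast
      then show ?thesis using absorb[of s] s t(2) by blast
    next
      case False then show ?thesis using absorb[of s] s by blast
    qed
    moreover have "t \<subseteq> g" if "t \<in> Q" "t \<inter> s \<noteq> {}" for t
      using absorb[of t] that \<open>s \<subseteq> g\<close> by blast
    ultimately show "?U \<subseteq> g" by blast
  qed
  then show "(\<lambda>s. s \<union> \<Union>{t \<in> Q. t \<inter> s \<noteq> {}}) ` P \<union> {t \<in> Q. \<not> meets t Y} \<subseteq> G" using bot by blast
  show "\<Union>(P \<union> Q) \<subseteq> \<Union>((\<lambda>s. s \<union> \<Union>{t \<in> Q. t \<inter> s \<noteq> {}}) ` P \<union> {t \<in> Q. \<not> meets t Y})"
  proof
    fix x assume "x \<in> \<Union>(P \<union> Q)"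
    then consider s where "s \<in> P" "x \<in> s" | t where "t \<in> Q" "x \<in> t" by blast
    then show "x \<in> \<Union>((\<lambda>s. s \<union> \<Union>{t \<in> Q. t \<inter> s \<noteq> {}}) ` P \<union> {t \<in> Q. \<not> meets t Y})"
    proof cases
      case 1 then show ?thesis by blast
    next
      case 2
      show ?thesis
      proof (cases "meets t Y")
        case True
        then obtain s where "s \<in> P" "t \<inter> Y \<subseteq> s" using c[OF 2(1)] by blast
        then have "s \<in> P" "t \<inter> s \<noteq> {}" using True unfolding meets_def by blast+
        then show ?thesis using 2 by blast
      next
        case False then show ?thesis using 2 by blast
      qed
    qed
  qed
qed

lemma nonprop_count: "p \<in> diagrams k k' \<Longrightarrow> s \<in> p \<Longrightarrow> \<not> propagating s \<Longrightarrow> ntop s = 0 \<or> nbot s = 0"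
proof -
  assume "p \<in> diagrams k k'" "s \<in> p" "\<not> propagating s"
  then have "s \<inter> rT = {} \<or> s \<inter> rB = {}" by (auto simp: propagating_def)
  then show ?thesis unfolding ntop_def nbot_def by auto
qed

lemma sub_right_iff: "A \<inter> B = {} \<Longrightarrow> t \<subseteq> A \<union> B \<Longrightarrow> t \<inter> A = {} \<longleftrightarrow> t \<subseteq> B"
  by blast

lemma not_sub_right: "A \<inter> B = {} \<Longrightarrow> t \<subseteq> A \<Longrightarrow> t \<noteq> {} \<Longrightarrow> \<not> t \<subseteq> B"
  by blast

lemma meet_iff: "X \<inter> A = {} \<Longrightarrow> X \<inter> ((s \<inter> A) \<union> f ` E) \<noteq> {} \<longleftrightarrow> (\<exists>y\<in>E. f y \<in> X)"
  by blast

lemma glued_minus: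
  fixes r :: "'c set set"
  assumes "A \<inter> M = {}" "f ` E \<subseteq> M"
  shows "((s \<inter> A) \<union> f ` E \<union> \<Union>{t \<in> (`) g ` r. Q t}) - M = (s \<inter> A) \<union> (\<Union>t\<in>{t \<in> r. Q (g ` t)}. g ` t - M)"
proof -
  have "\<Union>{t \<in> (`) g ` r. Q t} = (\<Union>t\<in>{t \<in> r. Q (g ` t)}. g ` t)" by blast
  moreover have "(\<Union>t\<in>K. h t) - M = (\<Union>t\<in>K. h t - M)" for K and h :: "'c set \<Rightarrow> _" by blast
  moreover have "s \<inter> A - M = s \<inter> A" "f ` E - M = {}" using assms by blast+
  ultimately show ?thesis by (simp only: Un_Diff Un_empty_right)
qed

lemma rep_le: "i \<ge> 1 \<Longrightarrow> rep l i \<le> i"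
  by (auto simp: rep_def intro: dvd_imp_le)

text \<open>A propagating part of residue \<open>i\<close> has at least \<open>rep l i\<close> top
  vertices, with an excess divisible by \<open>l\<close>, and any other part has a multiple of
  \<open>l\<close> of them. Summing over all parts gives \<open>n\<close>.\<close>

lemma prop_vec_index:
  assumes l: "l \<ge> 1" and q: "q \<in> tonal l n"
  shows "prop_vec l q \<in> index_set l n"
proof -
  let ?Pr = "{s \<in> q. propagating s}" and ?N = "{s \<in> q. \<not> propagating s}"
  note dg = tonal_diagram[OF q]
  have fin: "finite q" by (rule finite_diagram[OF dg])
  have n: "n = (\<Sum>s\<in>q. ntop s)"
  proof -
    have "\<Union>q = Top ` {1..n} \<union> Bot ` {1..n}" using dg by (auto simp: diagrams_def partition_on_def)
    then have "\<Union>q \<inter> rT = Top ` {1..n}" by auto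
    moreover have "(\<Union>s\<in>q. s \<inter> A) = \<Union>q \<inter> A" for A by blast
    ultimately have "Top ` {1..n} = (\<Union>s\<in>q. s \<inter> rT)" by simp
    then have "n = card (\<Union>s\<in>q. s \<inter> rT)" using card_image[of Top "{1..n}"] by (simp add: inj_on_def)
    also have "\<dots> = (\<Sum>s\<in>q. card (s \<inter> rT))"
    proof (rule card_UN_disjoint[OF fin])
      show "\<forall>s\<in>q. finite (s \<inter> rT)" using finite_part[OF dg] by simp
      show "\<forall>s\<in>q. \<forall>t\<in>q. s \<noteq> t \<longrightarrow> s \<inter> rT \<inter> (t \<inter> rT) = {}"
      proof (intro ballI impI)
        fix s t assume st: "s \<in> q" "t \<in> q" "s \<noteq> t"
        then have "s \<inter> t = {}" using diagram_disj[OF dg st(1,2)] by blast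
        then show "s \<inter> rT \<inter> (t \<inter> rT) = {}" by blast
      qed
    qed
    finally show ?thesis by (simp add: ntop_def)
  qed
  have rank: "rank_sum l (prop_vec l q) = (\<Sum>s\<in>?Pr. rep l (ntop s))"
  proof -
    have "(\<Sum>s\<in>?Pr. rep l (ntop s)) = (\<Sum>i\<in>{1..l}. \<Sum>s\<in>{s \<in> ?Pr. rep l (ntop s) = i}. rep l (ntop s))"
      by (rule sum.group[symmetric]) (use fin rep(1)[OF l] in auto)
    also have "\<dots> = (\<Sum>i\<in>{1..l}. i * prop_vec l q i)"
    proof (rule sum.cong[OF refl])
      fix i assume i: "i \<in> {1..l}"
      have "rep l k = i \<longleftrightarrow> k mod l = i mod l" for k
        using rep_unique[OF i, of k] rep(2)[of l k] by auto
      then have e: "{s \<in> ?Pr. rep l (ntop s) = i} = {s \<in> q. propagating s \<and> ntop s mod l = i mod l}" by blast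
      have "(\<Sum>s\<in>{s \<in> ?Pr. rep l (ntop s) = i}. rep l (ntop s)) = (\<Sum>s\<in>{s \<in> ?Pr. rep l (ntop s) = i}. i)"
        by (rule sum.cong) auto
      also have "\<dots> = i * card {s \<in> ?Pr. rep l (ntop s) = i}" by simp
      finally show "(\<Sum>s\<in>{s \<in> ?Pr. rep l (ntop s) = i}. rep l (ntop s)) = i * prop_vec l q i"
        using i unfolding e by (simp add: prop_vec_def)
    qed
    finally show ?thesis by (simp add: rank_sum_def)
  qed
  have le: "rep l (ntop s) \<le> ntop s" if "s \<in> ?Pr" for s
  proof (rule rep_le)
    have "s \<inter> rT \<noteq> {}" "finite (s \<inter> rT)" using that finite_part[OF dg] by (auto simp: propagating_def)
    then show "1 \<le> ntop s" unfolding ntop_def by (simp add: Suc_le_eq card_gt_0_iff)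
  qed
  have "n = (\<Sum>s\<in>?Pr. ntop s) + (\<Sum>s\<in>?N. ntop s)"
    unfolding n by (subst sum.union_disjoint[symmetric]) (use fin in \<open>auto intro: sum.cong\<close>)
  also have "(\<Sum>s\<in>?Pr. ntop s) = (\<Sum>s\<in>?Pr. rep l (ntop s)) + (\<Sum>s\<in>?Pr. ntop s - rep l (ntop s))"
    by (subst sum.distrib[symmetric], rule sum.cong) (use le in auto)
  finally have nr: "n = rank_sum l (prop_vec l q) + ((\<Sum>s\<in>?Pr. ntop s - rep l (ntop s)) + (\<Sum>s\<in>?N. ntop s))"
    unfolding rank by simp
  \<comment> \<open>Subtraction is truncated: if \<open>rep l (ntop s)\<close> exceeds
    \<open>ntop s\<close>, the difference is 0.\<close>
  have "l dvd ntop s - rep l (ntop s)" for s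
    by (metis mod_eq_dvd_iff_nat mod_eq_0_iff_dvd rep(2) diff_is_0_eq' dvd_0_right nle_le)
  moreover have "l dvd ntop s" if "s \<in> ?N" for s
  proof -
    have "ntop s mod l = nbot s mod l" using that q unfolding tonal_def by blast
    moreover have "ntop s = 0 \<or> nbot s = 0" using nonprop_count[OF dg, of s] that by simp
    ultimately show ?thesis by auto
  qed
  ultimately have "l dvd (\<Sum>s\<in>?Pr. ntop s - rep l (ntop s)) + (\<Sum>s\<in>?N. ntop s)"
    by (intro dvd_add dvd_sum) auto
  moreover have "prop_vec l q i = 0" if "i \<notin> {1..l}" for i using that unfolding prop_vec_def by argo
  ultimately show ?thesis using nr unfolding index_set_def by auto
qed

context cell
begin

section \<open>Diagrams that hook the top row of q onto the slots of a^m\<close>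

definition W :: "nat set" where "W = {1..n} - (\<Union>c\<in>I. B c)"

text \<open>All vertices of \<open>W\<close> will be attached to a single part, which stays tonal
  because their number is divisible by \<open>l\<close>.\<close>

lemma dvd_card_W: "l dvd card W"
proof -
  have "card (\<Union>c\<in>I. B c) = (\<Sum>c\<in>I. card (B c))"
  proof (rule card_UN_disjoint[OF finite_I])
    have "finite (B c)" for c by (cases c) (simp add: blk_def)
    then show "\<forall>c\<in>I. finite (B c)" by blast
    show "\<forall>c\<in>I. \<forall>d\<in>I. c \<noteq> d \<longrightarrow> B c \<inter> B d = {}" using B_disj by blast
  qed
  also have "\<dots> = (\<Sum>c\<in>I. fst c)" by (simp add: card_blk)
  also have "\<dots> = (\<Sum>i\<in>{1..l}. \<Sum>j\<in>{1..m i}. i)"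
    unfolding slots_def by (subst sum.Sigma) (auto intro!: sum.cong)
  also have "\<dots> = rank_sum l m" by (simp add: rank_sum_def mult.commute)
  finally have U: "card (\<Union>c\<in>I. B c) = rank_sum l m" .
  have "(\<Union>c\<in>I. B c) \<subseteq> {1..n}" using B_sub by blast
  then have "card W = n - rank_sum l m" unfolding W_def using U
    by (subst card_Diff_subset) (auto intro: finite_subset)
  then show ?thesis using m by (simp add: index_set_def)
qed

text \<open>The parts of \<open>q\<close> meeting the top row, with their lower halves replaced: the propagating ones
  are attached to the slots of \<open>a\<^sup>m\<close> through \<open>\<beta>\<close>, and all bottom vertices outside the slots are
  attached to \<open>s0\<close>, so that no loops arise in a product with \<open>a\<^sup>m\<close>.\<close>

definition attach :: "(vertex set \<Rightarrow> nat \<times> nat) \<Rightarrow> vertex set \<Rightarrow> vertex set \<Rightarrow> nat set" where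
  "attach \<beta> s0 s = (if propagating s then B (\<beta> s) else {}) \<union> (if s = s0 then W else {})"

definition hook :: "diagram \<Rightarrow> (vertex set \<Rightarrow> nat \<times> nat) \<Rightarrow> vertex set \<Rightarrow> diagram" where
  "hook q \<beta> s0 = (\<lambda>s. (s \<inter> rT) \<union> Bot ` attach \<beta> s0 s) ` {s \<in> q. s \<inter> rT \<noteq> {}}"

lemma hook_part_Int:
  "((s \<inter> rT) \<union> Bot ` A) \<inter> rT = s \<inter> rT" "((s \<inter> rT) \<union> Bot ` A) \<inter> rB = Bot ` A"
  by auto

context
  fixes q :: diagram and \<beta> :: "vertex set \<Rightarrow> nat \<times> nat" and s0 :: "vertex set"
  assumes q: "q \<in> tonal l n" and s0: "s0 \<in> q" "s0 \<inter> rT \<noteq> {}"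
    and \<beta>: "bij_betw \<beta> {s \<in> q. propagating s} I"
    and \<beta>_tone: "\<And>s. s \<in> q \<Longrightarrow> propagating s \<Longrightarrow> fst (\<beta> s) mod l = ntop s mod l"
begin

lemma \<beta>_I: "s \<in> q \<Longrightarrow> propagating s \<Longrightarrow> \<beta> s \<in> I"
  using \<beta> by (auto simp: bij_betw_def)

lemma \<beta>_inj: "s \<in> q \<Longrightarrow> propagating s \<Longrightarrow> t \<in> q \<Longrightarrow> propagating t \<Longrightarrow> \<beta> s = \<beta> t \<Longrightarrow> s = t"
  using \<beta> by (auto simp: bij_betw_def inj_on_def)

lemma \<beta>_surj: "c \<in> I \<Longrightarrow> \<exists>s\<in>q. propagating s \<and> \<beta> s = c"
proof -
  assume "c \<in> I"
  then have "c \<in> \<beta> ` {s \<in> q. propagating s}" using \<beta> by (simp add: bij_betw_def)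
  then show ?thesis by blast
qed

lemma attach_disj:
  assumes "s \<in> q" "t \<in> q" "x \<in> attach \<beta> s0 s" "x \<in> attach \<beta> s0 t"
  shows "s = t"
proof -
  have W: "x \<notin> W" if "x \<in> B c" "c \<in> I" for c using that by (auto simp: W_def)
  consider "propagating s" "x \<in> B (\<beta> s)" | "s = s0" "x \<in> W"
    using assms(3) by (auto simp: attach_def split: if_splits)
  then show ?thesis
  proof cases
    case 1
    then have "x \<notin> W" using W \<beta>_I[OF assms(1)] by blast
    then have t: "propagating t" "x \<in> B (\<beta> t)" using assms(4) by (auto simp: attach_def split: if_splits)
    then have "\<beta> s = \<beta> t" using B_disj[OF \<beta>_I[OF assms(1) 1(1)] \<beta>_I[OF assms(2) t(1)]] 1(2) by blast
    then show ?thesis using \<beta>_inj[OF assms(1) 1(1) assms(2) t(1)] by blast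
  next
    case 2
    then have "\<not> (propagating t \<and> x \<in> B (\<beta> t))" using W \<beta>_I[OF assms(2)] by blast
    then show ?thesis using assms(4) 2 by (auto simp: attach_def split: if_splits)
  qed
qed

lemma attach_cover: "x \<in> {1..n} \<Longrightarrow> \<exists>s\<in>q. s \<inter> rT \<noteq> {} \<and> x \<in> attach \<beta> s0 s"
proof (cases "x \<in> W")
  case True then show ?thesis using s0 by (auto simp: attach_def intro!: bexI[of _ s0])
next
  case False
  assume "x \<in> {1..n}"
  then obtain c where c: "c \<in> I" "x \<in> B c" using False by (auto simp: W_def)
  then obtain s where "s \<in> q" "propagating s" "\<beta> s = c" using \<beta>_surj by blast
  then show ?thesis using c by (auto simp: attach_def propagating_def intro!: bexI[of _ s])
qed

lemma attach_sub: "s \<in> q \<Longrightarrow> attach \<beta> s0 s \<subseteq> {1..n}"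
proof -
  assume s: "s \<in> q"
  have "B (\<beta> s) \<subseteq> {1..n}" if "propagating s" by (rule B_sub[OF \<beta>_I[OF s that]])
  moreover have "W \<subseteq> {1..n}" by (simp add: W_def)
  ultimately show ?thesis unfolding attach_def by (cases "propagating s") auto
qed

text \<open>The block attached to a propagating part has the residue of its top row, an isolated top
  part has residue 0, and \<open>W\<close> contributes a multiple of \<open>l\<close>.\<close>

lemma hook_tonal: "hook q \<beta> s0 \<in> tonal l n"
proof -
  note dg = tonal_diagram[OF q]
  have "hook q \<beta> s0 \<in> diagrams n n"
    unfolding diagrams_def
  proof (intro CollectI partition_onI)
    show "{} \<notin> hook q \<beta> s0" by (auto simp: hook_def)
    show "\<Union>(hook q \<beta> s0) = Top ` {1..n} \<union> Bot ` {1..n}"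
    proof
      have "(s \<inter> rT) \<union> Bot ` attach \<beta> s0 s \<subseteq> Top ` {1..n} \<union> Bot ` {1..n}" if "s \<in> q" for s
        using attach_sub[OF that] diagram_sub[OF dg that] by blast
      then show "\<Union>(hook q \<beta> s0) \<subseteq> Top ` {1..n} \<union> Bot ` {1..n}" unfolding hook_def by blast
      show "Top ` {1..n} \<union> Bot ` {1..n} \<subseteq> \<Union>(hook q \<beta> s0)"
      proof
        fix v assume "v \<in> Top ` {1..n} \<union> Bot ` {1..n}"
        then consider "v \<in> Top ` {1..n}" | x where "x \<in> {1..n}" "v = Bot x" by blast
        then show "v \<in> \<Union>(hook q \<beta> s0)"
        proof cases
          case 1
          then obtain s where "s \<in> q" "v \<in> s" using diagram_cover[OF dg, of v] by blast
          then show ?thesis using 1 unfolding hook_def by blast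
        next
          case 2
          then show ?thesis using attach_cover[of x] unfolding hook_def by blast
        qed
      qed
    qed
    fix u v assume u: "u \<in> hook q \<beta> s0" and v: "v \<in> hook q \<beta> s0" and ne: "u \<noteq> v"
    obtain s where s: "s \<in> q" "u = (s \<inter> rT) \<union> Bot ` attach \<beta> s0 s" using u by (auto simp: hook_def)
    obtain t where t: "t \<in> q" "v = (t \<inter> rT) \<union> Bot ` attach \<beta> s0 t" using v by (auto simp: hook_def)
    have "s \<noteq> t" using ne s t by blast
    then have "s \<inter> t = {}" "attach \<beta> s0 s \<inter> attach \<beta> s0 t = {}"
      using diagram_disj[OF dg s(1) t(1)] attach_disj[OF s(1) t(1)] by blast+
    then show "disjnt u v" unfolding disjnt_def s(2) t(2) by auto
  qed
  moreover have "ntop u mod l = nbot u mod l" if u: "u \<in> hook q \<beta> s0" for u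
  proof -
    obtain s where s: "s \<in> q" "u = (s \<inter> rT) \<union> Bot ` attach \<beta> s0 s" using u by (auto simp: hook_def)
    have nt: "ntop u = ntop s" unfolding s(2) ntop_def hook_part_Int ..
    have nb: "nbot u = card (attach \<beta> s0 s)" unfolding s(2) nbot_def hook_part_Int
      by (rule card_image) (simp add: inj_on_def)
    define A where "A = (if propagating s then B (\<beta> s) else {})"
    define A' where "A' = (if s = s0 then W else {})"
    have "A \<inter> A' = {}" using \<beta>_I[OF s(1)] by (auto simp: A_def A'_def W_def)
    moreover have "finite A" "finite A'"
      using finite_subset[OF attach_sub[OF s(1)]] by (auto simp: attach_def A_def A'_def)
    ultimately have "card (attach \<beta> s0 s) = card A + card A'"
      unfolding attach_def A_def[symmetric] A'_def[symmetric] by (rule card_Un_disjoint[rotated 2])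
    moreover have "l dvd card A'" using dvd_card_W by (simp add: A'_def)
    moreover have "card A mod l = ntop s mod l"
    proof (cases "propagating s")
      case True then show ?thesis using \<beta>_tone[OF s(1) True] by (simp add: A_def card_blk)
    next
      case False
      then have "ntop s = 0 \<or> nbot s = 0" by (rule nonprop_count[OF dg s(1)])
      then show ?thesis using False q s(1) by (auto simp: A_def tonal_def)
    qed
    ultimately show ?thesis unfolding nt nb by (metis dvd_imp_mod_0 mod_add_right_eq add_0_right)
  qed
  ultimately show ?thesis by (simp add: tonal_def)
qed

text \<open>The lower factor is only assumed to have a strand through each block, with arbitrary
  lower end \<open>z c\<close>, because the lemma is applied both to \<open>a\<close> and to a
  reflected product. Each part of \<open>r\<close> meets the middle row inside one set
  \<open>attach \<beta> s0 s\<close>, so \<open>coarse_glue\<close> gives the components. Each of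
  them contains a top vertex or is a bottom part of \<open>r\<close>, so no loop arises.\<close>

lemma hook_dcomp:
  assumes r: "r \<in> diagrams n n"
    and z: "\<And>c. c \<in> I \<Longrightarrow> Top ` B c \<union> z c \<in> r" "\<And>c. c \<in> I \<Longrightarrow> z c \<subseteq> rB"
    and r_cases: "\<And>t. t \<in> r \<Longrightarrow> (\<exists>c\<in>I. t = Top ` B c \<union> z c) \<or> t \<subseteq> rT \<or> t \<subseteq> rB"
  shows "loops (hook q \<beta> s0) r = 0"
    and "dcomp (hook q \<beta> s0) r
      = (\<lambda>s. (s \<inter> rT) \<union> (if propagating s then z (\<beta> s) else {})) ` {s \<in> q. s \<inter> rT \<noteq> {}} \<union> {t \<in> r. t \<subseteq> rB}"
proof -
  let ?x = "hook q \<beta> s0"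
  note dx = tonal_diagram[OF hook_tonal]
  interpret composable n n n ?x r using dx r by unfold_locales
  let ?part = "\<lambda>s. (s \<inter> rT) \<union> Bot ` attach \<beta> s0 s"
  let ?up = "\<lambda>s. (s \<inter> rT) \<union> Mid ` attach \<beta> s0 s"
  have up: "bot_to_mid ` ?part s = ?up s" for s
  proof -
    have "?part s \<subseteq> rT \<union> rB" by blast
    from bot_to_mid_image[OF this] show ?thesis unfolding hook_part_Int by (simp add: image_image)
  qed
  have upper_x: "upper ?x = ?up ` {s \<in> q. s \<inter> rT \<noteq> {}}"
    unfolding upper_def hook_def image_image up ..
  have top_part: "\<exists>s\<in>q. s \<inter> rT \<noteq> {} \<and> {y. Top y \<in> t} \<subseteq> attach \<beta> s0 s" if t: "t \<in> r" for t
  proof (cases "\<exists>c\<in>I. t = Top ` B c \<union> z c")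
    case True
    then obtain c where c: "c \<in> I" "t = Top ` B c \<union> z c" by blast
    obtain s where s: "s \<in> q" "propagating s" "\<beta> s = c" using \<beta>_surj[OF c(1)] by blast
    have "{y. Top y \<in> t} = B c" using z(2)[OF c(1)] unfolding c(2) by auto
    moreover have "B c \<subseteq> attach \<beta> s0 s" using s by (auto simp: attach_def)
    moreover have "s \<inter> rT \<noteq> {}" using s(2) by (simp add: propagating_def)
    ultimately show ?thesis using s(1) by blast
  next
    case False
    \<comment> \<open>A part of \<open>r\<close> that is no strand meets the top row outside the
      blocks, and all these vertices are attached to \<open>s0\<close>.\<close>
    have "{y. Top y \<in> t} \<subseteq> W"
    proof
      fix y assume "y \<in> {y. Top y \<in> t}"
      then have y: "Top y \<in> t" by simp
      have "y \<notin> B c" if "c \<in> I" for c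
        using diagram_disj[OF r t z(1)[OF that] y] False that by blast
      moreover have "y \<in> {1..n}" using diagram_sub[OF r t] y by auto
      ultimately show "y \<in> W" by (auto simp: W_def)
    qed
    then show ?thesis using s0 by (intro bexI[of _ s0]) (auto simp: attach_def)
  qed
  have low_Mid: "Mid y \<in> top_to_mid ` t \<longleftrightarrow> Top y \<in> t" if "t \<in> r" for t y
  proof -
    have "Mid y \<in> top_to_mid ` t \<longleftrightarrow> (\<exists>v\<in>t. top_to_mid v = Mid y)"
      by (simp add: image_iff eq_commute)
    also have "\<dots> \<longleftrightarrow> Top y \<in> t"
    proof
      assume "\<exists>v\<in>t. top_to_mid v = Mid y"
      then obtain v where v: "v \<in> t" "top_to_mid v = Mid y" by blast
      have "v \<notin> rM" using diagram_sub[OF r that] v(1) by auto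
      then show "Top y \<in> t" using v by (cases v) auto
    qed force
    finally show ?thesis .
  qed
  have G: "G = (\<lambda>s. s \<union> \<Union>{t \<in> lower r. t \<inter> s \<noteq> {}}) ` upper ?x \<union> {t \<in> lower r. \<not> meets t (Mid ` {1..n})}"
  proof (rule coarse_glue)
    fix t assume "t \<in> lower r" "meets t (Mid ` {1..n})"
    then obtain t' where t': "t' \<in> r" "t = top_to_mid ` t'" by (auto simp: lower_def)
    obtain s where s: "s \<in> q" "s \<inter> rT \<noteq> {}" "{y. Top y \<in> t'} \<subseteq> attach \<beta> s0 s" using top_part[OF t'(1)] by blast
    have "t \<inter> Mid ` {1..n} \<subseteq> ?up s"
    proof
      fix v assume "v \<in> t \<inter> Mid ` {1..n}"
      then have "v \<in> top_to_mid ` t'" "v \<in> Mid ` {1..n}" unfolding t'(2) by simp_all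
      then obtain y where y: "v = Mid y" "Mid y \<in> top_to_mid ` t'" by (metis imageE)
      then have "y \<in> attach \<beta> s0 s" using s(3) low_Mid[OF t'(1)] by blast
      then show "v \<in> ?up s" unfolding y(1) by blast
    qed
    moreover have "?up s \<in> upper ?x" unfolding upper_x using s by blast
    ultimately show "\<exists>s\<in>upper ?x. t \<inter> Mid ` {1..n} \<subseteq> s" by blast
  qed
  have bot: "{t \<in> lower r. \<not> meets t (Mid ` {1..n})} = {t \<in> r. t \<subseteq> rB}"
  proof -
    have e: "top_to_mid ` t = t" if "t \<in> r" "t \<subseteq> rB" for t
      using top_to_mid_image[of t] that vertex_disjoint by (simp add: Int_absorb2 le_supI2 Int_commute[of t rT]) auto
    have c: "\<not> meets (top_to_mid ` t) (Mid ` {1..n}) \<longleftrightarrow> t \<subseteq> rB" if "t \<in> r" for t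
    proof -
      have "t \<subseteq> rT \<union> rB" using diagram_sub[OF r that] by blast
      then have "t \<inter> rT = {} \<longleftrightarrow> t \<subseteq> rB" by (rule sub_right_iff[OF vertex_disjoint(2)])
      then show ?thesis using lower_parts(6)[OF diagram_sub[OF r that]] by blast
    qed
    have "{t \<in> lower r. \<not> meets t (Mid ` {1..n})} = (`) top_to_mid ` {t \<in> r. t \<subseteq> rB}"
      unfolding lower_def using c by blast
    also have "\<dots> = (\<lambda>t. t) ` {t \<in> r. t \<subseteq> rB}" by (rule image_cong[OF refl]) (use e in blast)
    finally show ?thesis by simp
  qed
  have glued: "(?up s \<union> \<Union>{t \<in> lower r. t \<inter> ?up s \<noteq> {}}) - rM
      = (s \<inter> rT) \<union> (if propagating s then z (\<beta> s) else {})" if s: "s \<in> q" for s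
  proof -
    have meet: "top_to_mid ` t \<inter> ?up s \<noteq> {} \<longleftrightarrow> (\<exists>y\<in>attach \<beta> s0 s. Top y \<in> t)" if t: "t \<in> r" for t
    proof -
      have "top_to_mid ` t \<inter> rT = {}" using diagram_sub[OF r t] by auto
      then have "top_to_mid ` t \<inter> ?up s \<noteq> {} \<longleftrightarrow> (\<exists>y\<in>attach \<beta> s0 s. Mid y \<in> top_to_mid ` t)"
        by (rule meet_iff)
      then show ?thesis by (simp only: low_Mid[OF t])
    qed
    have outer: "top_to_mid ` t - rM = t \<inter> rB" if "t \<in> r" for t
    proof -
      have "t \<subseteq> rT \<union> rB" using diagram_sub[OF r that] by blast
      then show ?thesis using top_to_mid_image[of t] top_to_mid_rT[of t] vertex_disjoint by auto
    qed
    have "(?up s \<union> \<Union>{t \<in> lower r. t \<inter> ?up s \<noteq> {}}) - rM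
      = (s \<inter> rT) \<union> (\<Union>t\<in>{t \<in> r. top_to_mid ` t \<inter> ?up s \<noteq> {}}. top_to_mid ` t - rM)"
      unfolding lower_def by (rule glued_minus[OF vertex_disjoint(1)]) auto
    also have "{t \<in> r. top_to_mid ` t \<inter> ?up s \<noteq> {}} = {t \<in> r. \<exists>y\<in>attach \<beta> s0 s. Top y \<in> t}"
      by (rule Collect_cong) (simp only: meet cong: conj_cong)
    also have "(\<Union>t\<in>{t \<in> r. \<exists>y\<in>attach \<beta> s0 s. Top y \<in> t}. top_to_mid ` t - rM)
      = (\<Union>t\<in>{t \<in> r. \<exists>y\<in>attach \<beta> s0 s. Top y \<in> t}. t \<inter> rB)"
      by (rule SUP_cong[OF refl]) (simp only: outer mem_Collect_eq)
    also have "(\<Union>t\<in>{t \<in> r. \<exists>y\<in>attach \<beta> s0 s. Top y \<in> t}. t \<inter> rB) = (if propagating s then z (\<beta> s) else {})"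
      (is "?L = ?R")
    proof
      show "?L \<subseteq> ?R"
      proof
        fix v assume "v \<in> ?L"
        then obtain t y where t: "t \<in> r" "y \<in> attach \<beta> s0 s" "Top y \<in> t" "v \<in> t" "v \<in> rB" by blast
        have "\<not> t \<subseteq> rT" "\<not> t \<subseteq> rB" using t by auto
        then obtain c where c: "c \<in> I" "t = Top ` B c \<union> z c" using r_cases[OF t(1)] by blast
        then have y: "y \<in> B c" using t(3) z(2)[OF c(1)] by auto
        obtain s' where s': "s' \<in> q" "propagating s'" "\<beta> s' = c" using \<beta>_surj[OF c(1)] by blast
        have "y \<in> attach \<beta> s0 s'" using y s' by (auto simp: attach_def)
        then have "s = s'" using attach_disj[OF s s'(1) t(2)] by blast
        then show "v \<in> ?R" using s' c t(4,5) by auto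
      qed
      show "?R \<subseteq> ?L"
      proof (cases "propagating s")
        case True
        then have I: "\<beta> s \<in> I" by (rule \<beta>_I[OF s])
        obtain y where y: "y \<in> B (\<beta> s)" using B_ne[OF I] by blast
        have "y \<in> attach \<beta> s0 s" using y True by (simp add: attach_def)
        then have "Top ` B (\<beta> s) \<union> z (\<beta> s) \<in> {t \<in> r. \<exists>y\<in>attach \<beta> s0 s. Top y \<in> t}" using z(1)[OF I] y by blast
        moreover have "z (\<beta> s) \<subseteq> (Top ` B (\<beta> s) \<union> z (\<beta> s)) \<inter> rB" using z(2)[OF I] by blast
        ultimately show ?thesis using True by auto
      qed simp
    qed
    finally show ?thesis .
  qed
  have GG: "G = (\<lambda>s. ?up s \<union> \<Union>{t \<in> lower r. t \<inter> ?up s \<noteq> {}}) ` {s \<in> q. s \<inter> rT \<noteq> {}} \<union> {t \<in> r. t \<subseteq> rB}"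
  proof -
    have "(\<lambda>s. s \<union> \<Union>{t \<in> lower r. t \<inter> s \<noteq> {}}) ` upper ?x \<union> {t \<in> lower r. \<not> meets t (Mid ` {1..n})}
      = (\<lambda>s. ?up s \<union> \<Union>{t \<in> lower r. t \<inter> ?up s \<noteq> {}}) ` {s \<in> q. s \<inter> rT \<noteq> {}} \<union> {t \<in> r. t \<subseteq> rB}"
      unfolding bot upper_x image_image ..
    with G show ?thesis by (rule trans)
  qed
  have "\<not> g \<subseteq> rM" if gG: "g \<in> G" for g
  proof -
    consider s where "s \<in> q" "s \<inter> rT \<noteq> {}" "s \<inter> rT \<subseteq> g" | "g \<in> r" "g \<subseteq> rB" using gG unfolding GG by blast
    then show ?thesis
    proof cases
      case 1 then show ?thesis using vertex_disjoint by blast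
    next
      case 2 then show ?thesis using diagram_ne[OF r 2(1)] vertex_disjoint by blast
    qed
  qed
  then have none: "{t \<in> glue ?x r. t \<subseteq> rM} = {}" unfolding glue_G by blast
  show "loops ?x r = 0" unfolding loops_def none by simp
  have minus: "t - rM = t" if "t \<subseteq> rB" for t using that by auto
  have "(\<lambda>t. t - rM) ` G = (\<lambda>s. (s \<inter> rT) \<union> (if propagating s then z (\<beta> s) else {})) ` {s \<in> q. s \<inter> rT \<noteq> {}} \<union> {t \<in> r. t \<subseteq> rB}"
    unfolding GG image_Un image_image using glued minus by (intro arg_cong2[of _ _ _ _ "(\<union>)"]) (auto intro!: image_cong)
  moreover have "{} \<notin> (\<lambda>s. (s \<inter> rT) \<union> (if propagating s then z (\<beta> s) else {})) ` {s \<in> q. s \<inter> rT \<noteq> {}} \<union> {t \<in> r. t \<subseteq> rB}"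
    using diagram_ne[OF r] by auto
  ultimately show "dcomp ?x r
      = (\<lambda>s. (s \<inter> rT) \<union> (if propagating s then z (\<beta> s) else {})) ` {s \<in> q. s \<inter> rT \<noteq> {}} \<union> {t \<in> r. t \<subseteq> rB}"
    unfolding dcomp_def glue_G by simp
qed

end

end

section \<open>Loop-free factorisation of a tonal diagram\<close>

lemma slot_map_exists:
  assumes l: "l \<ge> 1" and q: "q \<in> tonal l n"
  shows "\<exists>\<beta>. bij_betw \<beta> {s \<in> q. propagating s} (slots l (prop_vec l q)) \<and>
    (\<forall>s. fst (\<beta> s) mod l = ntop s mod l)"
proof -
  let ?T = "\<lambda>i. {s \<in> q. propagating s \<and> ntop s mod l = i mod l}"
  have fin: "finite q" by (rule finite_diagram[OF tonal_diagram[OF q]])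
  \<comment> \<open>By definition of the propagating vector there are as many propagating parts of
    residue \<open>i\<close> as slots of size \<open>i\<close>.\<close>
  have ex: "\<exists>h. bij_betw h (?T i) {1..prop_vec l q i}" if "i \<in> {1..l}" for i
    by (rule finite_same_card_bij) (use fin that in \<open>simp_all add: prop_vec_def\<close>)
  have "\<exists>h. \<forall>i\<in>{1..l}. bij_betw (h i) (?T i) {1..prop_vec l q i}"
    by (rule bchoice, rule ballI, rule ex)
  then obtain h where h: "\<forall>i\<in>{1..l}. bij_betw (h i) (?T i) {1..prop_vec l q i}" by blast
  define \<beta> where "\<beta> s = (rep l (ntop s), h (rep l (ntop s)) s)" for s
  have T: "s \<in> ?T (rep l (ntop s))" if "s \<in> q" "propagating s" for s using that rep(2)[of l "ntop s"] by simp
  have "bij_betw \<beta> {s \<in> q. propagating s} (slots l (prop_vec l q))"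
    unfolding bij_betw_def
  proof
    show "inj_on \<beta> {s \<in> q. propagating s}"
    proof (rule inj_onI)
      fix s t assume st: "s \<in> {s \<in> q. propagating s}" "t \<in> {s \<in> q. propagating s}" "\<beta> s = \<beta> t"
      then have e: "rep l (ntop t) = rep l (ntop s)" "h (rep l (ntop s)) s = h (rep l (ntop s)) t"
        by (auto simp: \<beta>_def)
      have "inj_on (h (rep l (ntop s))) (?T (rep l (ntop s)))" using h rep(1)[OF l] by (auto simp: bij_betw_def)
      then show "s = t" using e T[of s] T[of t] st(1,2) unfolding e(1) by (auto dest: inj_onD)
    qed
    show "\<beta> ` {s \<in> q. propagating s} = slots l (prop_vec l q)"
    proof
      show "\<beta> ` {s \<in> q. propagating s} \<subseteq> slots l (prop_vec l q)"
      proof (rule image_subsetI)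
        fix s assume s: "s \<in> {s \<in> q. propagating s}"
        have r: "rep l (ntop s) \<in> {1..l}" by (rule rep(1)[OF l])
        then have "h (rep l (ntop s)) ` ?T (rep l (ntop s)) = {1..prop_vec l q (rep l (ntop s))}"
          using h by (simp add: bij_betw_def)
        then have "h (rep l (ntop s)) s \<in> {1..prop_vec l q (rep l (ntop s))}" using T[of s] s by blast
        then show "\<beta> s \<in> slots l (prop_vec l q)" using r by (simp add: slots_def \<beta>_def)
      qed
      show "slots l (prop_vec l q) \<subseteq> \<beta> ` {s \<in> q. propagating s}"
      proof
        fix c assume "c \<in> slots l (prop_vec l q)"
        then obtain i j where c: "c = (i, j)" "i \<in> {1..l}" "j \<in> {1..prop_vec l q i}" by (auto simp: slots_def)
        then have "j \<in> h i ` ?T i" using h by (simp add: bij_betw_def)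
        then obtain s where s: "s \<in> q" "propagating s" "ntop s mod l = i mod l" "j = h i s" by blast
        have "rep l (ntop s) = i" using rep_unique[OF c(2) s(3)[symmetric]] by simp
        then have "\<beta> s = c" using s(4) c(1) by (simp add: \<beta>_def)
        then show "c \<in> \<beta> ` {s \<in> q. propagating s}" using s by blast
      qed
    qed
  qed
  moreover have "fst (\<beta> s) mod l = ntop s mod l" for s by (simp add: \<beta>_def rep(2))
  ultimately show ?thesis by blast
qed

lemma top_part_exists:
  assumes "q \<in> tonal l n" "n \<ge> 1"
  obtains s0 where "s0 \<in> q" "s0 \<inter> rT \<noteq> {}"
proof -
  have "Top 1 \<in> Top ` {1..n} \<union> Bot ` {1..n}" using assms(2) by simp
  then obtain s where "s \<in> q" "Top 1 \<in> s" using diagram_cover[OF tonal_diagram[OF assms(1)]] by blast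
  then show ?thesis using that[of s] by blast
qed

text \<open>A hook placed above \<open>a\<close> turns the top row of \<open>a\<close> into that of
  \<open>q\<close> and keeps the bottom row of \<open>a\<close>; a second hook, built for the
  reflected diagram, then restores the bottom row of \<open>q\<close>. No loops may occur, as the
  parameter is not invertible. For \<open>n = 0\<close> there would be no part \<open>s0\<close>
  meeting the top row.\<close>

lemma factor:
  assumes l: "l \<ge> 1" and q: "q \<in> tonal l n" and n: "n \<ge> 1"
  defines "a \<equiv> a_diagram l n (prop_vec l q)"
  shows "\<exists>x\<in>tonal l n. \<exists>y\<in>tonal l n. loops x a = 0 \<and> loops (dcomp x a) y = 0 \<and> dcomp (dcomp x a) y = q"
proof -
  interpret cell l n "prop_vec l q" using l prop_vec_index[OF l q] by unfold_locales
  note dq = tonal_diagram[OF q]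
  obtain \<beta> where \<beta>: "bij_betw \<beta> {s \<in> q. propagating s} I"
    "\<And>s. s \<in> q \<Longrightarrow> propagating s \<Longrightarrow> fst (\<beta> s) mod l = ntop s mod l"
    using slot_map_exists[OF l q] by blast
  obtain s0 where s0: "s0 \<in> q" "s0 \<inter> rT \<noteq> {}" by (rule top_part_exists[OF q n])
  define x where "x = hook q \<beta> s0"
  have x: "x \<in> tonal l n" unfolding x_def by (rule hook_tonal[OF q s0 \<beta>])
  \<comment> \<open>The upper half of \<open>q\<close> over the bottom row of
    \<open>a\<close>.\<close>
  define d where "d = (\<lambda>s. (s \<inter> rT) \<union> (if propagating s then Bot ` B (\<beta> s) else {})) ` {s \<in> q. s \<inter> rT \<noteq> {}}
      \<union> {t \<in> a. t \<subseteq> rB}"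
  have xa: "loops x a = 0" "dcomp x a = d"
    unfolding x_def d_def a_def
  proof -
    note pr = strand_a[unfolded strand_def] a_cases[unfolded strand_def]
    have "Bot ` A \<subseteq> rB" for A by blast
    note * = hook_dcomp[OF q s0 \<beta> tonal_diagram[OF a_tonal], where z = "\<lambda>c. Bot ` B c"]
    show "loops (hook q \<beta> s0) (a_diagram l n (prop_vec l q)) = 0"
      by (rule *(1)) (assumption | rule pr | rule \<open>Bot ` _ \<subseteq> rB\<close>)+
    show "dcomp (hook q \<beta> s0) (a_diagram l n (prop_vec l q))
      = (\<lambda>s. (s \<inter> rT) \<union> (if propagating s then Bot ` B (\<beta> s) else {})) ` {s \<in> q. s \<inter> rT \<noteq> {}}
      \<union> {t \<in> a_diagram l n (prop_vec l q). t \<subseteq> rB}"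
      by (rule *(2)) (assumption | rule pr | rule \<open>Bot ` _ \<subseteq> rB\<close>)+
  qed
  have a: "a \<in> tonal l n" unfolding a_def by (rule a_tonal)
  have d: "d \<in> tonal l n" unfolding xa(2)[symmetric]
    by (rule tonal_composable.dcomp_tonal) (use l x a in unfold_locales)
  have \<beta>I: "\<beta> s \<in> I" if "s \<in> q" "propagating s" for s using \<beta>(1) that by (auto simp: bij_betw_def)
  have d_tops: "(s \<inter> rT) \<union> (if propagating s then Bot ` B (\<beta> s) else {}) \<in> d" if "s \<in> q" "s \<inter> rT \<noteq> {}" for s
    unfolding d_def by (rule UnI1, rule image_eqI[OF refl]) (use that in simp)
  have dE: "(\<exists>s. s \<in> q \<and> s \<inter> rT \<noteq> {} \<and> t = (s \<inter> rT) \<union> (if propagating s then Bot ` B (\<beta> s) else {})) \<or> t \<subseteq> rB"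
    if "t \<in> d" for t
    using that unfolding d_def 
    by (elim UnE imageE CollectE conjE) ((rule disjI1, rule exI, intro conjI, assumption+) | (rule disjI2, assumption))+
  \<comment> \<open>The lower half of \<open>q\<close> comes from the same construction on the
    reflected diagrams, with the same assignment of slots.\<close>
  define q' where "q' = flip q"
  have q': "q' \<in> tonal l n" unfolding q'_def by (rule flip_tonal[OF q])
  define \<beta>' where "\<beta>' s = \<beta> (flip_vertex ` s)" for s
  have flip_bij: "bij_betw ((`) flip_vertex) {s \<in> q'. propagating s} {s \<in> q. propagating s}"
  proof (rule bij_betw_byWitness[where f' = "(`) flip_vertex"])
    show "(`) flip_vertex ` {s \<in> q'. propagating s} \<subseteq> {s \<in> q. propagating s}"
      unfolding q'_def by (auto simp: flip_mem propagating_flip)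
    show "(`) flip_vertex ` {s \<in> q. propagating s} \<subseteq> {s \<in> q'. propagating s}"
      unfolding q'_def by (auto simp: flip_mem propagating_flip)
  qed simp_all
  have \<beta>'_bij: "bij_betw \<beta>' {s \<in> q'. propagating s} I"
    using bij_betw_trans[OF flip_bij \<beta>(1)] by (simp add: \<beta>'_def[abs_def] comp_def)
  have \<beta>'_tone: "fst (\<beta>' s) mod l = ntop s mod l" if s: "s \<in> q'" "propagating s" for s
  proof -
    have "flip_vertex ` s \<in> q" "propagating (flip_vertex ` s)"
      using s by (auto simp: q'_def flip_mem propagating_flip)
    then have "fst (\<beta>' s) mod l = nbot s mod l" using \<beta>(2) by (simp add: \<beta>'_def ntop_flip)
    then show ?thesis using q' s(1) by (simp add: tonal_def)
  qed
  obtain s1 where s1: "s1 \<in> q'" "s1 \<inter> rT \<noteq> {}" by (rule top_part_exists[OF q' n])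
  define x' where "x' = hook q' \<beta>' s1"
  have x': "x' \<in> tonal l n" unfolding x'_def by (rule hook_tonal[OF q' s1 \<beta>'_bij \<beta>'_tone])
  \<comment> \<open>The strand of \<open>flip d\<close> through the slot \<open>c\<close> ends in
    the reflected top row of the part of \<open>q\<close> to which \<open>\<beta>\<close> assigns
    \<open>c\<close>.\<close>
  define z where "z c = flip_vertex ` (inv_into {s \<in> q. propagating s} \<beta> c \<inter> rT)" for c
  have z\<beta>: "z (\<beta> s) = flip_vertex ` (s \<inter> rT)" if "s \<in> q" "propagating s" for s
    unfolding z_def using that \<beta>(1) by (simp add: bij_betw_def)
  have fd: "flip d \<in> diagrams n n" by (rule flip_diagrams[OF tonal_diagram[OF d]])
  have flip_part: "flip_vertex ` ((s \<inter> rT) \<union> Bot ` A) = Top ` A \<union> flip_vertex ` (s \<inter> rT)" for s A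
    by (simp add: image_Un image_image Un_commute)
  have strand_d: "Top ` B c \<union> z c \<in> flip d" if c: "c \<in> I" for c
  proof -
    have "c \<in> \<beta> ` {s \<in> q. propagating s}" using \<beta>(1) c by (simp add: bij_betw_def)
    then obtain s where s: "s \<in> q" "propagating s" "\<beta> s = c" by blast
    have "s \<inter> rT \<noteq> {}" using s(2) by (simp add: propagating_def)
    then have "(s \<inter> rT) \<union> Bot ` B (\<beta> s) \<in> d" using d_tops[OF s(1)] s(2) by simp
    then have "flip_vertex ` ((s \<inter> rT) \<union> Bot ` B (\<beta> s)) \<in> flip d" unfolding flip_def by (rule imageI)
    then show ?thesis unfolding flip_part z\<beta>[OF s(1,2), symmetric] s(3) .
  qed
  have z_sub: "z c \<subseteq> rB" for c unfolding z_def flip_sub(2) by simp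
  have d_cases: "(\<exists>c\<in>I. t = Top ` B c \<union> z c) \<or> t \<subseteq> rT \<or> t \<subseteq> rB" if t: "t \<in> flip d" for t
  proof -
    obtain u where u: "u \<in> d" "t = flip_vertex ` u" using t unfolding flip_def by blast
    consider s where "s \<in> q" "propagating s" "u = (s \<inter> rT) \<union> Bot ` B (\<beta> s)"
      | "u \<subseteq> rT" | "u \<subseteq> rB"
    proof (cases "u \<subseteq> rB")
      case False
      then obtain s where s: "s \<in> q" "u = (s \<inter> rT) \<union> (if propagating s then Bot ` B (\<beta> s) else {})"
        using dE[OF u(1)] by blast
      show ?thesis
      proof (cases "propagating s")
        case True then show ?thesis using s that(1)[of s] by simp
      next
        case False then show ?thesis using s(2) by (intro that(2)) simp
      qed
    qed (rule that(3))
    then show ?thesis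
    proof cases
      case 1
      have "\<beta> s \<in> I" by (rule \<beta>I[OF 1(1,2)])
      moreover have "t = Top ` B (\<beta> s) \<union> z (\<beta> s)" unfolding u(2) 1(3) flip_part z\<beta>[OF 1(1,2)] ..
      ultimately show ?thesis by blast
    next
      case 2 then show ?thesis unfolding u(2) using flip_sub(2) by blast
    next
      case 3 then show ?thesis unfolding u(2) using flip_sub(1) by blast
    qed
  qed
  have hd: "loops x' (flip d) = 0"
    "dcomp x' (flip d) = (\<lambda>s. (s \<inter> rT) \<union> (if propagating s then z (\<beta>' s) else {})) ` {s \<in> q'. s \<inter> rT \<noteq> {}}
      \<union> {t \<in> flip d. t \<subseteq> rB}"
    unfolding x'_def
    by (rule hook_dcomp[OF q' s1 \<beta>'_bij \<beta>'_tone fd], (assumption | rule strand_d z_sub d_cases)+)+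
  have "dcomp x' (flip d) \<subseteq> q'"
  proof
    fix t assume "t \<in> dcomp x' (flip d)"
    then consider s where "s \<in> q'" "s \<inter> rT \<noteq> {}" "t = (s \<inter> rT) \<union> (if propagating s then z (\<beta>' s) else {})"
      | "t \<in> flip d" "t \<subseteq> rB" unfolding hd(2) by (elim UnE imageE CollectE conjE)
    then show "t \<in> q'"
    proof cases
      case 1
      have sub: "s \<subseteq> rT \<union> rB" using diagram_sub[OF tonal_diagram[OF q'] 1(1)] by blast
      have "t = s"
      proof (cases "propagating s")
        case True
        have "flip_vertex ` s \<in> q" "propagating (flip_vertex ` s)"
          using 1(1) True by (auto simp: q'_def flip_mem propagating_flip)
        then have "z (\<beta>' s) = s \<inter> rB" unfolding \<beta>'_def using z\<beta> by (simp add: flip_part_Int)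
        then show ?thesis using 1(3) True sub by auto
      next
        case False
        then have "s \<inter> rB = {}" using 1(2) by (simp add: propagating_def)
        then show ?thesis using 1(3) False sub by auto
      qed
      then show ?thesis using 1(1) by simp
    next
      case 2
      then have u: "flip_vertex ` t \<in> d" "flip_vertex ` t \<subseteq> rT" using flip_mem flip_sub(1) by blast+
      have ne: "flip_vertex ` t \<noteq> {}" using diagram_ne[OF tonal_diagram[OF d] u(1)] .
      have "\<not> flip_vertex ` t \<subseteq> rB" by (rule not_sub_right[OF vertex_disjoint(2) u(2) ne])
      then obtain s where s: "s \<in> q" "s \<inter> rT \<noteq> {}"
        "flip_vertex ` t = (s \<inter> rT) \<union> (if propagating s then Bot ` B (\<beta> s) else {})"
        using dE[OF u(1)] by metis
      have "\<not> propagating s"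
      proof
        assume pr: "propagating s"
        then have "B (\<beta> s) \<noteq> {}" using B_ne[OF \<beta>I[OF s(1)]] by blast
        then show False using s(3) pr u(2) by auto
      qed
      then have "s \<inter> rB = {}" "flip_vertex ` t = s \<inter> rT" using s(2,3) by (auto simp: propagating_def)
      moreover have "s \<subseteq> rT \<union> rB" using diagram_sub[OF dq s(1)] by blast
      ultimately have "flip_vertex ` t = s" by auto
      then show ?thesis using s(1) unfolding q'_def flip_mem by simp
    qed
  qed
  moreover have "dcomp x' (flip d) \<in> diagrams n n"
    by (rule composable.dcomp_diagrams) (use tonal_diagram[OF x'] fd in unfold_locales)
  ultimately have x'd: "dcomp x' (flip d) = q'"
    using diagram_subset_eq[OF _ tonal_diagram[OF q']] by blast
  have "dcomp d (flip x') = q" using flip_dcomp[of "flip d" x'] x'd by (simp add: q'_def)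
  moreover have "loops d (flip x') = 0" using flip_loops[of "flip d" x'] hd(1) by simp
  ultimately show ?thesis using x flip_tonal[OF x'] xa by blast
qed

section \<open>A form with dominant diagonal\<close>

text \<open>The coefficient in the largest degree \<open>M\<close> of a diagonal term is examined.
  An off-diagonal term has degree at most the mean of two diagonal degrees, and it could reach
  \<open>M\<close> only if \<open>2 * L p q = N p + N q\<close>, that is, for \<open>p = q\<close>.
  What remains is a sum of squares of leading coefficients, positive because the coefficients are
  integers.\<close>

lemma dominant_form_nonzero:
  fixes w :: "'a \<Rightarrow> int poly" and L :: "'a \<Rightarrow> 'a \<Rightarrow> nat" and N :: "'a \<Rightarrow> nat"
  assumes fin: "finite C" and w: "p0 \<in> C" "w p0 \<noteq> 0"
    and le: "\<And>p q. p \<in> C \<Longrightarrow> q \<in> C \<Longrightarrow> R p q \<Longrightarrow> 2 * L p q \<le> N p + N q"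
    and eq: "\<And>p q. p \<in> C \<Longrightarrow> q \<in> C \<Longrightarrow> R p q \<Longrightarrow> 2 * L p q = N p + N q \<Longrightarrow> p = q"
    and diag: "\<And>p. p \<in> C \<Longrightarrow> R p p \<and> L p p = N p"
  shows "(\<Sum>p\<in>C. \<Sum>q\<in>C. w p * w q * (if R p q then monom 1 (L p q) else 0)) \<noteq> 0"
proof -
  \<comment> \<open>For \<open>w p\<close> nonzero this is the degree of the diagonal term at
    \<open>p\<close>.\<close>
  define D where "D p = 2 * degree (w p) + N p" for p
  define M where "M = Max (D ` {p \<in> C. w p \<noteq> 0})"
  have fin': "finite (D ` {p \<in> C. w p \<noteq> 0})" using fin by simp
  have D_le: "D p \<le> M" if "p \<in> C" "w p \<noteq> 0" for p unfolding M_def using fin' that by (intro Max_ge) auto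
  have "M \<in> D ` {p \<in> C. w p \<noteq> 0}" unfolding M_def by (rule Max_in[OF fin']) (use w in auto)
  then obtain p1 where p1: "p1 \<in> C" "w p1 \<noteq> 0" "M = D p1" by auto
  let ?t = "\<lambda>p q. w p * w q * (if R p q then monom 1 (L p q) else 0)"
  have cf: "coeff (u * monom 1 k) M = (if M < k then 0 else coeff u (M - k))" for u :: "int poly" and k
    using coeff_monom_mult[of 1 k u M] by (simp add: mult.commute)
  have off: "coeff (?t p q) M = 0" if pq: "p \<in> C" "q \<in> C" "p \<noteq> q" for p q
  proof (rule ccontr)
    assume nz: "coeff (?t p q) M \<noteq> 0"
    then have R: "R p q" by (auto split: if_splits)
    then have nz': "coeff (w p * w q * monom 1 (L p q)) M \<noteq> 0" using nz by simp
    then have wne: "w p \<noteq> 0" "w q \<noteq> 0" by auto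
    have M: "M \<ge> L p q" "coeff (w p * w q) (M - L p q) \<noteq> 0"
      using nz' unfolding cf by (auto split: if_splits)
    have "M - L p q \<le> degree (w p) + degree (w q)"
      using le_degree[OF M(2)] degree_mult_le[of "w p" "w q"] by linarith
    \<comment> \<open>Doubled in order to compare with \<open>D p + D q\<close> without
      halves.\<close>
    then have "2 * M \<le> 2 * degree (w p) + 2 * degree (w q) + 2 * L p q" using M(1) by linarith
    moreover have "D p + D q \<le> 2 * M" using D_le[OF pq(1) wne(1)] D_le[OF pq(2) wne(2)] by linarith
    ultimately have "2 * L p q = N p + N q" using le[OF pq(1,2) R] unfolding D_def by linarith
    then show False using eq[OF pq(1,2) R] pq(3) by blast
  qed
  have on: "coeff (?t p p) M \<ge> 0" if p: "p \<in> C" for p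
  proof (cases "w p = 0")
    case False
    have t: "?t p p = w p * w p * monom 1 (N p)" using diag[OF p] by simp
    show ?thesis
    proof (cases "D p = M")
      case True
      then have "M - N p = degree (w p) + degree (w p)" "\<not> M < N p" unfolding D_def by linarith+
      then have "coeff (?t p p) M = coeff (w p * w p) (degree (w p) + degree (w p))"
        unfolding t cf by simp
      then show ?thesis by (simp add: coeff_mult_degree_sum)
    next
      case nM: False
      then have "D p < M" using D_le[OF p False] by simp
      then have "degree (w p * w p) < M - N p"
        using degree_mult_le[of "w p" "w p"] unfolding D_def by linarith
      then show ?thesis unfolding t cf by (simp add: coeff_eq_0)
    qed
  qed simp
  have pos: "coeff (?t p1 p1) M > 0"
  proof -
    have t: "?t p1 p1 = w p1 * w p1 * monom 1 (N p1)" using diag[OF p1(1)] by simp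
    have "coeff (?t p1 p1) M = lead_coeff (w p1) * lead_coeff (w p1)"
    proof -
      have "M - N p1 = degree (w p1) + degree (w p1)" "\<not> M < N p1" using p1(3) unfolding D_def by linarith+
      then show ?thesis unfolding t cf by (simp add: coeff_mult_degree_sum)
    qed
    moreover have "lead_coeff (w p1) * lead_coeff (w p1) > 0"
      using p1(2) zero_less_power2[of "lead_coeff (w p1)"] by (simp add: power2_eq_square)
    ultimately show ?thesis by simp
  qed
  have row: "(\<Sum>q\<in>C. coeff (?t p q) M) = coeff (?t p p) M" if p: "p \<in> C" for p
  proof -
    have "(\<Sum>q\<in>C. coeff (?t p q) M) = (\<Sum>q\<in>C. if q = p then coeff (?t p p) M else 0)"
      by (rule sum.cong[OF refl]) (use off[OF p] in auto)
    then show ?thesis using fin p by simp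
  qed
  have "coeff (\<Sum>p\<in>C. \<Sum>q\<in>C. ?t p q) M = (\<Sum>p\<in>C. \<Sum>q\<in>C. coeff (?t p q) M)" by (simp add: coeff_sum)
  also have "\<dots> = (\<Sum>p\<in>C. coeff (?t p p) M)" by (rule sum.cong[OF refl row])
  also have "\<dots> > 0" using sum_pos2[of C p1 "\<lambda>p. coeff (?t p p) M"] fin p1(1) pos on by blast
  finally show ?thesis by (metis coeff_0 less_irrefl)
qed

section \<open>The diagonal and the equivariance of the form\<close>

context cell
begin

text \<open>In the middle row \<open>p\<close> is glued to its own mirror image, so a part meets
  only its reflection: propagating parts close up to the strands of \<open>a\<close>, and the
  isolated top parts of \<open>p\<close> become the loops.\<close>

lemma dcomp_diagonal:
  assumes p: "p \<in> C"
  shows "dcomp (flip p) p = a" and "loops (flip p) p = nt p"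
proof -
  interpret T: tonal_composable l n "flip p" p using l flip_tonal[OF C_tonal[OF p]] C_tonal[OF p] by unfold_locales
  note dg = C_diagram[OF p]
  have up: "bot_to_mid ` flip_vertex ` s = flip_vertex ` top_to_mid ` s" for s
  proof -
    have "bot_to_mid (flip_vertex v) = flip_vertex (top_to_mid v)" for v by (cases v) auto
    then show ?thesis by (simp add: image_image)
  qed
  have upper: "upper (flip p) = (`) flip_vertex ` lower p"
    unfolding upper_def flip_def lower_def by (simp add: image_image up[unfolded image_image])
  have bottom: "s \<in> dcomp (flip p) p" if s: "s \<in> a" "s \<subseteq> rB" for s
  proof -
    have "s \<in> p" using s C_isolated[OF p] by blast
    have "s \<inter> rT = {}" using s(2) by auto
    then have e: "top_to_mid ` s = s" using top_to_mid_image[of s] s(2) by (simp add: Int_absorb2 le_supI2)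
    interpret S: two_parts "Bot ` {1..n}" "Mid ` {1..n}" "Top ` {1..n}" "lower p" "upper (flip p)" by (rule T.swap)
    have "s \<in> lower p" using \<open>s \<in> p\<close> e unfolding lower_def by (metis imageI)
    moreover have "\<not> meets s (Mid ` {1..n})"
      using lower_parts(6)[OF diagram_sub[OF dg \<open>s \<in> p\<close>]] \<open>s \<inter> rT = {}\<close> unfolding e by blast
    ultimately have "s \<in> T.G" using S.X_isolated[of s] by (simp add: Un_commute)
    moreover have "s - rM = s" "s \<noteq> {}" using s(2) diagram_ne[OF dg \<open>s \<in> p\<close>] by auto
    ultimately show ?thesis using T.dcompI[of s] by simp
  qed
  have fl: "flip (dcomp (flip p) p) = dcomp (flip p) p" using flip_dcomp[of p "flip p"] by simp
  have sub: "a \<subseteq> dcomp (flip p) p"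
  proof
    fix s assume s: "s \<in> a"
    then consider c where "c \<in> I" "s = strand l m c" | "s \<subseteq> rT" | "s \<subseteq> rB" using a_cases by blast
    then show "s \<in> dcomp (flip p) p"
    proof cases
      case 3 then show ?thesis using bottom s by blast
    next
      case 2
      have "flip_vertex ` s \<in> flip a" using s unfolding flip_def by (rule imageI)
      then have "flip_vertex ` s \<in> dcomp (flip p) p" using bottom 2 flip_sub(2) unfolding flip_a by blast
      then have "s \<in> flip (dcomp (flip p) p)" unfolding flip_mem .
      then show ?thesis unfolding fl .
    next
      case 1
      obtain u where u: "u \<in> p" "propagating u" "u \<inter> rB = Bot ` B c" using C_part[OF p 1(1)] by blast
      have subu: "u \<subseteq> rT \<union> rB" using diagram_sub[OF dg u(1)] by blast
      let ?t = "top_to_mid ` u" and ?s = "flip_vertex ` top_to_mid ` u"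
      have tQ: "?t \<in> lower p" using u(1) by (simp add: lower_def)
      have sP: "?s \<in> upper (flip p)" unfolding upper using tQ by (rule imageI)
      have t: "?t = Bot ` B c \<union> top_to_mid ` (u \<inter> rT)"
        using top_to_mid_image[OF subu] u(3) by simp
      have fM: "flip_vertex ` top_to_mid ` (u \<inter> rT) = top_to_mid ` (u \<inter> rT)"
      proof -
        have "flip_vertex v = v" if "v \<in> rM" for v using that by auto
        then have "flip_vertex ` top_to_mid ` (u \<inter> rT) = id ` top_to_mid ` (u \<inter> rT)"
          by (intro image_cong refl) (use top_to_mid_rT in auto)
        then show ?thesis by simp
      qed
      have s': "?s = Top ` B c \<union> top_to_mid ` (u \<inter> rT)"
        unfolding t image_Un fM by (simp add: image_image)
      have TMB: "top_to_mid ` (u \<inter> rT) \<subseteq> rM" by (rule top_to_mid_rT)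
      have uT: "top_to_mid ` (u \<inter> rT) \<noteq> {}" using u(2) by (simp add: propagating_def)
      \<comment> \<open>A common middle vertex ties the part to its mirror image.\<close>
      obtain x where x: "x \<in> top_to_mid ` (u \<inter> rT)" using uT by blast
      interpret S: two_parts "Bot ` {1..n}" "Mid ` {1..n}" "Top ` {1..n}" "lower p" "upper (flip p)" by (rule T.swap)
      have "?s \<union> ?t \<in> T.G"
      proof (rule conn_partI)
        show "?s \<union> ?t \<noteq> {}" using x t by blast
        show "?s \<union> ?t \<subseteq> \<Union>(upper (flip p) \<union> lower p)" using tQ sP by blast
        fix r assume r: "r \<in> upper (flip p) \<union> lower p" "r \<inter> (?s \<union> ?t) \<noteq> {}"
        show "r \<subseteq> ?s \<union> ?t"
        proof (cases "r \<in> upper (flip p)")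
          case True
          then have rs: "r \<subseteq> Top ` {1..n} \<union> Mid ` {1..n}" by (rule T.P_sub)
          then have "r \<inter> Bot ` B c = {}" by auto
          then have "r \<inter> ?s \<noteq> {}" using r(2) unfolding s' unfolding t by blast
          then have "r = ?s" using T.P_disj[OF True sP] by blast
          then show ?thesis by blast
        next
          case False
          then have rQ: "r \<in> lower p" using r(1) by blast
          then have rs: "r \<subseteq> Bot ` {1..n} \<union> Mid ` {1..n}" by (rule S.P_sub)
          then have "r \<inter> Top ` B c = {}" by auto
          then have "r \<inter> ?t \<noteq> {}" using r(2) unfolding s' unfolding t by blast
          then have "r = ?t" using S.P_disj[OF rQ tQ] by blast
          then show ?thesis by blast
        qed
      next
        fix g assume g: "g \<in> T.G" "g \<inter> (?s \<union> ?t) \<noteq> {}"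
        have ab: "?s \<inter> g \<noteq> {} \<Longrightarrow> ?s \<subseteq> g" "?t \<inter> g \<noteq> {} \<Longrightarrow> ?t \<subseteq> g"
          using conn_absorb[OF _ g(1)] sP tQ by blast+
        have "x \<in> ?s" "x \<in> ?t" using x unfolding s' unfolding t by blast+
        then show "?s \<union> ?t \<subseteq> g" using ab g(2) by blast
      qed
      moreover have "(?s \<union> ?t) - rM = s"
        unfolding 1(2) strand_def s' unfolding t using TMB by auto
      ultimately show ?thesis using T.dcompI[of "?s \<union> ?t"] diagram_ne[OF tonal_diagram[OF a_tonal] s] by simp
    qed
  qed
  show eq: "dcomp (flip p) p = a"
    by (rule diagram_subset_eq[OF tonal_diagram[OF a_tonal] T.dcomp_diagrams sub, symmetric])
  show "loops (flip p) p = nt p"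
  proof (rule antisym)
    show "loops (flip p) p \<le> nt p" using T.loops_le_left unfolding card_isolated_flip .
    \<comment> \<open>An isolated top part of \<open>p\<close> is moved to the middle row, where it
      coincides with its mirror image and forms a loop.\<close>
    have iso: "top_to_mid ` s \<in> T.G \<and> top_to_mid ` s \<subseteq> rM" if s: "s \<in> p" "s \<subseteq> rT" for s
    proof
      show sM: "top_to_mid ` s \<subseteq> rM" using s(2) by auto
      have "flip_vertex v = v" if "v \<in> rM" for v using that by auto
      then have f: "flip_vertex ` top_to_mid ` s = top_to_mid ` s" using sM by (force simp: image_iff)
      have Q: "top_to_mid ` s \<in> lower p" using s(1) by (simp add: lower_def)
      then have P: "top_to_mid ` s \<in> upper (flip p)" unfolding upper using f by (metis imageI)
      interpret S: two_parts "Bot ` {1..n}" "Mid ` {1..n}" "Top ` {1..n}" "lower p" "upper (flip p)" by (rule T.swap)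
      show "top_to_mid ` s \<in> T.G"
      proof (rule conn_isolated)
        show "top_to_mid ` s \<in> upper (flip p) \<union> lower p" using P by blast
        show "top_to_mid ` s \<noteq> {}" using diagram_ne[OF dg s(1)] by simp
        fix t assume t: "t \<in> upper (flip p) \<union> lower p" "t \<inter> top_to_mid ` s \<noteq> {}"
        then have "t = top_to_mid ` s" using T.P_disj[OF _ P, of t] S.P_disj[OF _ Q, of t] by blast
        then show "t \<subseteq> top_to_mid ` s" by simp
      qed
    qed
    have "nt p = card ((`) top_to_mid ` {s \<in> p. s \<subseteq> rT})" unfolding nt_def
      by (rule card_image[symmetric], rule inj_on_subset[OF inj_image_diagram(2)[OF dg]]) auto
    also have "\<dots> \<le> card {t \<in> glue (flip p) p. t \<subseteq> rM}"
      unfolding T.glue_G by (rule card_mono) (use iso T.finG in auto)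
    finally show "nt p \<le> loops (flip p) p" unfolding loops_def .
  qed
qed

text \<open>The coefficient at \<open>\<rho>\<close> of the form \<open>B(f, g)\<close> with values
  in the group algebra; its value at the identity is the scalar form \<open>T\<close>.\<close>

definition Bf :: "(diagram \<Rightarrow> int poly) \<Rightarrow> (diagram \<Rightarrow> int poly) \<Rightarrow> perms \<Rightarrow> int poly" where
  "Bf f g \<rho> = (\<Sum>p\<in>C. \<Sum>q\<in>C. f p * g q *
     (if dcomp (flip p) q = act a \<rho> then monom 1 (loops (flip p) q) else 0))"

lemma Bf_nonzero:
  assumes "p \<in> C" "w p \<noteq> 0"
  shows "Bf w w (\<lambda>i. id) \<noteq> 0"
  unfolding Bf_def act_one[OF a_C]
  by (rule dominant_form_nonzero[where w = w and N = nt and R = "\<lambda>p q. dcomp (flip p) q = a"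
        and L = "\<lambda>p q. loops (flip p) q", OF finite_C assms])
    (simp_all add: loops_le_nt loops_eq_nt dcomp_diagonal)

definition ract :: "(diagram \<Rightarrow> int poly) \<Rightarrow> (perms \<Rightarrow> int poly) \<Rightarrow> diagram \<Rightarrow> int poly" where
  "ract f x z = (\<Sum>p\<in>C. \<Sum>\<sigma>\<in>S. f p * x \<sigma> * basis_vec (act p \<sigma>) z)"

text \<open>The action is moved from the function \<open>f\<close> to the argument of
  \<open>h\<close>, which reduces identities for \<open>Bf\<close> to identities for its
  kernel.\<close>

lemma sum_ract: "(\<Sum>z\<in>C. ract f x z * h z) = (\<Sum>p\<in>C. \<Sum>\<sigma>\<in>S. f p * x \<sigma> * h (act p \<sigma>))"
proof -
  have "(\<Sum>z\<in>C. ract f x z * h z) = (\<Sum>z\<in>C. \<Sum>p\<in>C. \<Sum>\<sigma>\<in>S. f p * x \<sigma> * (basis_vec (act p \<sigma>) z * h z))"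
    unfolding ract_def sum_distrib_right by (simp add: mult.assoc)
  also have "\<dots> = (\<Sum>p\<in>C. \<Sum>z\<in>C. \<Sum>\<sigma>\<in>S. f p * x \<sigma> * (basis_vec (act p \<sigma>) z * h z))" by (rule sum.swap)
  also have "\<dots> = (\<Sum>p\<in>C. \<Sum>\<sigma>\<in>S. \<Sum>z\<in>C. f p * x \<sigma> * (basis_vec (act p \<sigma>) z * h z))"
    by (rule sum.cong[OF refl]) (rule sum.swap)
  also have "\<dots> = (\<Sum>p\<in>C. \<Sum>\<sigma>\<in>S. f p * x \<sigma> * h (act p \<sigma>))"
  proof (rule sum.cong[OF refl], rule sum.cong[OF refl])
    fix p \<sigma> assume p: "p \<in> C" "\<sigma> \<in> S"
    have "(\<Sum>z\<in>C. f p * x \<sigma> * (basis_vec (act p \<sigma>) z * h z)) = (\<Sum>z\<in>C. if z = act p \<sigma> then f p * x \<sigma> * h z else 0)"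
      by (rule sum.cong) (auto simp: basis_vec_def)
    then show "(\<Sum>z\<in>C. f p * x \<sigma> * (basis_vec (act p \<sigma>) z * h z)) = f p * x \<sigma> * h (act p \<sigma>)"
      using finite_C act_C[OF p] by simp
  qed
  finally show ?thesis .
qed

text \<open>Equivariance of the kernel: for \<open>p \<sigma>\<close> and \<open>q \<tau>\<close>
  its value at \<open>\<rho>\<close> is the value for \<open>p\<close> and \<open>q\<close> at
  \<open>\<sigma> \<rho> \<tau>^-1\<close>.\<close>

lemma Bf_ract:
  assumes \<rho>: "\<rho> \<in> S"
  shows "Bf (ract f x) (ract g y) \<rho>
    = (\<Sum>\<sigma>\<in>S. \<Sum>\<tau>\<in>S. x \<sigma> * y \<tau> * Bf f g (perms_mult (perms_mult \<sigma> \<rho>) (perms_inv \<tau>)))"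
proof -
  define K where "K p q \<rho> = (if dcomp (flip p) q = act a \<rho> then monom 1 (loops (flip p) q) else (0 :: int poly))" for p q \<rho>
  have K_act: "K (act p \<sigma>) (act q \<tau>) \<rho> = K p q (perms_mult (perms_mult \<sigma> \<rho>) (perms_inv \<tau>))"
    if "p \<in> C" "q \<in> C" and \<sigma>: "\<sigma> \<in> S" and \<tau>: "\<tau> \<in> S" for p q \<sigma> \<tau>
  proof -
    note p = that(1) and q = that(2)
    note \<sigma>' = perms_inv_closed[OF \<sigma>] and \<tau>' = perms_inv_closed[OF \<tau>]
    let ?\<rho>' = "perms_mult (perms_mult \<sigma> \<rho>) (perms_inv \<tau>)"
    have \<rho>': "?\<rho>' \<in> S" by (intro perms_mult_closed \<sigma> \<rho> \<tau>')
    have "dcomp (flip (act p \<sigma>)) (act q \<tau>) = act a \<rho> \<longleftrightarrow> dcomp (flip p) q = act a ?\<rho>'"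
    proof
      assume D: "dcomp (flip (act p \<sigma>)) (act q \<tau>) = act a \<rho>"
      show "dcomp (flip p) q = act a ?\<rho>'"
        using dcomp_act_orbit[OF act_C[OF p \<sigma>] act_C[OF q \<tau>] \<sigma>' \<tau>' \<rho> D]
        unfolding act_inv(1)[OF p \<sigma>] act_inv(1)[OF q \<tau>] perms_inv_inv[OF \<sigma>] .
    next
      assume D: "dcomp (flip p) q = act a ?\<rho>'"
      have "perms_mult (perms_mult (perms_inv \<sigma>) ?\<rho>') \<tau> = \<rho>"
        by (simp add: perms_mult_assoc perms_inv_mult[OF \<tau>] perms_inv_cancel[OF \<sigma>])
      then show "dcomp (flip (act p \<sigma>)) (act q \<tau>) = act a \<rho>"
        using dcomp_act_orbit[OF p q \<sigma> \<tau> \<rho>' D] by simp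
    qed
    then show ?thesis unfolding K_def loops_act[OF p q \<sigma> \<tau>] by simp
  qed
  have Bf: "Bf f g \<rho> = (\<Sum>p\<in>C. f p * (\<Sum>q\<in>C. g q * K p q \<rho>))" for f g \<rho>
    unfolding Bf_def K_def by (simp add: sum_distrib_left mult.assoc)
  have "Bf (ract f x) (ract g y) \<rho> = (\<Sum>p\<in>C. \<Sum>\<sigma>\<in>S. f p * x \<sigma> * (\<Sum>q\<in>C. \<Sum>\<tau>\<in>S. g q * y \<tau> * K (act p \<sigma>) (act q \<tau>) \<rho>))"
    unfolding Bf sum_ract ..
  also have "\<dots> = (\<Sum>p\<in>C. \<Sum>\<sigma>\<in>S. f p * x \<sigma> * (\<Sum>q\<in>C. \<Sum>\<tau>\<in>S. g q * y \<tau> * K p q (perms_mult (perms_mult \<sigma> \<rho>) (perms_inv \<tau>))))"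
    by (intro sum.cong refl arg_cong2[of _ _ _ _ "(*)"]) (simp_all add: K_act)
  also have "\<dots> = (\<Sum>\<sigma>\<in>S. \<Sum>p\<in>C. f p * x \<sigma> * (\<Sum>q\<in>C. \<Sum>\<tau>\<in>S. g q * y \<tau> * K p q (perms_mult (perms_mult \<sigma> \<rho>) (perms_inv \<tau>))))"
    by (rule sum.swap)
  also have "\<dots> = (\<Sum>\<sigma>\<in>S. \<Sum>\<tau>\<in>S. x \<sigma> * y \<tau> * Bf f g (perms_mult (perms_mult \<sigma> \<rho>) (perms_inv \<tau>)))"
  proof (rule sum.cong[OF refl])
    fix \<sigma>
    let ?k = "\<lambda>p q \<tau>. K p q (perms_mult (perms_mult \<sigma> \<rho>) (perms_inv \<tau>))"
    have "(\<Sum>p\<in>C. f p * x \<sigma> * (\<Sum>q\<in>C. \<Sum>\<tau>\<in>S. g q * y \<tau> * ?k p q \<tau>))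
        = (\<Sum>p\<in>C. \<Sum>\<tau>\<in>S. f p * x \<sigma> * (\<Sum>q\<in>C. g q * y \<tau> * ?k p q \<tau>))"
      by (rule sum.cong[OF refl], subst sum.swap) (simp add: sum_distrib_left)
    also have "\<dots> = (\<Sum>\<tau>\<in>S. \<Sum>p\<in>C. f p * x \<sigma> * (\<Sum>q\<in>C. g q * y \<tau> * ?k p q \<tau>))" by (rule sum.swap)
    also have "\<dots> = (\<Sum>\<tau>\<in>S. x \<sigma> * y \<tau> * (\<Sum>p\<in>C. f p * (\<Sum>q\<in>C. g q * ?k p q \<tau>)))"
      by (simp add: sum_distrib_left mult_ac)
    finally show "(\<Sum>p\<in>C. f p * x \<sigma> * (\<Sum>q\<in>C. \<Sum>\<tau>\<in>S. g q * y \<tau> * ?k p q \<tau>))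
        = (\<Sum>\<tau>\<in>S. x \<sigma> * y \<tau> * Bf f g (perms_mult (perms_mult \<sigma> \<rho>) (perms_inv \<tau>)))"
      unfolding Bf .
  qed
  finally show ?thesis .
qed

section \<open>Convolution in the group algebra\<close>

lemma group_alg_mult:
  "(x \<otimes>\<^bsub>group_alg l m\<^esub> y) \<rho> = (\<Sum>\<sigma>\<in>S. \<Sum>\<tau>\<in>S. x \<sigma> * y \<tau> * basis_vec (perms_mult \<sigma> \<tau>) \<rho>)"
  by (simp add: group_alg_def bilin_ext_def)

text \<open>For a fixed right factor \<open>\<tau>\<close> only
  \<open>\<sigma> = \<rho> \<tau>^-1\<close> contributes.\<close>

lemma group_alg_mult_right:
  assumes \<rho>: "\<rho> \<in> S"
  shows "(x \<otimes>\<^bsub>group_alg l m\<^esub> y) \<rho> = (\<Sum>\<tau>\<in>S. x (perms_mult \<rho> (perms_inv \<tau>)) * y \<tau>)"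
proof -
  have "(x \<otimes>\<^bsub>group_alg l m\<^esub> y) \<rho> = (\<Sum>\<tau>\<in>S. \<Sum>\<sigma>\<in>S. x \<sigma> * y \<tau> * basis_vec (perms_mult \<sigma> \<tau>) \<rho>)"
    unfolding group_alg_mult by (rule sum.swap)
  also have "\<dots> = (\<Sum>\<tau>\<in>S. x (perms_mult \<rho> (perms_inv \<tau>)) * y \<tau>)"
  proof (rule sum.cong[OF refl])
    fix \<tau> assume \<tau>: "\<tau> \<in> S"
    let ?\<sigma> = "perms_mult \<rho> (perms_inv \<tau>)"
    have e: "\<rho> = perms_mult \<sigma> \<tau> \<longleftrightarrow> \<sigma> = ?\<sigma>" for \<sigma>
    proof
      assume "\<rho> = perms_mult \<sigma> \<tau>" then show "\<sigma> = ?\<sigma>" by (simp add: perms_mult_assoc perms_inv_mult[OF \<tau>])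
    next
      assume "\<sigma> = ?\<sigma>" then show "\<rho> = perms_mult \<sigma> \<tau>" by (simp add: perms_mult_assoc perms_inv_mult[OF \<tau>])
    qed
    have "?\<sigma> \<in> S" by (intro perms_mult_closed \<rho> perms_inv_closed \<tau>)
    moreover have "(\<Sum>\<sigma>\<in>S. x \<sigma> * y \<tau> * basis_vec (perms_mult \<sigma> \<tau>) \<rho>) = (\<Sum>\<sigma>\<in>S. if \<sigma> = ?\<sigma> then x \<sigma> * y \<tau> else 0)"
      by (rule sum.cong[OF refl]) (simp add: basis_vec_def e)
    ultimately show "(\<Sum>\<sigma>\<in>S. x \<sigma> * y \<tau> * basis_vec (perms_mult \<sigma> \<tau>) \<rho>) = x ?\<sigma> * y \<tau>"
      using finite_sym_prod[of l m] by simp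
  qed
  finally show ?thesis .
qed

lemma group_alg_mult_left:
  assumes \<rho>: "\<rho> \<in> S"
  shows "(x \<otimes>\<^bsub>group_alg l m\<^esub> y) \<rho> = (\<Sum>\<sigma>\<in>S. x \<sigma> * y (perms_mult (perms_inv \<sigma>) \<rho>))"
  unfolding group_alg_mult
proof (rule sum.cong[OF refl])
  fix \<sigma> assume \<sigma>: "\<sigma> \<in> S"
  let ?\<tau> = "perms_mult (perms_inv \<sigma>) \<rho>"
  have e: "\<rho> = perms_mult \<sigma> \<tau> \<longleftrightarrow> \<tau> = ?\<tau>" for \<tau>
    using perms_inv_cancel[OF \<sigma>] by metis
  have "?\<tau> \<in> S" by (intro perms_mult_closed \<rho> perms_inv_closed \<sigma>)
  moreover have "(\<Sum>\<tau>\<in>S. x \<sigma> * y \<tau> * basis_vec (perms_mult \<sigma> \<tau>) \<rho>) = (\<Sum>\<tau>\<in>S. if \<tau> = ?\<tau> then x \<sigma> * y \<tau> else 0)"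
    by (rule sum.cong[OF refl]) (simp add: basis_vec_def e)
  ultimately show "(\<Sum>\<tau>\<in>S. x \<sigma> * y \<tau> * basis_vec (perms_mult \<sigma> \<tau>) \<rho>) = x \<sigma> * y ?\<tau>"
    using finite_sym_prod[of l m] by simp
qed

text \<open>Convolution on the left involves inverses. Substituting
  \<open>perms_inv \<sigma>\<close> for \<open>\<sigma>\<close> removes them, and the symmetry of
  \<open>x\<close> keeps its coefficients.\<close>

lemma Bf_sandwich:
  assumes \<rho>: "\<rho> \<in> S" and sym: "\<And>\<sigma>. \<sigma> \<in> S \<Longrightarrow> x (perms_inv \<sigma>) = x \<sigma>"
  shows "Bf (ract f x) (ract g y) \<rho> = (x \<otimes>\<^bsub>group_alg l m\<^esub> Bf f g \<otimes>\<^bsub>group_alg l m\<^esub> y) \<rho>"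
proof -
  have "(x \<otimes>\<^bsub>group_alg l m\<^esub> Bf f g \<otimes>\<^bsub>group_alg l m\<^esub> y) \<rho>
      = (\<Sum>\<tau>\<in>S. (\<Sum>\<sigma>\<in>S. x \<sigma> * Bf f g (perms_mult (perms_inv \<sigma>) (perms_mult \<rho> (perms_inv \<tau>)))) * y \<tau>)"
    unfolding group_alg_mult_right[OF \<rho>]
    by (rule sum.cong[OF refl]) (simp add: group_alg_mult_left perms_mult_closed \<rho> perms_inv_closed)
  also have "\<dots> = (\<Sum>\<tau>\<in>S. (\<Sum>\<sigma>\<in>S. x \<sigma> * Bf f g (perms_mult \<sigma> (perms_mult \<rho> (perms_inv \<tau>)))) * y \<tau>)"
  proof (rule sum.cong[OF refl])
    fix \<tau>
    let ?h = "\<lambda>\<sigma>. x \<sigma> * Bf f g (perms_mult (perms_inv \<sigma>) (perms_mult \<rho> (perms_inv \<tau>)))"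
    have b: "bij_betw perms_inv S S"
      by (rule bij_betw_byWitness[where f' = perms_inv]) (auto simp: perms_inv_inv perms_inv_closed)
    have "(\<Sum>\<sigma>\<in>S. ?h \<sigma>) = (\<Sum>\<sigma>\<in>S. ?h (perms_inv \<sigma>))" by (rule sum.reindex_bij_betw[OF b, symmetric])
    also have "\<dots> = (\<Sum>\<sigma>\<in>S. x \<sigma> * Bf f g (perms_mult \<sigma> (perms_mult \<rho> (perms_inv \<tau>))))"
      by (rule sum.cong[OF refl]) (simp add: sym perms_inv_inv)
    finally show "(\<Sum>\<sigma>\<in>S. ?h \<sigma>) * y \<tau> = (\<Sum>\<sigma>\<in>S. x \<sigma> * Bf f g (perms_mult \<sigma> (perms_mult \<rho> (perms_inv \<tau>)))) * y \<tau>"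
      by simp
  qed
  also have "\<dots> = (\<Sum>\<tau>\<in>S. \<Sum>\<sigma>\<in>S. x \<sigma> * y \<tau> * Bf f g (perms_mult (perms_mult \<sigma> \<rho>) (perms_inv \<tau>)))"
    by (simp add: sum_distrib_right sum_distrib_left mult_ac perms_mult_assoc)
  also have "\<dots> = Bf (ract f x) (ract g y) \<rho>" unfolding Bf_ract[OF \<rho>] by (rule sum.swap)
  finally show ?thesis by simp
qed

end

section \<open>The algebra modulo lower terms\<close>

text \<open>A module presented as the image of a space of functions under a map compatible with
  addition and scalars. It serves for the algebra, with the identity map, and for the standard
  module, with passage to cosets, so that linear combinations are computed pointwise.\<close>

locale fun_image =
  fixes M :: "(int poly, 'b) module" and c :: "('a \<Rightarrow> int poly) \<Rightarrow> 'b" and V :: "('a \<Rightarrow> int poly) set"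
  assumes carrier: "carrier M = c ` V"
    and add: "\<And>f g. f \<in> V \<Longrightarrow> g \<in> V \<Longrightarrow> c f \<oplus>\<^bsub>M\<^esub> c g = c (\<lambda>z. f z + g z)"
    and zero: "\<zero>\<^bsub>M\<^esub> = c (\<lambda>z. 0)"
    and smult: "\<And>k f. f \<in> V \<Longrightarrow> k \<odot>\<^bsub>M\<^esub> c f = c (\<lambda>z. k * f z)"
    and V_0: "(\<lambda>z. 0) \<in> V"
    and V_add: "\<And>f g. f \<in> V \<Longrightarrow> g \<in> V \<Longrightarrow> (\<lambda>z. f z + g z) \<in> V"
    and V_smult: "\<And>k f. f \<in> V \<Longrightarrow> (\<lambda>z. k * f z) \<in> V"
begin

lemma abelian_group: "abelian_group M"
proof (rule abelian_groupI)
  fix x y z assume "x \<in> carrier M" "y \<in> carrier M" "z \<in> carrier M"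
  then obtain f g h where f: "f \<in> V" "x = c f" and g: "g \<in> V" "y = c g" and h: "h \<in> V" "z = c h"
    unfolding carrier by blast
  show "x \<oplus>\<^bsub>M\<^esub> y \<oplus>\<^bsub>M\<^esub> z = x \<oplus>\<^bsub>M\<^esub> (y \<oplus>\<^bsub>M\<^esub> z)"
    unfolding f(2) g(2) h(2) by (simp add: f(1) g(1) h(1) add V_add add.assoc)
next
  fix x y assume "x \<in> carrier M" "y \<in> carrier M"
  then obtain f g where f: "f \<in> V" "x = c f" and g: "g \<in> V" "y = c g" unfolding carrier by blast
  show "x \<oplus>\<^bsub>M\<^esub> y \<in> carrier M" unfolding carrier f(2) g(2) add[OF f(1) g(1)] using V_add[OF f(1) g(1)] by blast
  show "x \<oplus>\<^bsub>M\<^esub> y = y \<oplus>\<^bsub>M\<^esub> x" unfolding f(2) g(2) by (simp add: f(1) g(1) add add.commute)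
next
  show "\<zero>\<^bsub>M\<^esub> \<in> carrier M" unfolding carrier zero using V_0 by blast
next
  fix x assume "x \<in> carrier M"
  then obtain f where f: "f \<in> V" "x = c f" unfolding carrier by blast
  show "\<zero>\<^bsub>M\<^esub> \<oplus>\<^bsub>M\<^esub> x = x" unfolding f(2) zero by (simp add: f(1) V_0 add)
  have n: "(\<lambda>z. - 1 * f z) \<in> V" by (rule V_smult[OF f(1)])
  have "c (\<lambda>z. - 1 * f z) \<oplus>\<^bsub>M\<^esub> x = \<zero>\<^bsub>M\<^esub>" unfolding f(2) add[OF n f(1)] zero by simp
  then show "\<exists>y\<in>carrier M. y \<oplus>\<^bsub>M\<^esub> x = \<zero>\<^bsub>M\<^esub>" unfolding carrier using n by blast
qed

lemma module: "Module.module class_ring M"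
proof (rule moduleI[OF class_cring.cring_axioms abelian_group])
  fix k x assume "x \<in> carrier M"
  then obtain f where f: "f \<in> V" "x = c f" unfolding carrier by blast
  show "k \<odot>\<^bsub>M\<^esub> x \<in> carrier M" unfolding carrier f(2) smult[OF f(1)] using V_smult[OF f(1)] by blast
next
  fix k k' x assume "x \<in> carrier M"
  then obtain f where f: "f \<in> V" "x = c f" unfolding carrier by blast
  show "(k \<oplus>\<^bsub>class_ring\<^esub> k') \<odot>\<^bsub>M\<^esub> x = k \<odot>\<^bsub>M\<^esub> x \<oplus>\<^bsub>M\<^esub> k' \<odot>\<^bsub>M\<^esub> x"
    unfolding f(2) by (simp add: f(1) smult add V_smult algebra_simps)
  show "(k \<otimes>\<^bsub>class_ring\<^esub> k') \<odot>\<^bsub>M\<^esub> x = k \<odot>\<^bsub>M\<^esub> (k' \<odot>\<^bsub>M\<^esub> x)"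
    unfolding f(2) by (simp add: f(1) smult V_smult mult.assoc)
next
  fix k x y assume "x \<in> carrier M" "y \<in> carrier M"
  then obtain f g where f: "f \<in> V" "x = c f" and g: "g \<in> V" "y = c g" unfolding carrier by blast
  show "k \<odot>\<^bsub>M\<^esub> (x \<oplus>\<^bsub>M\<^esub> y) = k \<odot>\<^bsub>M\<^esub> x \<oplus>\<^bsub>M\<^esub> k \<odot>\<^bsub>M\<^esub> y"
    unfolding f(2) g(2) by (simp add: f(1) g(1) smult add V_smult V_add algebra_simps)
next
  fix x assume "x \<in> carrier M"
  then obtain f where f: "f \<in> V" "x = c f" unfolding carrier by blast
  show "\<one>\<^bsub>class_ring\<^esub> \<odot>\<^bsub>M\<^esub> x = x" unfolding f(2) by (simp add: f(1) smult)
qed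

lemma V_sum:
  assumes "finite A" "\<And>X. X \<in> A \<Longrightarrow> \<omega> X \<in> V"
  shows "(\<lambda>z. \<Sum>X\<in>A. v X * \<omega> X z) \<in> V"
  using assms
proof (induction A rule: finite_induct)
  case (insert X A)
  then show ?case using V_add[OF V_smult[of "\<omega> X" "v X"], of "\<lambda>z. \<Sum>X\<in>A. v X * \<omega> X z"] by simp
qed (simp add: V_0)

lemma finsum_image:
  assumes "finite A" "\<And>X. X \<in> A \<Longrightarrow> \<omega> X \<in> V \<and> c (\<omega> X) = X"
  shows "(\<Oplus>\<^bsub>M\<^esub>X\<in>A. v X \<odot>\<^bsub>M\<^esub> X) = c (\<lambda>z. \<Sum>X\<in>A. v X * \<omega> X z)"
  using assms
proof (induction A rule: finite_induct)
  case empty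
  interpret abelian_group M by (rule abelian_group)
  show ?case by (simp add: zero)
next
  case (insert X A)
  interpret abelian_group M by (rule abelian_group)
  have t: "v Y \<odot>\<^bsub>M\<^esub> Y = c (\<lambda>z. v Y * \<omega> Y z)" if "Y \<in> insert X A" for Y
    using smult[of "\<omega> Y" "v Y"] insert.prems[OF that] by simp
  have cl: "v Y \<odot>\<^bsub>M\<^esub> Y \<in> carrier M" if "Y \<in> insert X A" for Y
    unfolding t[OF that] carrier using V_smult[of "\<omega> Y" "v Y"] insert.prems[OF that] by blast
  have "(\<Oplus>\<^bsub>M\<^esub>Y\<in>insert X A. v Y \<odot>\<^bsub>M\<^esub> Y) = v X \<odot>\<^bsub>M\<^esub> X \<oplus>\<^bsub>M\<^esub> (\<Oplus>\<^bsub>M\<^esub>Y\<in>A. v Y \<odot>\<^bsub>M\<^esub> Y)"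
    by (rule finsum_insert) (use insert.hyps cl in auto)
  also have "\<dots> = c (\<lambda>z. v X * \<omega> X z) \<oplus>\<^bsub>M\<^esub> c (\<lambda>z. \<Sum>Y\<in>A. v Y * \<omega> Y z)"
    using insert.IH insert.prems t[of X] by simp
  also have "\<dots> = c (\<lambda>z. v X * \<omega> X z + (\<Sum>Y\<in>A. v Y * \<omega> Y z))"
    using insert by (intro add V_smult V_sum) auto
  finally show ?case using insert.hyps by simp
qed

end

definition fun_on :: "'a set \<Rightarrow> ('a \<Rightarrow> int poly) set" where
  "fun_on X = {f. \<forall>x. x \<notin> X \<longrightarrow> f x = 0}"

lemma fun_onD: "f \<in> fun_on X \<Longrightarrow> x \<notin> X \<Longrightarrow> f x = 0"
  by (simp add: fun_on_def)

lemma carrier_free_mod: "carrier (free_mod X) = fun_on X"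
  by (simp add: free_mod_def fun_on_def)

section \<open>The tonal algebra and its ideal of lower terms\<close>

context cell
begin

abbreviation "A \<equiv> tonal_alg l n"
abbreviation "Tn \<equiv> tonal l n"

definition pm :: "(diagram \<Rightarrow> int poly) \<Rightarrow> (diagram \<Rightarrow> int poly) \<Rightarrow> diagram \<Rightarrow> int poly" where
  "pm f g z = (\<Sum>p\<in>Tn. \<Sum>q\<in>Tn. f p * g q * (monom 1 (loops p q) * basis_vec (dcomp p q) z))"

lemma A_simps:
  "carrier A = fun_on Tn" "f \<oplus>\<^bsub>A\<^esub> g = (\<lambda>z. f z + g z)" "\<zero>\<^bsub>A\<^esub> = (\<lambda>z. 0)"
  "k \<odot>\<^bsub>A\<^esub> f = (\<lambda>z. k * f z)" "f \<otimes>\<^bsub>A\<^esub> g = pm f g"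
  by (simp_all add: tonal_alg_def free_mod_def fun_on_def bilin_ext_def pm_def fun_eq_iff)

lemma finite_Tn: "finite Tn"
  by (rule finite_subset[OF _ finite_diagrams[of n n]]) (use tonal_diagram in blast)

lemma A_image: "fun_image A (\<lambda>f. f) (fun_on Tn)"
  by unfold_locales (simp_all add: A_simps, simp_all add: fun_on_def)

lemma Tn_closed: "p \<in> Tn \<Longrightarrow> q \<in> Tn \<Longrightarrow> dcomp p q \<in> Tn"
  using l by (intro tonal_composable.dcomp_tonal tonal_composable.intro)

lemma pm_nonzero:
  assumes "pm f g z \<noteq> 0"
  obtains p q where "p \<in> Tn" "q \<in> Tn" "f p \<noteq> 0" "g q \<noteq> 0" "z = dcomp p q"
proof -
  obtain p where p: "p \<in> Tn" "(\<Sum>q\<in>Tn. f p * g q * (monom 1 (loops p q) * basis_vec (dcomp p q) z)) \<noteq> 0"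
    using assms unfolding pm_def by (meson sum.not_neutral_contains_not_neutral)
  then obtain q where q: "q \<in> Tn" "f p * g q * (monom 1 (loops p q) * basis_vec (dcomp p q) z) \<noteq> 0"
    by (meson sum.not_neutral_contains_not_neutral)
  then have "f p \<noteq> 0" "g q \<noteq> 0" "z = dcomp p q" by (auto simp: basis_vec_def split: if_splits)
  then show ?thesis using that p q by blast
qed

lemma pm_basis:
  assumes "p \<in> Tn" "q \<in> Tn"
  shows "pm (basis_vec p) (basis_vec q) = (\<lambda>z. monom 1 (loops p q) * basis_vec (dcomp p q) z)"
proof
  fix z
  let ?h = "\<lambda>p q. monom 1 (loops p q) * basis_vec (dcomp p q) z :: int poly"
  have "pm (basis_vec p) (basis_vec q) z = (\<Sum>p'\<in>Tn. \<Sum>q'\<in>Tn. if p' = p then if q' = q then ?h p q else 0 else 0)"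
    unfolding pm_def by (intro sum.cong refl) (auto simp: basis_vec_def)
  also have "\<dots> = (\<Sum>p'\<in>Tn. if p' = p then ?h p q else 0)"
    by (rule sum.cong[OF refl]) (use finite_Tn assms in simp)
  also have "\<dots> = ?h p q" using finite_Tn assms by simp
  finally show "pm (basis_vec p) (basis_vec q) z = ?h p q" .
qed

definition Lo :: "diagram set" where
  "Lo = {p \<in> Tn. index_less l (prop_vec l p) m}"

lemma Lo_Tn: "Lo \<subseteq> Tn" by (auto simp: Lo_def)

text \<open>By antisymmetry a vector below \<open>m'\<close> cannot climb back to \<open>m\<close>,
  so strictness survives further descent.\<close>

lemma Lo_le:
  assumes p: "p \<in> Tn" and le: "index_le l (prop_vec l p) m'" and less: "index_less l m' m"
    and m': "m' \<in> index_set l n"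
  shows "p \<in> Lo"
proof -
  have le': "index_le l m' m" "m' \<noteq> m" using less by (simp_all add: index_less_def)
  have "prop_vec l p \<noteq> m"
  proof
    assume e: "prop_vec l p = m"
    \<comment> \<open>The order sees only the coordinates in \<open>{1..l}\<close>; elsewhere index
      vectors vanish.\<close>
    have "m' h = m h" for h
    proof (cases "h \<in> {1..l}")
      case True then show ?thesis using index_le_antisym[OF l le'(1) _ True] le e by simp
    next
      case False
      then have "m h = 0" "m' h = 0" using m m' unfolding index_set_def by blast+
      then show ?thesis by simp
    qed
    then show False using le'(2) by blast
  qed
  then show ?thesis using p index_le_trans[OF le le'(1)] by (simp add: Lo_def index_less_def)
qed

lemma Lo_closed:
  assumes "p \<in> Tn" "q \<in> Tn" "p \<in> Lo \<or> q \<in> Lo"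
  shows "dcomp p q \<in> Lo"
proof -
  interpret tonal_composable l n p q using l assms by unfold_locales
  show ?thesis using assms(3)
  proof
    assume "p \<in> Lo"
    then show ?thesis using Lo_le[OF dcomp_tonal prop_vec_le_left] prop_vec_index[OF l assms(1)] by (simp add: Lo_def)
  next
    assume "q \<in> Lo"
    then show ?thesis using Lo_le[OF dcomp_tonal prop_vec_le_right] prop_vec_index[OF l assms(2)] by (simp add: Lo_def)
  qed
qed

lemma C_Lo: "p \<in> C \<Longrightarrow> p \<notin> Lo"
  using C_prop_vec by (simp add: Lo_def index_less_def)

lemma flip_Lo: "flip p \<in> Lo \<longleftrightarrow> p \<in> Lo"
  using flip_tonal[of p l n] flip_tonal[of "flip p" l n] prop_vec_flip[of p l n] by (auto simp: Lo_def)

text \<open>For \<open>n = 0\<close> the index set contains only the zero vector, and nothing lies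
  strictly below it. This provides the hypothesis \<open>n \<ge> 1\<close> of
  \<open>factor\<close>.\<close>

lemma Lo_n: "p \<in> Lo \<Longrightarrow> n \<ge> 1"
proof (rule ccontr)
  assume p: "p \<in> Lo" and "\<not> n \<ge> 1"
  then have n0: "n = 0" by simp
  have z: "m' h = 0" if "m' \<in> index_set l n" for m' h
  proof (cases "h \<in> {1..l}")
    case True
    have "rank_sum l m' = 0" using that n0 by (simp add: index_set_def)
    then show ?thesis using True by (simp add: rank_sum_def)
  next
    case False then show ?thesis using that unfolding index_set_def by blast
  qed
  have "prop_vec l p = m" using z[OF prop_vec_index[OF l]] z[OF m] p by (auto simp: Lo_def fun_eq_iff)
  then show False using p by (simp add: Lo_def index_less_def)
qed

text \<open>A product through \<open>a^m'\<close> involves only diagrams whose propagating vector is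
  at most \<open>m'\<close>. Conversely, \<open>factor\<close> writes each diagram of
  \<open>Lo\<close> as one of the generating products.\<close>

lemma lower_ideal_eq: "lower_ideal l n m = fun_on Lo"
proof -
  interpret F: fun_image A "\<lambda>f. f" "fun_on Tn" by (rule A_image)
  interpret M: Module.module class_ring A by (rule F.module)
  let ?gen = "{x \<otimes>\<^bsub>A\<^esub> a_elt l n m' \<otimes>\<^bsub>A\<^esub> y | x y m'. x \<in> carrier A \<and> y \<in> carrier A \<and>
        m' \<in> index_set l n \<and> index_less l m' m}"
  have gen: "?gen \<subseteq> fun_on Lo"
  proof
    fix f assume "f \<in> ?gen"
    then obtain x y m' where f: "f = pm (pm x (a_elt l n m')) y" "m' \<in> index_set l n" "index_less l m' m"
      unfolding A_simps by blast
    interpret N: cell l n m' using l f(2) by unfold_locales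
    show "f \<in> fun_on Lo" unfolding fun_on_def
    proof (intro CollectI allI impI, rule ccontr)
      fix z assume z: "z \<notin> Lo" "f z \<noteq> 0"
      then obtain p q where pq: "p \<in> Tn" "q \<in> Tn" "pm x (a_elt l n m') p \<noteq> 0" "z = dcomp p q"
        unfolding f(1) by (metis pm_nonzero)
      obtain p' q' where p': "p' \<in> Tn" "q' \<in> Tn" "a_elt l n m' q' \<noteq> 0" "p = dcomp p' q'"
        using pq(3) by (metis pm_nonzero)
      have q': "q' = a_diagram l n m'" using p'(3) by (auto simp: a_elt_def basis_vec_def split: if_splits)
      interpret T: tonal_composable l n p' q' using l p' by unfold_locales
      have "index_le l (prop_vec l p) m'" using T.prop_vec_le_right N.prop_vec_a unfolding p'(4) q' by simp
      then have "p \<in> Lo" by (rule Lo_le[OF pq(1) _ f(3,2)])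
      then show False using Lo_closed[OF pq(1,2)] z(1) pq(4) by blast
    qed
  qed
  have Lo_A: "fun_on Lo \<subseteq> carrier A" unfolding A_simps using Lo_Tn by (auto simp: fun_on_def)
  have subm: "submodule class_ring (fun_on Lo) A"
    by (rule submodule.intro[OF F.module Lo_A]) (simp_all add: A_simps, simp_all add: fun_on_def)
  have genA: "?gen \<subseteq> carrier A" using gen Lo_A by blast
  interpret Sp: submodule class_ring "M.span ?gen" A by (rule M.span_is_submodule[OF genA])
  have basis: "basis_vec p \<in> M.span ?gen" if p: "p \<in> Lo" for p
  proof -
    have pT: "p \<in> Tn" using p Lo_Tn by blast
    let ?a = "a_diagram l n (prop_vec l p)"
    obtain x y where xy: "x \<in> Tn" "y \<in> Tn" "loops x ?a = 0" "loops (dcomp x ?a) y = 0" "dcomp (dcomp x ?a) y = p"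
      using factor[OF l pT Lo_n[OF p]] by blast
    interpret N: cell l n "prop_vec l p" using l prop_vec_index[OF l pT] by unfold_locales
    have "pm (basis_vec x) (a_elt l n (prop_vec l p)) = basis_vec (dcomp x ?a)"
      unfolding a_elt_def pm_basis[OF xy(1) N.a_tonal] xy(3) by simp
    \<comment> \<open>Both compositions are free of loops, so \<open>p\<close> appears with
      coefficient 1 and not with a power of the parameter.\<close>
    then have "basis_vec p = basis_vec x \<otimes>\<^bsub>A\<^esub> a_elt l n (prop_vec l p) \<otimes>\<^bsub>A\<^esub> basis_vec y"
      unfolding A_simps using pm_basis[OF Tn_closed[OF xy(1) N.a_tonal] xy(2)] xy(4,5) by simp
    moreover have "basis_vec x \<in> carrier A" "basis_vec y \<in> carrier A"
      unfolding A_simps using xy(1,2) by (auto simp: fun_on_def basis_vec_def)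
    ultimately have "basis_vec p \<in> ?gen" using p N.m unfolding Lo_def by blast
    then show ?thesis using M.in_own_span[OF genA] by blast
  qed
  have finLo: "finite Lo" using finite_Tn Lo_Tn by (rule finite_subset[rotated])
  have "fun_on Lo \<subseteq> M.span ?gen"
  proof
    fix f assume f: "f \<in> fun_on Lo"
    have "(\<lambda>z. if z \<in> F then f z else 0) \<in> M.span ?gen" if "finite F" "F \<subseteq> Lo" for F
      using that
    proof (induction F rule: finite_induct)
      case empty
      then show ?case using Sp.zero_closed by (simp add: A_simps)
    next
      case (insert p F)
      have "f p \<odot>\<^bsub>A\<^esub> basis_vec p \<oplus>\<^bsub>A\<^esub> (\<lambda>z. if z \<in> F then f z else 0) \<in> M.span ?gen"
        using insert basis by (intro Sp.m_closed Sp.smult_closed) auto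
      moreover have "f p \<odot>\<^bsub>A\<^esub> basis_vec p \<oplus>\<^bsub>A\<^esub> (\<lambda>z. if z \<in> F then f z else 0) = (\<lambda>z. if z \<in> insert p F then f z else 0)"
        using insert.hyps by (auto simp: A_simps basis_vec_def fun_eq_iff)
      ultimately show ?case by argo
    qed
    from this[OF finLo order_refl] show "f \<in> M.span ?gen"
    proof -
      have "(\<lambda>z. if z \<in> Lo then f z else 0) = f" using f by (auto simp: fun_on_def fun_eq_iff)
      then show ?thesis using \<open>(\<lambda>z. if z \<in> Lo then f z else 0) \<in> M.span ?gen\<close> by simp
    qed
  qed
  moreover have "M.span ?gen \<subseteq> fun_on Lo" by (rule M.span_is_subset[OF gen subm])
  ultimately show ?thesis unfolding lower_ideal_def by blast
qed

section \<open>The quotient algebra in coordinates\<close>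

abbreviation "cl \<equiv> cls l n m"

text \<open>Members of the ideal are the functions that vanish outside \<open>Lo\<close>, so adding
  them changes the values on \<open>Lo\<close> at will. From here on equality in the quotient means
  equality of coefficients outside \<open>Lo\<close>.\<close>

lemma coset_eq: "lower_ideal l n m +>\<^bsub>A\<^esub> f = {h. \<forall>z. z \<notin> Lo \<longrightarrow> h z = f z}"
proof
  show "lower_ideal l n m +>\<^bsub>A\<^esub> f \<subseteq> {h. \<forall>z. z \<notin> Lo \<longrightarrow> h z = f z}"
    unfolding a_r_coset_def' lower_ideal_eq A_simps by (auto simp: fun_on_def)
  show "{h. \<forall>z. z \<notin> Lo \<longrightarrow> h z = f z} \<subseteq> lower_ideal l n m +>\<^bsub>A\<^esub> f"
  proof
    fix h assume h: "h \<in> {h. \<forall>z. z \<notin> Lo \<longrightarrow> h z = f z}"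
    have "h = (\<lambda>z. (h z - f z) + f z)" by simp
    moreover have "(\<lambda>z. h z - f z) \<in> fun_on Lo" using h by (simp add: fun_on_def)
    ultimately show "h \<in> lower_ideal l n m +>\<^bsub>A\<^esub> f" unfolding a_r_coset_def' lower_ideal_eq A_simps by blast
  qed
qed

lemma cl_eq: "cl f = {h. \<forall>z. z \<notin> Lo \<longrightarrow> h z = f z}"
  unfolding cls_def by (rule coset_eq)

lemma cl_cong: "(\<And>z. z \<notin> Lo \<Longrightarrow> f z = g z) \<Longrightarrow> cl f = cl g"
  unfolding cl_eq by auto

lemma cl_eqD: "cl f = cl g \<Longrightarrow> z \<notin> Lo \<Longrightarrow> f z = g z"
  unfolding cl_eq by blast

lemma cl_self: "f \<in> cl f" unfolding cl_eq by simp

text \<open>A product of diagrams that is not in \<open>Lo\<close> has both factors outside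
  \<open>Lo\<close>.\<close>

lemma pm_cong:
  assumes f: "\<And>z. z \<notin> Lo \<Longrightarrow> f z = f' z" and g: "\<And>z. z \<notin> Lo \<Longrightarrow> g z = g' z" and z: "z \<notin> Lo"
  shows "pm f g z = pm f' g' z"
  unfolding pm_def
proof (rule sum.cong[OF refl], rule sum.cong[OF refl])
  fix p q assume pq: "p \<in> Tn" "q \<in> Tn"
  show "f p * g q * (monom 1 (loops p q) * basis_vec (dcomp p q) z)
      = f' p * g' q * (monom 1 (loops p q) * basis_vec (dcomp p q) z)"
  proof (cases "dcomp p q = z")
    case True
    then have "p \<notin> Lo" "q \<notin> Lo" using Lo_closed[OF pq] z by blast+
    then show ?thesis using f g by simp
  qed (simp add: basis_vec_def)
qed

abbreviation "Q \<equiv> cell_alg l n m"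

lemma Q_mult: "cl f \<otimes>\<^bsub>Q\<^esub> cl g = cl (pm f g)"
proof -
  have "cl f \<otimes>\<^bsub>Q\<^esub> cl g = (\<Union>x\<in>cl f. \<Union>y\<in>cl g. cl (pm x y))"
    by (simp add: cell_alg_def quot_alg_def FactRing_def rcoset_mult_def A_simps cls_def)
  moreover have "cl (pm x y) = cl (pm f g)" if "x \<in> cl f" "y \<in> cl g" for x y
    by (rule cl_cong, rule pm_cong) (use that in \<open>simp_all add: cl_eq\<close>)
  ultimately show ?thesis using cl_self by blast
qed

lemma Q_add: "cl f \<oplus>\<^bsub>Q\<^esub> cl g = cl (\<lambda>z. f z + g z)"
proof -
  have "cl f \<oplus>\<^bsub>Q\<^esub> cl g = (\<Union>x\<in>cl f. \<Union>y\<in>cl g. {\<lambda>z. x z + y z})"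
    by (simp add: cell_alg_def quot_alg_def FactRing_def set_add_def' A_simps)
  also have "\<dots> = cl (\<lambda>z. f z + g z)"
  proof
    show "(\<Union>x\<in>cl f. \<Union>y\<in>cl g. {\<lambda>z. x z + y z}) \<subseteq> cl (\<lambda>z. f z + g z)" unfolding cl_eq by auto
    show "cl (\<lambda>z. f z + g z) \<subseteq> (\<Union>x\<in>cl f. \<Union>y\<in>cl g. {\<lambda>z. x z + y z})"
    proof
      fix h assume h: "h \<in> cl (\<lambda>z. f z + g z)"
      have "(\<lambda>z. h z - f z) \<in> cl g" using h by (simp add: cl_eq)
      moreover have "h = (\<lambda>z. f z + (h z - f z))" by simp
      ultimately show "h \<in> (\<Union>x\<in>cl f. \<Union>y\<in>cl g. {\<lambda>z. x z + y z})" using cl_self[of f] by blast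
    qed
  qed
  finally show ?thesis .
qed

lemma Q_smult: "k \<odot>\<^bsub>Q\<^esub> cl f = cl (\<lambda>z. k * f z)"
proof -
  have "k \<odot>\<^bsub>Q\<^esub> cl f = (\<Union>x\<in>cl f. cl (\<lambda>z. k * x z))"
    by (simp add: cell_alg_def quot_alg_def A_simps cls_def)
  moreover have "cl (\<lambda>z. k * x z) = cl (\<lambda>z. k * f z)" if "x \<in> cl f" for x
    by (rule cl_cong) (use that in \<open>simp add: cl_eq\<close>)
  ultimately show ?thesis using cl_self by blast
qed

lemma Q_zero: "\<zero>\<^bsub>Q\<^esub> = cl (\<lambda>z. 0)"
  by (simp add: cell_alg_def quot_alg_def FactRing_def lower_ideal_eq cl_eq fun_on_def)

lemma Q_carrier: "carrier Q = cl ` fun_on Tn"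
  by (auto simp: cell_alg_def quot_alg_def FactRing_def A_RCOSETS_def' A_simps cls_def)

lemma opmap_eq: "h \<in> fun_on Tn \<Longrightarrow> opmap l n h = (\<lambda>z. h (flip z))"
proof
  fix z assume h: "h \<in> fun_on Tn"
  have "opmap l n h z = (\<Sum>x\<in>Tn. if x = flip z then h x else 0)"
    unfolding opmap_def lin_ext_def by (rule sum.cong[OF refl]) (auto simp: basis_vec_def)
  also have "\<dots> = h (flip z)" using finite_Tn fun_onD[OF h, of "flip z"] by simp
  finally show "opmap l n h z = h (flip z)" .
qed

lemma cl_sub: "f \<in> fun_on Tn \<Longrightarrow> cl f \<subseteq> fun_on Tn"
  using Lo_Tn unfolding cl_eq fun_on_def by auto

text \<open>Reflection preserves \<open>Lo\<close> and so acts on cosets. As a sum over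
  \<open>Tn\<close>, \<open>opmap\<close> agrees with precomposition by \<open>flip\<close> because
  the members of the coset are supported on \<open>Tn\<close>.\<close>

lemma cell_op_cl:
  assumes f: "f \<in> fun_on Tn"
  shows "cell_op l n (cl f) = cl (\<lambda>z. f (flip z))"
proof -
  have "cell_op l n (cl f) = (\<lambda>h z. h (flip z)) ` cl f"
    unfolding cell_op_def by (rule image_cong[OF refl]) (use cl_sub[OF f] opmap_eq in blast)
  also have "\<dots> = cl (\<lambda>z. f (flip z))"
  proof
    show "(\<lambda>h z. h (flip z)) ` cl f \<subseteq> cl (\<lambda>z. f (flip z))" unfolding cl_eq using flip_Lo by auto
    show "cl (\<lambda>z. f (flip z)) \<subseteq> (\<lambda>h z. h (flip z)) ` cl f"
    proof
      fix h assume h: "h \<in> cl (\<lambda>z. f (flip z))"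
      show "h \<in> (\<lambda>h z. h (flip z)) ` cl f"
      proof (rule image_eqI)
        show "h = (\<lambda>z. (\<lambda>y. h (flip y)) (flip z))" by simp
        show "(\<lambda>y. h (flip y)) \<in> cl f" unfolding cl_eq
        proof (intro CollectI allI impI)
          fix z assume "z \<notin> Lo"
          then have "flip z \<notin> Lo" by (simp add: flip_Lo)
          then show "h (flip z) = f z" using h unfolding cl_eq by simp
        qed
      qed
    qed
  qed
  finally show ?thesis .
qed

section \<open>Left ideal, right action and standard module in coordinates\<close>

definition trunc :: "(diagram \<Rightarrow> int poly) \<Rightarrow> diagram \<Rightarrow> int poly" where
  "trunc h z = (if z \<in> C then h z else 0)"

lemma trunc_fun_on: "trunc h \<in> fun_on C" by (simp add: trunc_def fun_on_def)

lemma fun_on_C_Tn: "f \<in> fun_on C \<Longrightarrow> f \<in> fun_on Tn"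
  using C_tonal by (auto simp: fun_on_def)

lemma dcomp_C_Lo: "p \<in> Tn \<Longrightarrow> q \<in> C \<Longrightarrow> dcomp p q \<in> C \<or> dcomp p q \<in> Lo"
  using dcomp_C_cases Tn_closed C_tonal by (auto simp: Lo_def)

text \<open>Modulo \<open>Lo\<close> a product with \<open>a\<close> is supported on
  \<open>C\<close>. Truncation to \<open>C\<close> yields the representative on which
  \<open>cell_act\<close> operates.\<close>

lemma cell_left_ideal_eq:
  "cell_left_ideal l n m = (\<lambda>g. cl (trunc (pm g (basis_vec a)))) ` fun_on Tn"
proof -
  have "cl (pm g (basis_vec a)) = cl (trunc (pm g (basis_vec a)))" for g
  proof (rule cl_cong)
    fix z assume z: "z \<notin> Lo"
    have "pm g (basis_vec a) z = 0" if "z \<notin> C"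
    proof (rule ccontr)
      assume "pm g (basis_vec a) z \<noteq> 0"
      then obtain p q where "p \<in> Tn" "basis_vec a q \<noteq> (0 :: int poly)" "z = dcomp p q" by (metis pm_nonzero)
      then show False using dcomp_C_Lo[OF _ a_C, of p] z that by (auto simp: basis_vec_def split: if_splits)
    qed
    then show "pm g (basis_vec a) z = trunc (pm g (basis_vec a)) z" by (simp add: trunc_def)
  qed
  moreover have "cell_left_ideal l n m = (\<lambda>g. cl (pm g (basis_vec a))) ` fun_on Tn"
  proof -
    have "{X \<otimes>\<^bsub>Q\<^esub> Y | X. X \<in> cl ` V} = (\<lambda>g. cl g \<otimes>\<^bsub>Q\<^esub> Y) ` V" for V Y by blast
    then show ?thesis unfolding cell_left_ideal_def Q_carrier a_elt_def Q_mult[symmetric] .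
  qed
  ultimately show ?thesis by simp
qed

lemma ract_fun_on: "ract f x \<in> fun_on C"
  unfolding fun_on_def
proof (intro CollectI allI impI)
  fix z assume "z \<notin> C"
  then have "f p * x \<sigma> * basis_vec (act p \<sigma>) z = 0" if "p \<in> C" "\<sigma> \<in> S" for p \<sigma>
    using act_C[OF that] by (auto simp: basis_vec_def)
  then show "ract f x z = 0" unfolding ract_def by (intro sum.neutral ballI) blast
qed

lemma cl_inj: "f \<in> fun_on C \<Longrightarrow> g \<in> fun_on C \<Longrightarrow> cl f = cl g \<Longrightarrow> f = g"
proof
  fix z assume a: "f \<in> fun_on C" "g \<in> fun_on C" "cl f = cl g"
  show "f z = g z"
  proof (cases "z \<in> C")
    case True then show ?thesis using cl_eqD[OF a(3)] C_Lo by blast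
  next
    case False then show ?thesis using a by (simp add: fun_on_def)
  qed
qed

text \<open>\<open>C\<close> and \<open>Lo\<close> are disjoint, so the expansion of a class in the
  diagrams of \<open>C\<close> is unique and the description operator finds it.\<close>

lemma cell_act_cl:
  assumes f: "f \<in> fun_on C"
  shows "cell_act l n m (cl f) x = cl (ract f x)"
proof -
  have r: "bilin_ext C S (\<lambda>p \<sigma>. basis_vec (act p \<sigma>)) g x = ract g x" for g
    by (simp add: bilin_ext_def ract_def fun_eq_iff)
  show ?thesis
    unfolding cell_act_def carrier_free_mod r
    by (rule the_equality) (use f cl_inj[OF f] in blast)+
qed

text \<open>Right multiplication by \<open>a\<close> followed by the action of \<open>x\<close>, on
  representatives. It is linear on the whole algebra, which exhibits the standard module as a linear
  image.\<close>

definition \<Phi> :: "(perms \<Rightarrow> int poly) \<Rightarrow> (diagram \<Rightarrow> int poly) \<Rightarrow> diagram \<Rightarrow> int poly" where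
  "\<Phi> x g = ract (trunc (pm g (basis_vec a))) x"

lemma \<Phi>_fun_on: "\<Phi> x g \<in> fun_on C" unfolding \<Phi>_def by (rule ract_fun_on)

lemma \<Phi>_linear:
  "\<Phi> x (\<lambda>z. f z + g z) = (\<lambda>z. \<Phi> x f z + \<Phi> x g z)"
  "\<Phi> x (\<lambda>z. k * f z) = (\<lambda>z. k * \<Phi> x f z)"
proof -
  have "pm (\<lambda>z. f z + g z) h = (\<lambda>z. pm f h z + pm g h z)" for h
    by (simp add: pm_def fun_eq_iff algebra_simps sum.distrib)
  then have "trunc (pm (\<lambda>z. f z + g z) h) = (\<lambda>z. trunc (pm f h) z + trunc (pm g h) z)" for h
    by (simp add: trunc_def fun_eq_iff)
  then show "\<Phi> x (\<lambda>z. f z + g z) = (\<lambda>z. \<Phi> x f z + \<Phi> x g z)"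
    by (simp add: \<Phi>_def ract_def fun_eq_iff algebra_simps sum.distrib)
  have "pm (\<lambda>z. k * f z) h = (\<lambda>z. k * pm f h z)" for h
    by (simp add: pm_def fun_eq_iff mult.assoc sum_distrib_left)
  then have "trunc (pm (\<lambda>z. k * f z) h) = (\<lambda>z. k * trunc (pm f h) z)" for h
    by (simp add: trunc_def fun_eq_iff)
  then show "\<Phi> x (\<lambda>z. k * f z) = (\<lambda>z. k * \<Phi> x f z)"
    by (simp add: \<Phi>_def ract_def fun_eq_iff mult.assoc sum_distrib_left)
qed

lemma std_image: "fun_image (std_module l n m e) cl (\<Phi> (int_coeffs e) ` fun_on Tn)"
proof
  let ?x = "int_coeffs e"
  show "carrier (std_module l n m e) = cl ` \<Phi> ?x ` fun_on Tn"
    unfolding std_module_def cell_left_ideal_eq \<Phi>_def by (simp add: image_image cell_act_cl trunc_fun_on)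
  show "(\<lambda>z. 0) \<in> \<Phi> ?x ` fun_on Tn"
  proof (rule image_eqI)
    show "(\<lambda>z. 0) = \<Phi> ?x (\<lambda>z. 0 * 0)" unfolding \<Phi>_linear by simp
  qed (simp add: fun_on_def)
  fix f g assume f: "f \<in> \<Phi> ?x ` fun_on Tn"
  then obtain f' where f': "f' \<in> fun_on Tn" "f = \<Phi> ?x f'" by blast
  show "(\<lambda>z. k * f z) \<in> \<Phi> ?x ` fun_on Tn" for k
    unfolding f'(2) \<Phi>_linear(2)[symmetric] by (rule imageI) (use f' in \<open>simp add: fun_on_def\<close>)
  assume g: "g \<in> \<Phi> ?x ` fun_on Tn"
  then obtain g' where g': "g' \<in> fun_on Tn" "g = \<Phi> ?x g'" by blast
  show "(\<lambda>z. f z + g z) \<in> \<Phi> ?x ` fun_on Tn"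
    unfolding f'(2) g'(2) \<Phi>_linear(1)[symmetric] by (rule imageI) (use f' g' in \<open>simp add: fun_on_def\<close>)
qed (simp_all add: std_module_def Q_add Q_smult Q_zero)

section \<open>The contravariant form in coordinates\<close>

lemma pm_flip:
  assumes w: "w \<in> fun_on C" and w': "w' \<in> fun_on C"
  shows "pm (\<lambda>z. w (flip z)) w' z
    = (\<Sum>p\<in>C. \<Sum>q\<in>C. w p * w' q * (monom 1 (loops (flip p) q) * basis_vec (dcomp (flip p) q) z))"
proof -
  let ?h = "\<lambda>p q. w p * w' q * (monom 1 (loops (flip p) q) * basis_vec (dcomp (flip p) q) z)"
  have CT: "C \<subseteq> Tn" using C_tonal by blast
  have b: "bij_betw flip Tn Tn"
    by (rule bij_betw_byWitness[where f' = flip]) (auto simp: flip_tonal)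
  have "pm (\<lambda>z. w (flip z)) w' z = (\<Sum>p\<in>Tn. \<Sum>q\<in>Tn. ?h (flip p) q)" unfolding pm_def by simp
  also have "\<dots> = (\<Sum>p\<in>Tn. \<Sum>q\<in>Tn. ?h p q)" by (rule sum.reindex_bij_betw[OF b])
  also have "\<dots> = (\<Sum>p\<in>C. \<Sum>q\<in>Tn. ?h p q)"
    by (rule sum.mono_neutral_right[OF finite_Tn CT]) (use w in \<open>auto simp: fun_on_def\<close>)
  also have "\<dots> = (\<Sum>p\<in>C. \<Sum>q\<in>C. ?h p q)"
    by (intro sum.cong refl sum.mono_neutral_right[OF finite_Tn CT]) (use w' in \<open>auto simp: fun_on_def\<close>)
  finally show ?thesis .
qed

text \<open>Outside \<open>Lo\<close> the product is supported on the orbit of \<open>a\<close>,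
  where its coefficients are values of \<open>Bf\<close>. By \<open>Bf_sandwich\<close> they are the
  coefficients of some \<open>e b e\<close>, hence of a multiple of \<open>e\<close>, and the
  multiplier is the form. Evaluation at the identity gives the equation.\<close>

lemma contra_form_eq:
  assumes sym: "\<And>\<sigma>. \<sigma> \<in> S \<Longrightarrow> e (perms_inv \<sigma>) = e \<sigma>"
    and mid: "\<And>x. x \<in> carrier (group_alg l m) \<Longrightarrow> \<exists>k.
        int_coeffs e \<otimes>\<^bsub>group_alg l m\<^esub> x \<otimes>\<^bsub>group_alg l m\<^esub> int_coeffs e = k \<odot>\<^bsub>group_alg l m\<^esub> int_coeffs e"
    and ne: "\<rho>0 \<in> S" "e \<rho>0 \<noteq> 0"
  defines "E \<equiv> int_coeffs e"
  shows "contra_form l n m e (cl (ract f E)) (cl (ract g E)) * E (\<lambda>i. id) = Bf (ract f E) (ract g E) (\<lambda>i. id)"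
proof -
  let ?w = "ract f E" and ?w' = "ract g E"
  let ?GA = "group_alg l m"
  \<comment> \<open>\<open>Bf f g\<close> cut off outside \<open>S\<close>, so that it becomes an
    element of the group algebra.\<close>
  define b where "b \<rho> = (if \<rho> \<in> S then Bf f g \<rho> else 0)" for \<rho>
  have "b \<in> carrier ?GA" by (simp add: b_def group_alg_def free_mod_def)
  then obtain k where k: "E \<otimes>\<^bsub>?GA\<^esub> b \<otimes>\<^bsub>?GA\<^esub> E = k \<odot>\<^bsub>?GA\<^esub> E" using mid unfolding E_def by blast
  have "E \<otimes>\<^bsub>?GA\<^esub> b = E \<otimes>\<^bsub>?GA\<^esub> Bf f g"
    unfolding fun_eq_iff group_alg_mult b_def by (auto intro!: sum.cong)
  then have k': "(E \<otimes>\<^bsub>?GA\<^esub> Bf f g \<otimes>\<^bsub>?GA\<^esub> E) \<rho> = k * E \<rho>" for \<rho>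
    using k by (simp add: group_alg_def free_mod_def)
  have Bk: "Bf ?w ?w' \<rho> = k * E \<rho>" if "\<rho> \<in> S" for \<rho>
    unfolding k'[symmetric] by (rule Bf_sandwich[OF that]) (simp add: E_def int_coeffs_def sym)
  have aE: "ract (basis_vec a) E z = (\<Sum>\<sigma>\<in>S. E \<sigma> * basis_vec (act a \<sigma>) z)" for z
  proof -
    have "ract (basis_vec a) E z = (\<Sum>p\<in>C. if p = a then (\<Sum>\<sigma>\<in>S. E \<sigma> * basis_vec (act a \<sigma>) z) else 0)"
      unfolding ract_def by (rule sum.cong[OF refl]) (auto simp: basis_vec_def)
    then show ?thesis using finite_C a_C by simp
  qed
  \<comment> \<open>The symmetric groups act freely on \<open>a\<close>, so the coefficients of
    \<open>e\<close> can be read off along its orbit.\<close>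
  have aE_orbit: "ract (basis_vec a) E (act a \<rho>) = E \<rho>" if \<rho>: "\<rho> \<in> S" for \<rho>
  proof -
    have "ract (basis_vec a) E (act a \<rho>) = (\<Sum>\<sigma>\<in>S. if \<sigma> = \<rho> then E \<sigma> else 0)"
      unfolding aE by (rule sum.cong[OF refl]) (use orbit_inj[OF _ \<rho>] in \<open>auto simp: basis_vec_def\<close>)
    then show ?thesis using \<rho> finite_sym_prod[of l m] by simp
  qed
  have lhs: "cell_op l n (cl ?w) \<otimes>\<^bsub>Q\<^esub> cl ?w' = cl (pm (\<lambda>z. ?w (flip z)) ?w')"
    unfolding cell_op_cl[OF fun_on_C_Tn[OF ract_fun_on]] Q_mult ..
  have a_fun: "basis_vec a \<in> fun_on C" using a_C by (auto simp: fun_on_def basis_vec_def)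
  have rhs: "c \<odot>\<^bsub>Q\<^esub> cell_act l n m (cl (a_elt l n m)) (int_coeffs e) = cl (\<lambda>z. c * ract (basis_vec a) E z)" for c
    unfolding a_elt_def cell_act_cl[OF a_fun] Q_smult E_def ..
  have eq: "cl (pm (\<lambda>z. ?w (flip z)) ?w') = cl (\<lambda>z. k * ract (basis_vec a) E z)"
  proof (rule cl_cong)
    fix z assume z: "z \<notin> Lo"
    show "pm (\<lambda>z. ?w (flip z)) ?w' z = k * ract (basis_vec a) E z"
    proof (cases "\<exists>\<rho>\<in>S. z = act a \<rho>")
      case True
      then obtain \<rho> where \<rho>: "\<rho> \<in> S" "z = act a \<rho>" by blast
      have "pm (\<lambda>z. ?w (flip z)) ?w' z = Bf ?w ?w' \<rho>"
        unfolding pm_flip[OF ract_fun_on ract_fun_on] Bf_def \<rho>(2)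
        by (intro sum.cong refl) (auto simp: basis_vec_def)
      then show ?thesis unfolding \<rho>(2) aE_orbit[OF \<rho>(1)] using Bk[OF \<rho>(1)] by simp
    next
      case False
      \<comment> \<open>Off the orbit both sides vanish: a product of a reflected \<open>p\<close>
        with \<open>q\<close> that is not lower lies on the orbit by
        \<open>dcomp_flip_orbit\<close>.\<close>
      have "basis_vec (act a \<sigma>) z = (0 :: int poly)" if "\<sigma> \<in> S" for \<sigma>
        using False that by (auto simp: basis_vec_def)
      then have 0: "ract (basis_vec a) E z = 0" unfolding aE by simp
      have "basis_vec (dcomp (flip p) q) z = (0 :: int poly)" if pq: "p \<in> C" "q \<in> C" for p q
      proof (rule ccontr)
        assume "basis_vec (dcomp (flip p) q) z \<noteq> (0 :: int poly)"
        then have e: "z = dcomp (flip p) q" by (auto simp: basis_vec_def split: if_splits)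
        then have "dcomp (flip p) q \<in> C" using dcomp_C_Lo[OF flip_tonal[OF C_tonal[OF pq(1)]] pq(2)] z by blast
        then show False using dcomp_flip_orbit[OF pq] False e by blast
      qed
      then have "pm (\<lambda>z. ?w (flip z)) ?w' z = 0" unfolding pm_flip[OF ract_fun_on ract_fun_on] by simp
      then show ?thesis unfolding 0 by simp
    qed
  qed
  have "contra_form l n m e (cl ?w) (cl ?w') = k"
    unfolding contra_form_def lhs rhs
  proof (rule the_equality)
    show "cl (pm (\<lambda>z. ?w (flip z)) ?w') = cl (\<lambda>z. k * ract (basis_vec a) E z)" by (rule eq)
    fix c assume "cl (pm (\<lambda>z. ?w (flip z)) ?w') = cl (\<lambda>z. c * ract (basis_vec a) E z)"
    then have "cl (\<lambda>z. c * ract (basis_vec a) E z) = cl (\<lambda>z. k * ract (basis_vec a) E z)" using eq by simp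
    \<comment> \<open>A nonzero coefficient of \<open>e\<close> determines the scalar, as the ground
      ring has no zero divisors.\<close>
    from cl_eqD[OF this C_Lo[OF act_C[OF a_C ne(1)]]] have "c * E \<rho>0 = k * E \<rho>0" unfolding aE_orbit[OF ne(1)] .
    moreover have "E \<rho>0 \<noteq> 0" using ne(2) by (simp add: E_def int_coeffs_def)
    ultimately show "c = k" by simp
  qed
  then show ?thesis using Bk[OF perms_one_closed] by simp
qed

lemma Bf_sum:
  "Bf (\<lambda>z. \<Sum>i\<in>J. v i * w i z) (\<lambda>z. \<Sum>i\<in>J. v i * w i z) \<rho> = (\<Sum>i\<in>J. \<Sum>j\<in>J. v i * (v j * Bf (w i) (w j) \<rho>))"
proof -
  define K where "K p q = (if dcomp (flip p) q = act a \<rho> then monom 1 (loops (flip p) q) else (0 :: int poly))" for p q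
  have "Bf (\<lambda>z. \<Sum>i\<in>J. v i * w i z) (\<lambda>z. \<Sum>i\<in>J. v i * w i z) \<rho>
     = (\<Sum>p\<in>C. \<Sum>q\<in>C. \<Sum>i\<in>J. \<Sum>j\<in>J. v i * (v j * (w i p * w j q * K p q)))"
    unfolding Bf_def K_def[symmetric] sum_product sum_distrib_right
    by (intro sum.cong refl) (simp add: sum_distrib_left mult_ac)
  also have "\<dots> = (\<Sum>p\<in>C. \<Sum>i\<in>J. \<Sum>q\<in>C. \<Sum>j\<in>J. v i * (v j * (w i p * w j q * K p q)))"
    by (rule sum.cong[OF refl]) (rule sum.swap)
  also have "\<dots> = (\<Sum>i\<in>J. \<Sum>p\<in>C. \<Sum>q\<in>C. \<Sum>j\<in>J. v i * (v j * (w i p * w j q * K p q)))" by (rule sum.swap)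
  also have "\<dots> = (\<Sum>i\<in>J. \<Sum>p\<in>C. \<Sum>j\<in>J. \<Sum>q\<in>C. v i * (v j * (w i p * w j q * K p q)))"
    by (rule sum.cong[OF refl], rule sum.cong[OF refl]) (rule sum.swap)
  also have "\<dots> = (\<Sum>i\<in>J. \<Sum>j\<in>J. \<Sum>p\<in>C. \<Sum>q\<in>C. v i * (v j * (w i p * w j q * K p q)))"
    by (rule sum.cong[OF refl]) (rule sum.swap)
  also have "\<dots> = (\<Sum>i\<in>J. \<Sum>j\<in>J. v i * (v j * Bf (w i) (w j) \<rho>))"
    unfolding Bf_def K_def[symmetric] by (simp add: sum_distrib_left)
  finally show ?thesis .
qed

end

section \<open>Nonvanishing of the Gram determinant\<close>

theorem lemma9p2:
  fixes l n :: nat and m :: "nat \<Rightarrow> nat" and lam :: "nat \<Rightarrow> nat list"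
    and e :: "perms \<Rightarrow> int" and bs :: "(diagram \<Rightarrow> int poly) set list"
  assumes "l \<ge> 1"
    and "(m, lam) \<in> labels l n"
    and "specht_element l m lam e"
    and "is_basis (std_module l n m e) bs"
  shows "det (gram_matrix l n m e bs) \<noteq> 0"
proof
  assume det0: "det (gram_matrix l n m e bs) = 0"
  interpret cell l n m using assms(1,2) by unfold_locales (auto simp: labels_def)
  define E where "E = int_coeffs e"
  let ?M = "std_module l n m e"
  interpret F: fun_image ?M cl "\<Phi> E ` fun_on Tn" unfolding E_def by (rule std_image)
  have e_supp: "e \<sigma> = 0" if "\<sigma> \<notin> S" for \<sigma> using assms(3) that unfolding specht_element_def by blast
  have e_sym: "e (perms_inv \<sigma>) = e \<sigma>" if "\<sigma> \<in> S" for \<sigma> using assms(3) that unfolding specht_element_def by blast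
  have e_mid: "\<exists>k. int_coeffs e \<otimes>\<^bsub>group_alg l m\<^esub> x \<otimes>\<^bsub>group_alg l m\<^esub> int_coeffs e = k \<odot>\<^bsub>group_alg l m\<^esub> int_coeffs e"
    if "x \<in> carrier (group_alg l m)" for x using assms(3) that unfolding specht_element_def by blast
  have bs: "distinct bs" "set bs \<subseteq> carrier ?M" "\<not> LinearCombinations.module.lin_dep class_ring ?M (set bs)"
    using assms(4) unfolding is_basis_def by blast+
  let ?N = "length bs"
  let ?Gm = "gram_matrix l n m e bs"
  have Gc: "?Gm \<in> carrier_mat ?N ?N" by (simp add: gram_matrix_def)
  \<comment> \<open>A singular square matrix over an integral domain has a nonzero null vector with
    entries in the domain.\<close>
  obtain v where v: "v \<in> carrier_vec ?N" "v \<noteq> 0\<^sub>v ?N" "?Gm *\<^sub>v v = 0\<^sub>v ?N"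
    using det0 det_0_iff_vec_prod_zero[OF Gc] by blast
  have "\<exists>\<omega>. \<forall>X\<in>set bs. \<omega> X \<in> fun_on Tn \<and> cl (\<Phi> E (\<omega> X)) = X"
    by (rule bchoice) (use bs(2) in \<open>auto simp: F.carrier\<close>)
  then obtain \<omega> where \<omega>: "\<And>X. X \<in> set bs \<Longrightarrow> \<omega> X \<in> fun_on Tn \<and> cl (\<Phi> E (\<omega> X)) = X" by blast
  define W' where "W' i = \<Phi> E (\<omega> (bs ! i))" for i
  define w where "w = (\<lambda>z. \<Sum>i<?N. v $ i * W' i z)"
  have bs_i: "cl (W' i) = bs ! i" if "i < ?N" for i using \<omega>[of "bs ! i"] that by (simp add: W'_def)
  \<comment> \<open>Otherwise the entries of \<open>v\<close> would form a linear relation between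
    the basis elements.\<close>
  have w_ne: "w \<noteq> (\<lambda>z. 0)"
  proof
    assume w0: "w = (\<lambda>z. 0)"
    \<comment> \<open>Linear dependence is stated with coefficients attached to elements, so the
      entries of \<open>v\<close> are carried over from positions to elements; distinctness of
      \<open>bs\<close> makes this possible.\<close>
    define idx where "idx X = (THE i. i < ?N \<and> bs ! i = X)" for X
    have idx: "idx (bs ! i) = i" if "i < ?N" for i
      unfolding idx_def using bs(1) that by (intro the_equality) (auto simp: nth_eq_iff_index_eq)
    define cf where "cf X = v $ idx X" for X
    have b: "bij_betw (\<lambda>i. bs ! i) {..<?N} (set bs)" by (rule bij_betw_nth[OF bs(1)]) auto
    have "(\<lambda>z. \<Sum>X\<in>set bs. cf X * \<Phi> E (\<omega> X) z) = w"
    proof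
      fix z
      have "(\<Sum>X\<in>set bs. cf X * \<Phi> E (\<omega> X) z) = (\<Sum>i<?N. cf (bs ! i) * \<Phi> E (\<omega> (bs ! i)) z)"
        by (rule sum.reindex_bij_betw[OF b, symmetric])
      also have "\<dots> = w z" unfolding w_def W'_def by (rule sum.cong[OF refl]) (simp add: cf_def idx)
      finally show "(\<Sum>X\<in>set bs. cf X * \<Phi> E (\<omega> X) z) = w z" .
    qed
    moreover have "(\<Oplus>\<^bsub>?M\<^esub>X\<in>set bs. cf X \<odot>\<^bsub>?M\<^esub> X) = cl (\<lambda>z. \<Sum>X\<in>set bs. cf X * \<Phi> E (\<omega> X) z)"
      by (rule F.finsum_image) (use \<omega> in auto)
    ultimately have "(\<Oplus>\<^bsub>?M\<^esub>X\<in>set bs. cf X \<odot>\<^bsub>?M\<^esub> X) = \<zero>\<^bsub>?M\<^esub>" using w0 F.zero by simp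
    then have lc: "LinearCombinations.module.lincomb ?M cf (set bs) = \<zero>\<^bsub>?M\<^esub>"
      unfolding LinearCombinations.module.lincomb_def[OF F.module] .
    have "\<exists>i<?N. v $ i \<noteq> 0"
    proof (rule ccontr)
      assume "\<not> ?thesis"
      then have "v = 0\<^sub>v ?N" using v(1) by (intro eq_vecI) auto
      then show False using v(2) by blast
    qed
    then obtain i where i: "i < ?N" "v $ i \<noteq> 0" by blast
    have "LinearCombinations.module.lin_dep class_ring ?M (set bs)"
      unfolding LinearCombinations.module.lin_dep_def[OF F.module]
    proof (intro exI conjI)
      show "LinearCombinations.module.lincomb ?M cf (set bs) = \<zero>\<^bsub>?M\<^esub>" by (rule lc)
      show "bs ! i \<in> set bs" using i(1) by simp
      show "cf (bs ! i) \<noteq> \<zero>\<^bsub>class_ring\<^esub>" using i by (simp add: cf_def idx)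
    qed simp_all
    then show False using bs(3) by blast
  qed
  then obtain z where z: "w z \<noteq> 0" by blast
  have w_C: "w \<in> fun_on C" unfolding w_def W'_def using \<Phi>_fun_on by (simp add: fun_on_def)
  have zC: "z \<in> C" using z fun_onD[OF w_C] by blast
  \<comment> \<open>If \<open>e\<close> vanished on \<open>S\<close>, its action would annihilate
    everything and \<open>w\<close> would be 0.\<close>
  have "\<exists>\<rho>\<in>S. e \<rho> \<noteq> 0"
  proof (rule ccontr)
    assume "\<not> (\<exists>\<rho>\<in>S. e \<rho> \<noteq> 0)"
    then have "E \<sigma> = 0" if "\<sigma> \<in> S" for \<sigma> using that by (simp add: E_def int_coeffs_def)
    then have "W' i z = 0" for i unfolding W'_def \<Phi>_def ract_def by simp
    then show False using z by (simp add: w_def)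
  qed
  then obtain \<rho>0 where \<rho>0: "\<rho>0 \<in> S" "e \<rho>0 \<noteq> 0" by blast
  have form: "Bf (W' i) (W' j) (\<lambda>i. id) = ?Gm $$ (i, j) * E (\<lambda>i. id)" if "i < ?N" "j < ?N" for i j
  proof -
    have "Bf (W' i) (W' j) (\<lambda>i. id) = contra_form l n m e (cl (W' i)) (cl (W' j)) * E (\<lambda>i. id)"
      unfolding W'_def \<Phi>_def E_def 
      by (rule contra_form_eq[where e = e, symmetric]) (use e_sym e_mid \<rho>0 in blast)+
    moreover have "?Gm $$ (i, j) = contra_form l n m e (bs ! i) (bs ! j)"
      using that by (simp add: gram_matrix_def)
    ultimately show ?thesis unfolding bs_i[OF that(1)] bs_i[OF that(2)] by (simp only:)
  qed
  have row: "(\<Sum>j<?N. ?Gm $$ (i, j) * v $ j) = 0" if i: "i < ?N" for i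
  proof -
    have "(\<Sum>j<?N. ?Gm $$ (i, j) * v $ j) = (?Gm *\<^sub>v v) $ i"
      using i v(1) Gc by (simp add: scalar_prod_def lessThan_atLeast0)
    then show ?thesis using v(3) i by simp
  qed
  \<comment> \<open>The inner sums become entries of the Gram matrix applied to \<open>v\<close>, so
    \<open>w\<close> is orthogonal to itself.\<close>
  have "Bf w w (\<lambda>i. id) = (\<Sum>i<?N. \<Sum>j<?N. v $ i * (v $ j * Bf (W' i) (W' j) (\<lambda>i. id)))"
    unfolding w_def by (rule Bf_sum)
  also have "\<dots> = (\<Sum>i<?N. v $ i * E (\<lambda>i. id) * (\<Sum>j<?N. ?Gm $$ (i, j) * v $ j))"
    unfolding sum_distrib_left by (intro sum.cong refl) (simp add: form mult_ac)
  also have "\<dots> = 0" using row by simp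
  finally show False using Bf_nonzero[of z w] zC z by blast
qed

end
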